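(* In the setting and with the notation of the context, the min-max robust tracking problem $$\textbf{(P1)}\qquad \min_{u\in\mathbb{R}^{mT_e}}\ \max_{w,g}\ \sum_{k=0}^{T_e-1}\left(\|y_k-r_k\|_Q^2+\|u_k\|_R^2\right)$$ $$\text{s.t.}\quad \begin{bmatrix} U_p \\ Y_p \\ U_f \\ Y_f \end{bmatrix} g=\begin{bmatrix} u_{\mathrm{ini}} \\ y_{\mathrm{ini}}-w \\ u \\ y \end{bmatrix},\qquad \begin{bmatrix} 1 \\ w \end{bmatrix}^\top\Phi\begin{bmatrix} 1 \\ w \end{bmatrix}\ge 0,$$ is equivalent to the following minimization problem with linear cost and linear matrix inequality constraint: $$\textbf{(LMI)}\qquad \min_{u\in\mathbb{R}^{mT_e},\ \gamma\in\mathbb{R},\ \alpha\ge 0}\ \gamma\qquad\text{s.t.}\quad \begin{bmatrix} (\bar R+B_u^\top\bar Q B_u)^{-1} & \begin{bmatrix} u & \mathbf{0} \end{bmatrix} \\ \begin{bmatrix} u^\top \\ \mathbf{0} \end{bmatrix} & Q_g^a(u,\gamma)-\alpha A_w \end{bmatrix}\ge 0,$$ where $$Q_g^a(u,\gamma)=\begin{bmatrix} \gamma-(B_uu)^\top\bar Q(y_0-r)-(y_0-r)^\top\bar Q(B_uu)-(y_0-r)^\top\bar Q(y_0-r) & -(B_uu+y_0-r)^\top\bar Q B_w \\ -B_w^\top\bar Q(B_uu+y_0-r) & -B_w^\top\bar Q B_w \end{bmatrix}.$$ Here equivalence means that the optimal values of (P1) and (LMI) (as infima over $u$ and over $(u,\gamma,\alpha)$,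 respectively) coincide, and that whenever $(u^*,\gamma^*,\alpha^* )$ is optimal for (LMI), $u^*$ is an optimal input sequence for (P1).
   Context: For symmetric matrices, $\ge 0$ means positive semidefinite and $<0$ negative definite; $\|x\|_Q=\sqrt{x^\top Qx}$ for $Q\ge0$; $\otimes$ is the Kronecker product; $\mathbf{I},\mathbf{0}$ are identity and zero matrices of suitable size; $\mathcal{N}(A)$ denotes a matrix whose columns form a basis of $\ker(A)$. System. $\mathcal{G}$ is the discrete-time LTI system $x_{k+1}=Ax_k+Bu_k$, $y_k=Cx_k+Du_k$, with $x_k\in\mathbb{R}^n$, $u_k\in\mathbb{R}^m$, $y_k\in\mathbb{R}^p$, with $(A,B)$ controllable and $(A,C)$ observable. Its lag $\mathbf{l}(\mathcal{G})$ is the smallest integer $l$ such that $[C^\top,A^\top C^\top,\dots,(A^{l-1})^\top C^\top]^\top$ has rank $n$. An input-output sequence is a trajectory of $\mathcal{G}$ if it is generated by these equations for some initial state. For a finite sequence of vectors $\{v_k\}$, $v$ denotes the column concatenation of its elements in order. Data. $\{\bar u_k,\bar y_k\}_{k=t_h}^{t_h+T_d-1}$ (historical data, noiseless) is a trajectory of $\mathcal{G}$. The depth-$L$ Hankel matrix $\mathcal{H}_L(\bar v)$ of a sequence $\{\bar v_k\}_{k=t_h}^{t_h+T_d-1}$ has as its $j$-th column ($j=1,\dots,T_d-L+1$) the concatenation of $\bar v_{t_h+j-1},\dots,\bar v_{t_h+j+L-2}$. The sequence $\bar u$ is persistently exciting of order $L$ if $\mathrm{rank}(\mathcal{H}_L(\bar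 u))=mL$. Standing assumptions: $\bar u$ is persistently exciting of order $T_{\mathrm{ini}}+T_e+n$, and $T_{\mathrm{ini}}\ge \mathbf{l}(\mathcal{G})$. Partition $\mathcal{H}_{T_{\mathrm{ini}}+T_e}(\bar u)=[U_p^\top\ U_f^\top]^\top$ and $\mathcal{H}_{T_{\mathrm{ini}}+T_e}(\bar y)=[Y_p^\top\ Y_f^\top]^\top$, where $U_p,Y_p$ consist of the first $T_{\mathrm{ini}}$ block rows and $U_f,Y_f$ of the last $T_e$ block rows. Recent data. $u_{\mathrm{ini}}\in\mathbb{R}^{mT_{\mathrm{ini}}}$ and $y_{\mathrm{ini}}\in\mathbb{R}^{pT_{\mathrm{ini}}}$ are the measured inputs and outputs at times $-T_{\mathrm{ini}},\dots,-1$. The output is noisy: $y_{\mathrm{ini}}$ is the sum of a noiseless output $\check y_{\mathrm{ini}}$, with $(u_{\mathrm{ini}},\check y_{\mathrm{ini}})$ a trajectory of $\mathcal{G}$, and an unknown noise vector satisfying the quadratic constraint $\begin{bmatrix} 1 \\ w \end{bmatrix}^\top\Phi\begin{bmatrix} 1 \\ w \end{bmatrix}\ge0$. Here $\Phi=\begin{bmatrix} \Phi_{11} & \Phi_{12} \\ \Phi_{12}^\top & \Phi_{22} \end{bmatrix}$ is symmetric, $\Phi_{11}$ is a scalar, and $\Phi_{22}=\Phi_{22}^\top<0$. Cost. $r=(r_0,\dots,r_{T_e-1})\in\mathbb{R}^{pT_e}$ is a given output reference, $Q\in\mathbb{R}^{p\times p}$ and $R\in\mathbb{R}^{m\times m}$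 are positive semidefinite, $\bar Q=\mathbf{I}\otimes Q$ and $\bar R=\mathbf{I}\otimes R$ (with $T_e$ diagonal blocks), and $\bar R+B_u^\top\bar QB_u$ is invertible. In (P1), $u=(u_0,\dots,u_{T_e-1})$, and $y=(y_0,\dots,y_{T_e-1})$ is the output determined by the equality constraint; it is uniquely determined by $u$ and $w$ even if $g$ is not unique. Matrices. Let $n_w=\dim\ker(U_p)$, $M=\mathcal{N}(U_p)$, $g_w^*=U_p^\top(U_pU_p^\top)^{-1}u_{\mathrm{ini}}$, $w_0=y_{\mathrm{ini}}-Y_pg_w^*$, and $$A_w=\begin{bmatrix} \Phi_{11}+w_0^\top\Phi_{12}^\top+\Phi_{12}w_0+w_0^\top\Phi_{22}w_0 & -\Phi_{12}Y_pM-w_0^\top\Phi_{22}Y_pM \\ -M^\top Y_p^\top\Phi_{12}^\top-M^\top Y_p^\top\Phi_{22}w_0 & M^\top Y_p^\top\Phi_{22}Y_pM \end{bmatrix}.$$ Let $P_Y$ be a row permutation matrix with $P_YY_p=[Y_{p1}^\top,Y_{p2}^\top]^\top$ such that $\Lambda=[U_p^\top,Y_{p1}^\top,U_f^\top]^\top$ has full row rank and $\mathrm{rank}(\Lambda)=\mathrm{rank}([U_p^\top,Y_p^\top,U_f^\top]^\top)$ (such a $P_Y$ always exists). Define, with block rows partitioned conformally with $\Lambda$, $$B_{\mathrm{ini}}=Y_f\left(\mathbf{I}+\Lambda^\top(\Lambda\Lambda^\top)^{-1}\begin{bmatrix} \mathbf{0} \\ \mathbf{0} \\ -U_f \end{bmatrix}\right),\quad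 B_u=Y_f\Lambda^\top(\Lambda\Lambda^\top)^{-1}\begin{bmatrix} \mathbf{0} \\ \mathbf{0} \\ \mathbf{I} \end{bmatrix},\quad B_w=B_{\mathrm{ini}}M,\quad y_0=B_{\mathrm{ini}}g_w^*.$$ In the definition of $Q_g^a$, $y_0$ denotes this vector in $\mathbb{R}^{pT_e}$ (not the output at time $0$). *)

theory Defs
  imports
    "Jordan_Normal_Form.Matrix_Kernel"
    "Jordan_Normal_Form.DL_Rank"
    "HOL-Library.Extended_Real"
begin

section \<open>Matrices and vectors\<close>

definition mrank :: "real mat \<Rightarrow> nat" where
  "mrank A = vec_space.rank (dim_row A) A"

text \<open>Only meaningful for invertible square matrices; otherwise the value is unspecified.\<close>

definition minv :: "real mat \<Rightarrow> real mat" where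
  "minv A = the (mat_inverse A)"

text \<open>For symmetric matrices, \<open>\<ge> 0\<close> and \<open>< 0\<close> are the following predicates
  (symmetry is included in both).\<close>

definition psd :: "real mat \<Rightarrow> bool" where
  "psd A \<longleftrightarrow> square_mat A \<and> A\<^sup>T = A \<and>
     (\<forall>x \<in> carrier_vec (dim_col A). 0 \<le> x \<bullet> (A *\<^sub>v x))"

definition neg_def :: "real mat \<Rightarrow> bool" where
  "neg_def A \<longleftrightarrow> square_mat A \<and> A\<^sup>T = A \<and>
     (\<forall>x \<in> carrier_vec (dim_col A). x \<noteq> 0\<^sub>v (dim_col A) \<longrightarrow> x \<bullet> (A *\<^sub>v x) < 0)"

definition wnorm :: "real mat \<Rightarrow> real vec \<Rightarrow> real" where
  "wnorm Q x = sqrt (x \<bullet> (Q *\<^sub>v x))"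

definition kron :: "real mat \<Rightarrow> real mat \<Rightarrow> real mat" where
  "kron A B = mat (dim_row A * dim_row B) (dim_col A * dim_col B)
     (\<lambda>(i, j). A $$ (i div dim_row B, j div dim_col B) * B $$ (i mod dim_row B, j mod dim_col B))"

definition permutation_mat :: "nat \<Rightarrow> real mat \<Rightarrow> bool" where
  "permutation_mat k P \<longleftrightarrow>
     (\<exists>\<sigma>. \<sigma> permutes {..<k} \<and> P = mat k k (\<lambda>(i, j). if j = \<sigma> i then 1 else 0))"

text \<open>The columns of \<open>M\<close>, which are required to be pairwise distinct, form a basis of the
  kernel of \<open>A\<close>.\<close>

definition null_basis_mat :: "real mat \<Rightarrow> real mat \<Rightarrow> bool" where
  "null_basis_mat A M \<longleftrightarrow> dim_row M = dim_col A \<and> distinct (cols M) \<and>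
     kernel.basis (dim_col A) A (set (cols M))"

definition col_mat :: "real vec \<Rightarrow> real mat" where
  "col_mat v = mat_of_cols (dim_vec v) [v]"

definition scalar_mat :: "real \<Rightarrow> real mat" where
  "scalar_mat c = mat 1 1 (\<lambda>_. c)"

section \<open>Sequences of vectors\<close>

text \<open>Sequences are indexed by integer time; a finite sequence is given by its first time \<open>t\<close>
  and its length \<open>T\<close>, and values outside this window are irrelevant. Block \<open>k\<close> of a
  stacked vector is counted from 0.\<close>

definition stack :: "nat \<Rightarrow> (int \<Rightarrow> real vec) \<Rightarrow> int \<Rightarrow> nat \<Rightarrow> real vec" where
  "stack d v t T = vec (d * T) (\<lambda>i. v (t + int (i div d)) $ (i mod d))"

definition vblock :: "nat \<Rightarrow> real vec \<Rightarrow> nat \<Rightarrow> real vec" where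
  "vblock d v k = vec d (\<lambda>i. v $ (k * d + i))"

text \<open>If \<open>T < L\<close>, the Hankel matrix has no columns.\<close>

definition hankel :: "nat \<Rightarrow> (int \<Rightarrow> real vec) \<Rightarrow> int \<Rightarrow> nat \<Rightarrow> nat \<Rightarrow> real mat" where
  "hankel d v t T L = mat (d * L) (T + 1 - L)
     (\<lambda>(i, j). v (t + int j + int (i div d)) $ (i mod d))"

definition persistently_exciting ::
  "nat \<Rightarrow> (int \<Rightarrow> real vec) \<Rightarrow> int \<Rightarrow> nat \<Rightarrow> nat \<Rightarrow> bool" where
  "persistently_exciting d v t T L \<longleftrightarrow> mrank (hankel d v t T L) = d * L"

section \<open>Linear time-invariant systems\<close>

definition trajectory ::
  "real mat \<Rightarrow> real mat \<Rightarrow> real mat \<Rightarrow> real mat \<Rightarrow> int \<Rightarrow> nat \<Rightarrow>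
   (int \<Rightarrow> real vec) \<Rightarrow> (int \<Rightarrow> real vec) \<Rightarrow> bool" where
  "trajectory A B C D t T u y \<longleftrightarrow>
     (\<forall>k \<in> {t..<t + int T}. u k \<in> carrier_vec (dim_col B)) \<and>
     (\<exists>x :: int \<Rightarrow> real vec. x t \<in> carrier_vec (dim_col A) \<and>
       (\<forall>k \<in> {t..<t + int T}.
          x (k + 1) = A *\<^sub>v x k + B *\<^sub>v u k \<and>
          y k = C *\<^sub>v x k + D *\<^sub>v u k))"

definition controllability_mat :: "real mat \<Rightarrow> real mat \<Rightarrow> real mat" where
  "controllability_mat A B = mat (dim_row A) (dim_col B * dim_row A)
     (\<lambda>(i, j). (A ^\<^sub>m (j div dim_col B) * B) $$ (i, j mod dim_col B))"

definition controllable :: "real mat \<Rightarrow> real mat \<Rightarrow> bool" where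
  "controllable A B \<longleftrightarrow> mrank (controllability_mat A B) = dim_row A"

definition observability_mat :: "real mat \<Rightarrow> real mat \<Rightarrow> nat \<Rightarrow> real mat" where
  "observability_mat A C l = mat (dim_row C * l) (dim_row A)
     (\<lambda>(i, j). (C * A ^\<^sub>m (i div dim_row C)) $$ (i mod dim_row C, j))"

definition observable :: "real mat \<Rightarrow> real mat \<Rightarrow> bool" where
  "observable A C \<longleftrightarrow> mrank (observability_mat A C (dim_row A)) = dim_row A"

definition lag :: "real mat \<Rightarrow> real mat \<Rightarrow> nat" where
  "lag A C = (LEAST l. mrank (observability_mat A C l) = dim_row A)"

section \<open>Noise description and matrix inequality\<close>

text \<open>\<open>\<Phi>11\<close> is a scalar, \<open>\<Phi>12\<close> a row matrix.\<close>

definition Phi_mat :: "real \<Rightarrow> real mat \<Rightarrow> real mat \<Rightarrow> real mat" where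
  "Phi_mat \<Phi>11 \<Phi>12 \<Phi>22 = four_block_mat (scalar_mat \<Phi>11) \<Phi>12 \<Phi>12\<^sup>T \<Phi>22"

definition noise_qc :: "real mat \<Rightarrow> real vec \<Rightarrow> bool" where
  "noise_qc \<Phi> w \<longleftrightarrow> 0 \<le> vCons 1 w \<bullet> (\<Phi> *\<^sub>v vCons 1 w)"

definition Aw_mat ::
  "real \<Rightarrow> real mat \<Rightarrow> real mat \<Rightarrow> real vec \<Rightarrow> real mat \<Rightarrow> real mat \<Rightarrow> real mat" where
  "Aw_mat \<Phi>11 \<Phi>12 \<Phi>22 w0 Yp M = (let w = col_mat w0 in
     four_block_mat
       (scalar_mat \<Phi>11 + w\<^sup>T * \<Phi>12\<^sup>T + \<Phi>12 * w + w\<^sup>T * \<Phi>22 * w)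
       (- (\<Phi>12 * Yp * M) - w\<^sup>T * \<Phi>22 * Yp * M)
       (- (M\<^sup>T * Yp\<^sup>T * \<Phi>12\<^sup>T) - M\<^sup>T * Yp\<^sup>T * \<Phi>22 * w)
       (M\<^sup>T * Yp\<^sup>T * \<Phi>22 * Yp * M))"

definition Qga_mat ::
  "real mat \<Rightarrow> real mat \<Rightarrow> real mat \<Rightarrow> real vec \<Rightarrow> real vec \<Rightarrow> real vec \<Rightarrow> real \<Rightarrow> real mat" where
  "Qga_mat Qbar Bu Bw y0 r u \<gamma> = (let b = col_mat (Bu *\<^sub>v u); e = col_mat (y0 - r) in
     four_block_mat
       (scalar_mat \<gamma> - b\<^sup>T * Qbar * e - e\<^sup>T * Qbar * b - e\<^sup>T * Qbar * e)
       (- ((b + e)\<^sup>T * Qbar * Bw))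
       (- (Bw\<^sup>T * Qbar * (b + e)))
       (- (Bw\<^sup>T * Qbar * Bw)))"

text \<open>The block matrix with diagonal blocks \<open>S\<inverse>\<close> and \<open>X\<close>, lower left block consisting of
  \<open>u\<^sup>T\<close> above \<open>k\<close> zero rows, and upper right block its transpose.\<close>

definition LMI_mat :: "real mat \<Rightarrow> nat \<Rightarrow> real vec \<Rightarrow> real mat \<Rightarrow> real mat" where
  "LMI_mat S k u X = (let W = (col_mat u)\<^sup>T @\<^sub>r 0\<^sub>m k (dim_vec u) in
     four_block_mat (minv S) W\<^sup>T W X)"

end

theory Submission
  imports Defs
begin

text \<open>
  A column combination \<open>g\<close> of the data matrices is again a trajectory of the system, and Willems'
  fundamental lemma (\<open>willems_kernel\<close>, \<open>combination_exists\<close>) says that persistent excitation makes every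
  trajectory of the right length arise in this way. Three consequences are all that the problem needs from
  the dynamics: the past can be left untouched while the future input is prescribed (\<open>past_neutral_input\<close>), the
  future output is a linear function of the past output when all inputs vanish (\<open>free_response\<close>, by
  observability), and the noiseless recent data are matched by some \<open>g\<close> (\<open>past_trajectory_represented\<close>).

  Writing the solutions of \<open>Up g = uini\<close> as \<open>gw + M z\<close>, the inner maximization becomes one over \<open>z\<close> alone: the
  noise is \<open>w0 - Yp M z\<close>, the tracking error is \<open>Bu u + (y0 - r) + Bw z\<close>, and the quadratic constraint on the
  noise is the quadratic form of \<open>Aw\<close> at \<open>(1, z)\<close>. A number \<open>\<gamma>\<close> bounds the worst case exactly if a quadratic form in
  \<open>(1, z)\<close>, which depends on \<open>\<gamma>\<close> and \<open>u\<close>, is nonnegative wherever the form of \<open>Aw\<close> is. The matrix inequality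
  says, after a Schur complement with respect to \<open>S\<close> (\<open>LMI_mat_psd_iff\<close>), that the first form minus \<open>\<alpha>\<close> times
  the second is nonnegative for all \<open>(t, z)\<close>. So feasible triples give upper bounds at once, and the converse
  is an S-lemma.

  The S-lemma usually requires a point at which the constraint holds strictly. No such point is assumed here:
  the noise set may be a single point. If the constraint form is nowhere positive, only one of the vectors
  \<open>w0 - Yp M z\<close> is an admissible noise and the constraint is minus a definite form in the deviation from it. For
  a given input the error depends on the noise alone, so it is controlled by this form; a strictly valid bound
  \<open>\<gamma>\<close> is then certified by a large \<open>\<alpha>\<close> (\<open>robust_certificate\<close>). Bounds equal to the worst case may fail
  to have a certificate, but strict ones suffice to compare infima (\<open>optimum_of_certified_bounds\<close>).\<close>

section \<open>Rank, kernels and one-sided inverses\<close>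

lemma surj_of_full_row_rank:
  assumes A: "A \<in> carrier_mat nr nc" and r: "mrank A = nr" and y: "y \<in> carrier_vec nr"
  obtains x where "x \<in> carrier_vec nc" "A *\<^sub>v x = y"
proof -
  interpret vec_space "TYPE(real)" nr .
  let ?P = "\<lambda>T. T \<subseteq> set (cols A) \<and> lin_indpt T"
  have cs: "set (cols A) \<subseteq> carrier_vec nr" using A cols_dim by blast
  obtain U where U: "finite U" "maximal U ?P"
    using maximal_exists_superset[of "set (cols A)" ?P "{}"]
    by (metis (no_types, lifting) List.finite_set empty_subsetI finite_lin_indpt2 finite.emptyI empty_iff)
  have "card U = nr" using rank_card_indpt[OF A U(2)] r A unfolding mrank_def by simp
  moreover have Us: "U \<subseteq> set (cols A)" "lin_indpt U" using U(2) unfolding maximal_def by auto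
  ultimately have "basis U"
    using cs by (intro dim_li_is_basis) (auto simp: dim_is_n U)
  then have "carrier_vec nr \<subseteq> span (set (cols A))"
    using span_is_monotone[OF Us(1)] unfolding basis_def by auto
  then have "y \<in> col_space A" using y unfolding col_space_def by auto
  then show thesis using that col_space_eq[OF A] A by auto
qed

lemma rank_nullity_mat:
  assumes A: "A \<in> carrier_mat nr nc"
  shows "mrank A + kernel_dim A = nc"
proof -
  interpret W: vec_space "TYPE(real)" nr .
  interpret K: kernel nr nc A by unfold_locales (rule A)
  interpret T: linear_map class_ring "module_vec TYPE(real) nc" "module_vec TYPE(real) nr" "\<lambda>v. A *\<^sub>v v"
    using A by unfold_locales
      (auto simp: LinearCombinations.module_hom_def mult_add_distrib_mat_vec class_ring_simps module_vec_simps
         mult_mat_vec[OF A])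
  have "T.im = W.col_space A"
    unfolding T.im_def W.col_space_eq[OF A] using A by (auto simp: module_vec_simps)
  moreover have "T.ker = mat_kernel A"
    unfolding T.ker_def mat_kernel[OF A] by (auto simp: module_vec_simps)
  ultimately show ?thesis using T.rank_nullity[OF K.NC.fin_dim] A K.NC.dim_is_n
    by (simp add: mrank_def W.rank_def W.col_space_def)
qed

text \<open>By rank-nullity the two kernels have the same dimension, so a basis of the smaller one is a basis of
  the larger one.\<close>
lemma kernel_mono_eq_rank:
  assumes A: "A \<in> carrier_mat r1 nc" and B: "B \<in> carrier_mat r2 nc"
    and sub: "mat_kernel A \<subseteq> mat_kernel B" and rk: "mrank A = mrank B"
  shows "mat_kernel A = mat_kernel B"
proof -
  interpret KA: kernel r1 nc A by unfold_locales (rule A)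
  interpret KB: kernel r2 nc B by unfold_locales (rule B)
  obtain bs where bs: "finite bs" "KA.basis bs" using kernel_basis_exists[OF A] by blast
  obtain cs where cs: "finite cs" "KB.basis cs" using kernel_basis_exists[OF B] by blast
  have bsA: "bs \<subseteq> mat_kernel A" "KA.span bs = mat_kernel A" "KA.lin_indpt bs"
    using bs(2) unfolding KA.Ker.basis_def by auto
  have "KA.dim = KB.dim"
    using rank_nullity_mat[OF A] rank_nullity_mat[OF B] rk by simp
  then have "card bs = KB.dim" using KA.Ker.dim_basis[OF bs] by simp
  moreover have "KB.lin_indpt bs"
    using bsA(3) KA.lindep_same[OF bsA(1)] KB.lindep_same[of bs] bsA(1) sub by auto
  moreover have "KB.Ker.fin_dim" unfolding KB.Ker.fin_dim_def using cs KB.Ker.basis_def by auto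
  ultimately have "KB.basis bs" 
    using bs(1) bsA(1) sub by (intro KB.Ker.dim_li_is_basis) auto
  then have "KB.span bs = mat_kernel B" unfolding KB.Ker.basis_def by auto
  then show ?thesis
    using bsA KA.span_same[OF bsA(1)] KB.span_same[of bs] sub by auto
qed

lemma mrank_one: "mrank (1\<^sub>m n) = n"
  unfolding mrank_def using vec_space.det_rank_iff[of "1\<^sub>m n :: real mat" n] by simp

text \<open>The instance of \<open>kernel_mono_eq_rank\<close> in which the smaller kernel is that of the identity.\<close>
lemma inj_of_full_col_rank:
  assumes A: "A \<in> carrier_mat nr nc" and r: "mrank A = nc"
    and x: "x \<in> carrier_vec nc" "A *\<^sub>v x = 0\<^sub>v nr"
  shows "x = 0\<^sub>v nc"
proof -
  have o: "1\<^sub>m nc \<in> carrier_mat nc nc" by simp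
  have "mat_kernel (1\<^sub>m nc :: real mat) = mat_kernel A"
    using A r mrank_one[of nc] by (intro kernel_mono_eq_rank[OF o A]) (auto simp: mat_kernel[OF A] mat_kernel[OF o])
  moreover have "x \<in> mat_kernel A" using x mat_kernel[OF A] by auto
  ultimately show ?thesis using mat_kernelD[OF o, of x] by simp
qed

lemma scalar_prod_self_0:
  assumes x: "(x::real vec) \<in> carrier_vec n" and "x \<bullet> x = 0"
  shows "x = 0\<^sub>v n"
proof
  have "\<forall>i\<in>{0..<n}. x $ i * x $ i = 0"
    using assms by (subst sum_nonneg_eq_0_iff[symmetric]) (auto simp: scalar_prod_def)
  then show "x $ i = 0\<^sub>v n $ i" if "i < dim_vec (0\<^sub>v n :: real vec)" for i using that by auto
qed (use x in auto)

lemma adjoint_prod: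
  assumes "(A::real mat) \<in> carrier_mat nr nc" "x \<in> carrier_vec nc" "y \<in> carrier_vec nr"
  shows "y \<bullet> (A *\<^sub>v x) = (A\<^sup>T *\<^sub>v y) \<bullet> x"
  using assms transpose_vec_mult_scalar[OF assms] by (simp add: comm_scalar_prod[of _ nr])

lemma inverse_of_inj:
  assumes A: "(A::real mat) \<in> carrier_mat n n"
    and inj: "\<And>x. x \<in> carrier_vec n \<Longrightarrow> A *\<^sub>v x = 0\<^sub>v n \<Longrightarrow> x = 0\<^sub>v n"
  shows "minv A \<in> carrier_mat n n" "A * minv A = 1\<^sub>m n" "minv A * A = 1\<^sub>m n"
proof -
  have "det A \<noteq> 0" using det_0_iff_vec_prod_zero_field[OF A] inj by blast
  then have "A \<in> Units (ring_mat TYPE(real) n undefined)" by (rule det_non_zero_imp_unit[OF A])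
  then obtain B where "mat_inverse A = Some B" using mat_inverse(1)[OF A, of undefined] by (cases "mat_inverse A") auto
  then show "minv A \<in> carrier_mat n n" "A * minv A = 1\<^sub>m n" "minv A * A = 1\<^sub>m n"
    using mat_inverse(2)[OF A] unfolding minv_def by auto
qed

text \<open>A vector \<open>y\<close> in the kernel of \<open>A A\<^sup>T\<close> has \<open>\<parallel>A\<^sup>T y\<parallel>\<^sup>2 = y \<bullet> A A\<^sup>T y = 0\<close>. This is the way by which
  trivial left kernels are turned into solvability of linear systems and full column rank into left inverses.\<close>
lemma gram_inverse:
  assumes A: "(A::real mat) \<in> carrier_mat nr nc"
    and lk: "\<And>y. y \<in> carrier_vec nr \<Longrightarrow> A\<^sup>T *\<^sub>v y = 0\<^sub>v nc \<Longrightarrow> y = 0\<^sub>v nr"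
  shows "minv (A * A\<^sup>T) \<in> carrier_mat nr nr" "(A * A\<^sup>T) * minv (A * A\<^sup>T) = 1\<^sub>m nr"
     "minv (A * A\<^sup>T) * (A * A\<^sup>T) = 1\<^sub>m nr"
proof -
  have AA: "A * A\<^sup>T \<in> carrier_mat nr nr" using A by simp
  have "y = 0\<^sub>v nr" if y: "y \<in> carrier_vec nr" "A * A\<^sup>T *\<^sub>v y = 0\<^sub>v nr" for y
  proof -
    have *: "A\<^sup>T *\<^sub>v y \<in> carrier_vec nc" using A y by simp
    have "A *\<^sub>v (A\<^sup>T *\<^sub>v y) = 0\<^sub>v nr"
      using y(2) assoc_mult_mat_vec[OF A _ y(1), of "A\<^sup>T"] A by (metis transpose_carrier_mat)
    then have "(A\<^sup>T *\<^sub>v y) \<bullet> (A\<^sup>T *\<^sub>v y) = 0"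
      using adjoint_prod[OF A * y(1)] y(1) by simp
    then show ?thesis using lk[OF y(1)] scalar_prod_self_0[OF *] by blast
  qed
  from inverse_of_inj[OF AA this]
  show "minv (A * A\<^sup>T) \<in> carrier_mat nr nr" "(A * A\<^sup>T) * minv (A * A\<^sup>T) = 1\<^sub>m nr"
     "minv (A * A\<^sup>T) * (A * A\<^sup>T) = 1\<^sub>m nr" by auto
qed

lemma left_kernel_of_full_row_rank:
  assumes A: "A \<in> carrier_mat nr nc" and r: "mrank A = nr" 
    and y: "y \<in> carrier_vec nr" "A\<^sup>T *\<^sub>v y = 0\<^sub>v nc"
  shows "y = 0\<^sub>v nr"
proof -
  obtain x where x: "x \<in> carrier_vec nc" "A *\<^sub>v x = y" using surj_of_full_row_rank[OF A r y(1)] .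
  then have "y \<bullet> y = 0" using adjoint_prod[OF A x(1) y(1)] y by simp
  then show ?thesis using scalar_prod_self_0 y by blast
qed

lemma right_inverse:
  assumes A: "A \<in> carrier_mat nr nc" 
    and lk: "\<And>y. y \<in> carrier_vec nr \<Longrightarrow> A\<^sup>T *\<^sub>v y = 0\<^sub>v nc \<Longrightarrow> y = 0\<^sub>v nr"
  shows "A\<^sup>T * minv (A * A\<^sup>T) \<in> carrier_mat nc nr" "A * (A\<^sup>T * minv (A * A\<^sup>T)) = 1\<^sub>m nr"
proof -
  note g = gram_inverse[OF A lk]
  have At: "A\<^sup>T \<in> carrier_mat nc nr" using A by simp
  show "A\<^sup>T * minv (A * A\<^sup>T) \<in> carrier_mat nc nr" using At g(1) by simp
  show "A * (A\<^sup>T * minv (A * A\<^sup>T)) = 1\<^sub>m nr"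
    using assoc_mult_mat[OF A At g(1)] g(2) by simp
qed

lemma left_inverse:
  assumes A: "(A::real mat) \<in> carrier_mat nr nc"
    and inj: "\<And>x. x \<in> carrier_vec nc \<Longrightarrow> A *\<^sub>v x = 0\<^sub>v nr \<Longrightarrow> x = 0\<^sub>v nc"
  obtains L where "L \<in> carrier_mat nc nr" "L * A = 1\<^sub>m nc"
proof -
  have At: "A\<^sup>T \<in> carrier_mat nc nr" using A by simp
  have "x = 0\<^sub>v nc" if "x \<in> carrier_vec nc" "(A\<^sup>T)\<^sup>T *\<^sub>v x = 0\<^sub>v nr" for x
    using inj that by simp
  from gram_inverse[OF At this]
  have g: "minv (A\<^sup>T * A) \<in> carrier_mat nc nc" "minv (A\<^sup>T * A) * (A\<^sup>T * A) = 1\<^sub>m nc" by auto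
  show thesis
  proof (rule that)
    show "minv (A\<^sup>T * A) * A\<^sup>T \<in> carrier_mat nc nr" using g(1) At by simp
    show "minv (A\<^sup>T * A) * A\<^sup>T * A = 1\<^sub>m nc" using assoc_mult_mat[OF g(1) At A] g(2) by simp
  qed
qed

lemma null_basisD:
  assumes A: "A \<in> carrier_mat nr nc" and M: "null_basis_mat A M"
  shows "M \<in> carrier_mat nc (kernel_dim A)"
    "z \<in> carrier_vec (kernel_dim A) \<Longrightarrow> A *\<^sub>v (M *\<^sub>v z) = 0\<^sub>v nr"
    "g \<in> carrier_vec nc \<Longrightarrow> A *\<^sub>v g = 0\<^sub>v nr \<Longrightarrow> \<exists>z \<in> carrier_vec (kernel_dim A). g = M *\<^sub>v z"
proof -
  interpret K: kernel nr nc A by unfold_locales (rule A)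
  have m: "dim_row M = nc" "distinct (cols M)" "K.basis (set (cols M))"
    using M A unfolding null_basis_mat_def by auto
  have sub: "set (cols M) \<subseteq> mat_kernel A" and sp: "K.span (set (cols M)) = mat_kernel A"
    using m(3) unfolding K.Ker.basis_def by auto
  have "K.dim = card (set (cols M))" using K.Ker.dim_basis[OF _ m(3)] by simp
  then have "dim_col M = kernel_dim A" using distinct_card[OF m(2)] by simp
  then show Mc: "M \<in> carrier_mat nc (kernel_dim A)" using m by auto
  have "mat_kernel A = K.NC.col_space M"
    using sp K.span_same[OF sub] unfolding K.NC.col_space_def by simp
  then have eq: "mat_kernel A = {y \<in> carrier_vec nc. \<exists>x\<in>carrier_vec (kernel_dim A). M *\<^sub>v x = y}"
    using K.NC.col_space_eq[OF Mc] Mc by auto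
  show "A *\<^sub>v (M *\<^sub>v z) = 0\<^sub>v nr" if "z \<in> carrier_vec (kernel_dim A)"
  proof -
    have "M *\<^sub>v z \<in> carrier_vec nc" using Mc that by (rule mult_mat_vec_carrier)
    then have "M *\<^sub>v z \<in> mat_kernel A" unfolding eq using that by blast
    then show ?thesis using mat_kernelD[OF A] by auto
  qed
  show "\<exists>z \<in> carrier_vec (kernel_dim A). g = M *\<^sub>v z" if "g \<in> carrier_vec nc" "A *\<^sub>v g = 0\<^sub>v nr"
  proof -
    have "g \<in> mat_kernel A" using that mat_kernel[OF A] by auto
    then have "g \<in> {y \<in> carrier_vec nc. \<exists>x\<in>carrier_vec (kernel_dim A). M *\<^sub>v x = y}"
      unfolding eq .
    then show ?thesis by blast
  qed
qed

section \<open>Stacked vectors\<close>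

lemma sum_div_mod:
  fixes f :: "nat \<Rightarrow> nat \<Rightarrow> real"
  shows "(\<Sum>r<m * K. f (r div m) (r mod m)) = (\<Sum>k<K. \<Sum>a<m. f k a)"
proof -
  have "(\<Sum>r<m * K. f (r div m) (r mod m)) = (\<Sum>k<K. \<Sum>r=k*m..<k*m+m. f (r div m) (r mod m))"
    by (simp add: sum.nat_group mult.commute)
  also have "\<dots> = (\<Sum>k<K. \<Sum>a<m. f k a)"
  proof (rule sum.cong[OF refl])
    fix k
    have "(\<Sum>r=k*m..<k*m+m. f (r div m) (r mod m)) = (\<Sum>a=0..<m. f ((a + k*m) div m) ((a + k*m) mod m))"
      using sum.shift_bounds_nat_ivl[of "\<lambda>r. f (r div m) (r mod m)" 0 "k*m" m] by (simp add: add.commute)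
    also have "\<dots> = (\<Sum>a<m. f k a)"
      by (rule sum.cong) auto
    finally show "(\<Sum>r=k*m..<k*m+m. f (r div m) (r mod m)) = (\<Sum>a<m. f k a)" .
  qed
  finally show ?thesis .
qed

lemma block_index: "r < d * K \<Longrightarrow> r div d < K" "r < d * K \<Longrightarrow> r mod d < d" for r d K :: nat
  by (auto simp: less_mult_imp_div_less mult.commute intro!: mod_less_divisor gr0I)

lemma zero_vec_blocks: "0\<^sub>v (d * K) = vec (d * K) (\<lambda>r. 0\<^sub>v d $ (r mod d) :: real)" for d K :: nat
  by (intro eq_vecI) (auto simp: block_index)

lemma append_blocks:
  assumes "P \<in> carrier_mat (d * a) N" "F \<in> carrier_mat (d * b) N" "g \<in> carrier_vec N"
    and "\<And>r. r < d * (a + b) \<Longrightarrow> ((P @\<^sub>r F) *\<^sub>v g) $ r = f (r div d) (r mod d)"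
  shows "r < d * a \<Longrightarrow> (P *\<^sub>v g) $ r = f (r div d) (r mod d)"
    "r < d * b \<Longrightarrow> (F *\<^sub>v g) $ r = f (a + r div d) (r mod d)"
proof -
  note e = mat_mult_append[OF assms(1-3)]
  show "(P *\<^sub>v g) $ r = f (r div d) (r mod d)" if "r < d * a"
    using assms(1,2,3) assms(4)[of r] that unfolding e by (simp add: distrib_left)
  show "(F *\<^sub>v g) $ r = f (a + r div d) (r mod d)" if r: "r < d * b"
  proof -
    have "d > 0" using r by (intro gr0I) auto
    then show ?thesis
      using assms(1,2,3) assms(4)[of "d * a + r"] r unfolding e by (simp add: distrib_left)
  qed
qed

lemma block_eqI:
  assumes "w \<in> carrier_vec d" "w' \<in> carrier_vec d" "\<And>a. a < d \<Longrightarrow> w $ a = w' $ a"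
  shows "w = w'"
  using assms by (intro eq_vecI) auto

lemma col_append_rows:
  assumes "A \<in> carrier_mat nr1 nc" "B \<in> carrier_mat nr2 nc" "j < nc"
  shows "col (A @\<^sub>r B) j = col A j @\<^sub>v col B j"
  unfolding append_rows_def using assms
  by (subst col_four_block_mat[of _ nr1 nc _ 0 _ nr2]) auto

section \<open>Willems' fundamental lemma\<close>

text \<open>The \<open>n + 1\<close> functionals \<open>v \<mapsto> xi \<bullet> A\<^sup>i v\<close> on an \<open>n\<close>-dimensional space are dependent. The relation is
  normalized by the position \<open>d\<close> of its last nonzero coefficient, from which the triangular elimination in
  \<open>willems_kernel\<close> starts.\<close>
lemma powers_dependent:
  assumes A: "(A::real mat) \<in> carrier_mat n n" and xi: "xi \<in> carrier_vec n"
  obtains c d where "d \<le> n" "c d \<noteq> 0" "\<And>i. i > d \<Longrightarrow> c i = 0"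
    "\<And>v. v \<in> carrier_vec n \<Longrightarrow> (\<Sum>i\<le>d. c i * (xi \<bullet> ((A ^\<^sub>m i) *\<^sub>v v))) = (0::real)"
proof -
  \<comment> \<open>The vectors are the columns of \<open>M\<close>, padded by a zero row; the padding makes \<open>M\<close> square and singular.\<close>
  define M where "M = mat (Suc n) (Suc n) (\<lambda>(r,i). if r < n then ((A ^\<^sub>m i)\<^sup>T *\<^sub>v xi) $ r else 0)"
  have M: "M \<in> carrier_mat (Suc n) (Suc n)" unfolding M_def by simp
  have "M\<^sup>T *\<^sub>v unit_vec (Suc n) n = 0\<^sub>v (Suc n)"
    using M by (intro eq_vecI) (auto simp: M_def)
  moreover have "unit_vec (Suc n) n \<noteq> (0\<^sub>v (Suc n) :: real vec)" by auto
  ultimately have "det (M\<^sup>T) = 0"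
    using det_0_iff_vec_prod_zero_field[of "M\<^sup>T" "Suc n"] M by (metis transpose_carrier_mat unit_vec_carrier)
  then have "det M = 0" using det_transpose[OF M] by simp
  then obtain w where w: "w \<in> carrier_vec (Suc n)" "w \<noteq> 0\<^sub>v (Suc n)" "M *\<^sub>v w = 0\<^sub>v (Suc n)"
    using det_0_iff_vec_prod_zero_field[OF M] by auto
  obtain i0 where i0: "i0 \<le> n" "w $ i0 \<noteq> 0"
    using w(1,2) by (metis carrier_vecD eq_vecI index_zero_vec less_Suc_eq_le)
  define d where "d = Max {i. i \<le> n \<and> w $ i \<noteq> 0}"
  have fin: "finite {i. i \<le> n \<and> w $ i \<noteq> 0}" by simp
  have "d \<in> {i. i \<le> n \<and> w $ i \<noteq> 0}" unfolding d_def using fin i0 by (intro Max_in) auto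
  then have d: "d \<le> n" "w $ d \<noteq> 0" by auto
  have dm: "w $ i = 0" if "i > d" "i \<le> n" for i
    using Max_ge[OF fin, of i] that unfolding d_def by fastforce
  define c where "c i = (if i \<le> n then w $ i else 0)" for i
  show thesis
  proof (rule that[of d c])
    show "d \<le> n" "c d \<noteq> 0" using d by (auto simp: c_def)
    show c0: "c i = 0" if "i > d" for i using dm that by (auto simp: c_def)
    fix v :: "real vec" assume v: "v \<in> carrier_vec n"
    have row: "(\<Sum>i\<le>n. c i * ((A ^\<^sub>m i)\<^sup>T *\<^sub>v xi) $ r) = 0" if r: "r < n" for r
    proof -
      have "(M *\<^sub>v w) $ r = (\<Sum>i\<in>{0..<Suc n}. ((A ^\<^sub>m i)\<^sup>T *\<^sub>v xi) $ r * w $ i)"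
        using r w(1) by (auto simp: M_def scalar_prod_def)
      then show ?thesis using w(3) r
        by (simp add: c_def atLeast0LessThan lessThan_Suc_atMost mult.commute)
    qed
    have "(\<Sum>i\<le>d. c i * (xi \<bullet> ((A ^\<^sub>m i) *\<^sub>v v))) = (\<Sum>i\<le>n. c i * (xi \<bullet> ((A ^\<^sub>m i) *\<^sub>v v)))"
      using d(1) c0 by (intro sum.mono_neutral_left) auto
    also have "\<dots> = (\<Sum>i\<le>n. c i * (\<Sum>r<n. ((A ^\<^sub>m i)\<^sup>T *\<^sub>v xi) $ r * v $ r))"
    proof (rule sum.cong[OF refl])
      fix i assume "i \<in> {..n}"
      have Ai: "A ^\<^sub>m i \<in> carrier_mat n n" using A by simp
      have "xi \<bullet> ((A ^\<^sub>m i) *\<^sub>v v) = ((A ^\<^sub>m i)\<^sup>T *\<^sub>v xi) \<bullet> v" by (rule adjoint_prod[OF Ai v xi])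
      also have "\<dots> = (\<Sum>r<n. ((A ^\<^sub>m i)\<^sup>T *\<^sub>v xi) $ r * v $ r)" unfolding scalar_prod_def using v
        by (simp add: atLeast0LessThan)
      finally show "c i * (xi \<bullet> ((A ^\<^sub>m i) *\<^sub>v v)) = c i * (\<Sum>r<n. ((A ^\<^sub>m i)\<^sup>T *\<^sub>v xi) $ r * v $ r)" by simp
    qed
    also have "\<dots> = (\<Sum>r<n. v $ r * (\<Sum>i\<le>n. c i * ((A ^\<^sub>m i)\<^sup>T *\<^sub>v xi) $ r))"
      unfolding sum_distrib_left by (subst sum.swap) (simp add: mult_ac)
    also have "\<dots> = 0" using row by simp
    finally show "(\<Sum>i\<le>d. c i * (xi \<bullet> ((A ^\<^sub>m i) *\<^sub>v v))) = 0" .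
  qed
qed

lemma pow_mat_mult_vec_Suc:
  assumes "(A :: real mat) \<in> carrier_mat n n" "v \<in> carrier_vec n"
  shows "(A ^\<^sub>m Suc k) *\<^sub>v v = (A ^\<^sub>m k) *\<^sub>v (A *\<^sub>v v)"
  using assms by (simp add: assoc_mult_mat_vec[of _ n n _ n])

lemma pow_mat_mult_vec_add:
  assumes A: "(A :: real mat) \<in> carrier_mat n n" and v: "v \<in> carrier_vec n"
  shows "(A ^\<^sub>m i) *\<^sub>v ((A ^\<^sub>m j) *\<^sub>v v) = (A ^\<^sub>m (i + j)) *\<^sub>v v"
  using v
proof (induction j arbitrary: v)
  case (Suc j)
  then show ?case
    using A Suc.IH[of "A *\<^sub>v v"] by (simp add: pow_mat_mult_vec_Suc[of A n] del: pow_mat.simps)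
qed (use A in simp)

text \<open>The historical data together with a state sequence \<open>x\<close> that generates them. The excitation order exceeds
  the window length \<open>L\<close> by the state dimension.\<close>
locale lti_data =
  fixes n m p Td L N :: nat and A B C D :: "real mat" and th :: int and u y x :: "int \<Rightarrow> real vec"
  assumes A: "A \<in> carrier_mat n n" and B: "B \<in> carrier_mat n m"
    and C: "C \<in> carrier_mat p n" and D: "D \<in> carrier_mat p m"
    and ctrb: "controllable A B"
    and u: "\<And>k. th \<le> k \<Longrightarrow> k < th + int Td \<Longrightarrow> u k \<in> carrier_vec m"
    and x0: "x th \<in> carrier_vec n"
    and xs: "\<And>k. th \<le> k \<Longrightarrow> k < th + int Td \<Longrightarrow> x (k + 1) = A *\<^sub>v x k + B *\<^sub>v u k"
    and ys: "\<And>k. th \<le> k \<Longrightarrow> k < th + int Td \<Longrightarrow> y k = C *\<^sub>v x k + D *\<^sub>v u k"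
    and pe: "persistently_exciting m u th Td (L + n)"
    and N: "N = Td + 1 - L"
begin

lemma u_nat: "k < Td \<Longrightarrow> u (th + int k) \<in> carrier_vec m"
  by (rule u) auto

lemma x_carrier: "k \<le> Td \<Longrightarrow> x (th + int k) \<in> carrier_vec n"
proof (induction k)
  case (Suc k)
  then show ?case using xs[of "th + int k"] u_nat[of k] A B
    by (simp add: add.assoc[symmetric] add.commute[of 1])
qed (use x0 in simp)

lemma state_expansion:
  assumes xi: "xi \<in> carrier_vec n" and "j + i \<le> Td"
  shows "xi \<bullet> x (th + int (j + i)) = xi \<bullet> ((A ^\<^sub>m i) *\<^sub>v x (th + int j))
    + (\<Sum>k<i. \<Sum>a<m. (xi \<bullet> ((A ^\<^sub>m (i - 1 - k)) *\<^sub>v col B a)) * u (th + int (j + k)) $ a)"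
  using assms(2)
proof (induction i arbitrary: j)
  case 0
  then show ?case using A x_carrier[of j] by simp
next
  case (Suc i)
  have xj: "x (th + int j) \<in> carrier_vec n" "u (th + int j) \<in> carrier_vec m"
    using Suc.prems x_carrier u_nat by auto
  have Ai: "A ^\<^sub>m i \<in> carrier_mat n n" using A by simp
  have step: "x (th + int (Suc j)) = A *\<^sub>v x (th + int j) + B *\<^sub>v u (th + int j)"
    using xs[of "th + int j"] Suc.prems by (simp add: add.assoc[symmetric] add.commute[of 1])
  have "xi \<bullet> ((A ^\<^sub>m i) *\<^sub>v (B *\<^sub>v u (th + int j))) = (\<Sum>a<m. (xi \<bullet> ((A ^\<^sub>m i) *\<^sub>v col B a)) * u (th + int j) $ a)"
  proof -
    let ?w = "(A ^\<^sub>m i * B)\<^sup>T *\<^sub>v xi"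
    have AB: "A ^\<^sub>m i * B \<in> carrier_mat n m" using Ai B by simp
    have "xi \<bullet> ((A ^\<^sub>m i) *\<^sub>v (B *\<^sub>v u (th + int j))) = xi \<bullet> ((A ^\<^sub>m i * B) *\<^sub>v u (th + int j))"
      using assoc_mult_mat_vec[OF Ai B xj(2)] by simp
    also have "\<dots> = ?w \<bullet> u (th + int j)" by (rule adjoint_prod[OF AB xj(2) xi])
    also have "\<dots> = (\<Sum>a<m. ?w $ a * u (th + int j) $ a)"
      using xj(2) by (simp add: scalar_prod_def atLeast0LessThan)
    also have "\<dots> = (\<Sum>a<m. (xi \<bullet> ((A ^\<^sub>m i) *\<^sub>v col B a)) * u (th + int j) $ a)"
    proof (rule sum.cong[OF refl])
      fix a assume a: "a \<in> {..<m}"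
      then have "?w $ a = col (A ^\<^sub>m i * B) a \<bullet> xi" using AB B by simp
      also have "\<dots> = ((A ^\<^sub>m i) *\<^sub>v col B a) \<bullet> xi" using col_mult2[OF Ai B, of a] a by simp
      also have "\<dots> = xi \<bullet> ((A ^\<^sub>m i) *\<^sub>v col B a)"
        using Ai B xi by (intro comm_scalar_prod[of _ n]) auto
      finally show "?w $ a * u (th + int j) $ a = (xi \<bullet> ((A ^\<^sub>m i) *\<^sub>v col B a)) * u (th + int j) $ a"
        by simp
    qed
    finally show ?thesis .
  qed
  moreover have "xi \<bullet> ((A ^\<^sub>m i) *\<^sub>v x (th + int (Suc j))) =
      xi \<bullet> ((A ^\<^sub>m Suc i) *\<^sub>v x (th + int j)) + xi \<bullet> ((A ^\<^sub>m i) *\<^sub>v (B *\<^sub>v u (th + int j)))"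
  proof -
    have c: "A *\<^sub>v x (th + int j) \<in> carrier_vec n" "B *\<^sub>v u (th + int j) \<in> carrier_vec n"
      using A B xj by (auto intro: mult_mat_vec_carrier)
    show ?thesis
      unfolding step mult_add_distrib_mat_vec[OF Ai c] pow_mat_mult_vec_Suc[OF A xj(1)]
      using Ai c by (intro scalar_prod_add_distrib[OF xi]) (auto intro: mult_mat_vec_carrier)
  qed
  moreover have "xi \<bullet> x (th + int (Suc j + i)) = xi \<bullet> ((A ^\<^sub>m i) *\<^sub>v x (th + int (Suc j)))
    + (\<Sum>k<i. \<Sum>a<m. (xi \<bullet> ((A ^\<^sub>m (i - 1 - k)) *\<^sub>v col B a)) * u (th + int (Suc j + k)) $ a)"
    using Suc.prems by (intro Suc.IH) simp
  ultimately show ?case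
    by (simp add: sum.lessThan_Suc_shift add.left_commute[of _ "1::int"] del: pow_mat.simps sum.lessThan_Suc)
qed

text \<open>The form in which persistent excitation is used: a linear relation between \<open>L + n\<close> consecutive inputs that
  holds at all times of the data record is trivial.\<close>
lemma excitation_kernel:
  fixes \<theta> :: "nat \<Rightarrow> nat \<Rightarrow> real"
  assumes z: "\<And>j. j + L + n < Td + 1 \<Longrightarrow> (\<Sum>k<L+n. \<Sum>a<m. \<theta> k a * u (th + int (j + k)) $ a) = 0"
    and "k < L + n" "a < m"
  shows "\<theta> k a = 0"
proof -
  let ?H = "hankel m u th Td (L + n)" and ?w = "vec (m * (L + n)) (\<lambda>r. \<theta> (r div m) (r mod m))"
  have H: "?H \<in> carrier_mat (m * (L + n)) (Td + 1 - (L + n))" unfolding hankel_def by simp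
  have "?H\<^sup>T *\<^sub>v ?w = 0\<^sub>v (Td + 1 - (L + n))"
  proof
    show "dim_vec (?H\<^sup>T *\<^sub>v ?w) = dim_vec (0\<^sub>v (Td + 1 - (L + n)))" using H by simp
    fix j assume "j < dim_vec (0\<^sub>v (Td + 1 - (L + n)) :: real vec)"
    then have j: "j < Td + 1 - (L + n)" by simp
    have "(?H\<^sup>T *\<^sub>v ?w) $ j = (\<Sum>r<m * (L + n). \<theta> (r div m) (r mod m) * u (th + int (j + r div m)) $ (r mod m))"
      using j by (auto simp: hankel_def scalar_prod_def atLeast0LessThan mult.commute add.assoc intro!: sum.cong)
    also have "\<dots> = (\<Sum>k<L+n. \<Sum>a<m. \<theta> k a * u (th + int (j + k)) $ a)"
      by (rule sum_div_mod)
    also have "\<dots> = 0" using j by (intro z) simp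
    finally show "(?H\<^sup>T *\<^sub>v ?w) $ j = 0\<^sub>v (Td + 1 - (L + n)) $ j" using j by simp
  qed
  then have "?w = 0\<^sub>v (m * (L + n))"
    using pe left_kernel_of_full_row_rank[OF H] unfolding persistently_exciting_def by simp
  moreover have r: "m * k + a < m * (L + n)"
  proof -
    have "m * k + a < m * Suc k" using assms(3) by simp
    also have "\<dots> \<le> m * (L + n)" using assms(2) by (intro mult_le_mono2) simp
    finally show ?thesis .
  qed
  ultimately have "?w $ (m * k + a) = 0" by simp
  then show ?thesis using r assms(3) by simp
qed

text \<open>A relation \<open>(xi, \<eta>)\<close> between the state at time \<open>j\<close> and the following \<open>L\<close> inputs can be read \<open>i\<close> steps later and
  pulled back to the state at \<open>j\<close>; it then involves \<open>xi \<bullet> A\<^sup>i x\<^sub>j\<close> and \<open>L + i\<close> inputs. Combining these for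
  \<open>i \<le> n\<close> with the coefficients of \<open>powers_dependent\<close> removes the state, and excitation makes the remaining
  input coefficients \<open>\<theta>\<close> vanish. They have a triangular shape: the last
  nonzero block of \<open>\<eta>\<close> would reappear, times \<open>c\<^sub>d\<close>, as a block of \<open>\<theta>\<close>, and once \<open>\<eta> = 0\<close> the blocks of \<open>\<theta>\<close>
  are combinations of the numbers \<open>\<beta> e = xi \<bullet> A\<^sup>e B\<close> with leading coefficient \<open>c\<^sub>d\<close>. Hence \<open>\<eta> = 0\<close>, then
  \<open>\<beta> e = 0\<close> for all \<open>e\<close>, and controllability gives \<open>xi = 0\<close>.\<close>
lemma willems_kernel:
  fixes \<eta> :: "nat \<Rightarrow> nat \<Rightarrow> real"
  assumes xi: "xi \<in> carrier_vec n"
    and z: "\<And>j. j < N \<Longrightarrow> xi \<bullet> x (th + int j) + (\<Sum>k<L. \<Sum>a<m. \<eta> k a * u (th + int (j + k)) $ a) = 0"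
  shows "xi = 0\<^sub>v n" "k < L \<Longrightarrow> a < m \<Longrightarrow> \<eta> k a = 0"
proof -
  obtain c d where d: "d \<le> n" "c d \<noteq> 0" "\<And>i. i > d \<Longrightarrow> c i = 0"
    and dep: "\<And>v. v \<in> carrier_vec n \<Longrightarrow> (\<Sum>i\<le>d. c i * (xi \<bullet> ((A ^\<^sub>m i) *\<^sub>v v))) = (0::real)"
    using powers_dependent[OF A xi] by metis
  define \<beta> where "\<beta> e a = xi \<bullet> ((A ^\<^sub>m e) *\<^sub>v col B a)" for e a
  define \<eta>' where "\<eta>' k a = (if k < L then \<eta> k a else 0)" for k a
  define h where "h i k a = (if k < i then \<beta> (i - 1 - k) a else \<eta>' (k - i) a)" for i k a
  define \<theta> where "\<theta> k a = (\<Sum>i\<le>d. c i * h i k a)" for k a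
  have \<theta>0: "\<theta> k a = 0" if "k < L + n" "a < m" for k a
  proof (rule excitation_kernel[OF _ that])
    fix j assume j: "j + L + n < Td + 1"
    have eq: "xi \<bullet> ((A ^\<^sub>m i) *\<^sub>v x (th + int j)) + (\<Sum>k<L+n. \<Sum>a<m. h i k a * u (th + int (j + k)) $ a) = 0"
      if i: "i \<le> d" for i
    proof -
      let ?f = "\<lambda>k. \<Sum>a<m. h i k a * u (th + int (j + k)) $ a"
      have "(\<Sum>k<L+n. ?f k) = (\<Sum>k<i+L. ?f k)"
        using i d(1) by (intro sum.mono_neutral_right) (auto simp: h_def \<eta>'_def)
      also have "\<dots> = (\<Sum>k<i. ?f k) + (\<Sum>k<L. ?f (i + k))"
        by (induction L) auto
      also have "(\<Sum>k<i. ?f k) = (\<Sum>k<i. \<Sum>a<m. \<beta> (i - 1 - k) a * u (th + int (j + k)) $ a)"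
        by (simp add: h_def)
      also have "(\<Sum>k<L. ?f (i + k)) = (\<Sum>k<L. \<Sum>a<m. \<eta> k a * u (th + int (j + i + k)) $ a)"
        by (simp add: h_def \<eta>'_def add.assoc)
      finally have *: "(\<Sum>k<L+n. ?f k) = (\<Sum>k<i. \<Sum>a<m. \<beta> (i - 1 - k) a * u (th + int (j + k)) $ a)
        + (\<Sum>k<L. \<Sum>a<m. \<eta> k a * u (th + int (j + i + k)) $ a)" .
      have "j + i < N" "j + i \<le> Td" using j i d(1) N by auto
      from z[OF this(1)] state_expansion[OF xi this(2)] show ?thesis
        unfolding * \<beta>_def by simp
    qed
    have "(\<Sum>k<L+n. \<Sum>a<m. \<theta> k a * u (th + int (j + k)) $ a)
      = (\<Sum>k<L+n. \<Sum>a<m. \<Sum>i\<le>d. c i * (h i k a * u (th + int (j + k)) $ a))"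
      unfolding \<theta>_def sum_distrib_right by (simp add: mult.assoc)
    also have "\<dots> = (\<Sum>k<L+n. \<Sum>i\<le>d. \<Sum>a<m. c i * (h i k a * u (th + int (j + k)) $ a))"
      by (rule sum.cong[OF refl], rule sum.swap)
    also have "\<dots> = (\<Sum>i\<le>d. \<Sum>k<L+n. \<Sum>a<m. c i * (h i k a * u (th + int (j + k)) $ a))"
      by (rule sum.swap)
    also have "\<dots> = (\<Sum>i\<le>d. c i * (\<Sum>k<L+n. \<Sum>a<m. h i k a * u (th + int (j + k)) $ a))"
      by (simp add: sum_distrib_left)
    also have "\<dots> = (\<Sum>i\<le>d. - (c i * (xi \<bullet> ((A ^\<^sub>m i) *\<^sub>v x (th + int j)))))"
    proof (rule sum.cong[OF refl])
      fix i assume "i \<in> {..d}"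
      then have "(\<Sum>k<L+n. \<Sum>a<m. h i k a * u (th + int (j + k)) $ a) = - (xi \<bullet> ((A ^\<^sub>m i) *\<^sub>v x (th + int j)))"
        using eq[of i] by simp
      then show "c i * (\<Sum>k<L+n. \<Sum>a<m. h i k a * u (th + int (j + k)) $ a) = - (c i * (xi \<bullet> ((A ^\<^sub>m i) *\<^sub>v x (th + int j))))"
        by simp
    qed
    also have "\<dots> = 0" using dep[OF x_carrier[of j]] j by (simp add: sum_negf)
    finally show "(\<Sum>k<L+n. \<Sum>a<m. \<theta> k a * u (th + int (j + k)) $ a) = 0" .
  qed
  \<comment> \<open>At block \<open>l' + d\<close>, with \<open>l'\<close> the last nonzero block of \<open>\<eta>\<close>, only the summand \<open>i = d\<close> survives.\<close>
  have \<eta>'0: "\<eta>' l a = 0" if a: "a < m" for l a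
  proof (rule ccontr)
    assume l: "\<eta>' l a \<noteq> 0"
    define l' where "l' = Max {l. l < L \<and> \<eta>' l a \<noteq> 0}"
    have fin: "finite {l. l < L \<and> \<eta>' l a \<noteq> 0}" by simp
    have "l < L" using l by (auto simp: \<eta>'_def split: if_splits)
    then have "l' \<in> {l. l < L \<and> \<eta>' l a \<noteq> 0}" unfolding l'_def using fin l by (intro Max_in) auto
    then have l': "l' < L" "\<eta>' l' a \<noteq> 0" by auto
    have gt: "\<eta>' i a = 0" if "i > l'" for i
      using Max_ge[OF fin, of i] that unfolding l'_def[symmetric] by (cases "i < L") (auto simp: \<eta>'_def)
    have "0 = \<theta> (l' + d) a" using \<theta>0[of "l' + d" a] l' d(1) a by simp
    also have "\<dots> = (\<Sum>i\<in>{d}. c i * h i (l' + d) a)"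
      unfolding \<theta>_def by (rule sum.mono_neutral_right) (auto simp: h_def gt)
    also have "\<dots> = c d * \<eta>' l' a" by (simp add: h_def)
    finally show False using l' d(2) by simp
  qed
  then show "k < L \<Longrightarrow> a < m \<Longrightarrow> \<eta> k a = 0" for k a unfolding \<eta>'_def by metis
  \<comment> \<open>For \<open>e < d\<close> read off block \<open>d - 1 - e\<close>; for larger \<open>e\<close> apply the dependency to \<open>A\<^bsup>e-d\<^esup> B\<close>. In both cases all
    other summands contain some \<open>\<beta>\<close> with a smaller exponent.\<close>
  have \<beta>0: "\<beta> e a = 0" if a: "a < m" for e a
  proof (induction e rule: less_induct)
    case (less e)
    have "c d * \<beta> e a = 0"
    proof (cases "e < d")
      case True
      have "0 = \<theta> (d - 1 - e) a" using \<theta>0[of "d - 1 - e" a] d(1) a True by simp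
      also have "\<dots> = (\<Sum>i\<in>{d}. c i * h i (d - 1 - e) a)"
        unfolding \<theta>_def using True a by (intro sum.mono_neutral_right) (auto simp: h_def \<eta>'0 intro!: less)
      also have "\<dots> = c d * \<beta> e a" using True by (simp add: h_def)
      finally show ?thesis by simp
    next
      case False
      have Ba: "col B a \<in> carrier_vec n" using B by auto
      have "0 = (\<Sum>i\<le>d. c i * (xi \<bullet> ((A ^\<^sub>m i) *\<^sub>v ((A ^\<^sub>m (e - d)) *\<^sub>v col B a))))"
        using A Ba by (intro dep[symmetric] mult_mat_vec_carrier[of _ n n]) auto
      also have "\<dots> = (\<Sum>i\<le>d. c i * \<beta> (i + (e - d)) a)"
        by (simp add: \<beta>_def pow_mat_mult_vec_add[OF A Ba])
      also have "\<dots> = (\<Sum>i\<in>{d}. c i * \<beta> (i + (e - d)) a)"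
        using False by (intro sum.mono_neutral_right) (auto intro!: less)
      also have "\<dots> = c d * \<beta> e a" using False by simp
      finally show ?thesis by simp
    qed
    then show ?case using d(2) by simp
  qed
  show "xi = 0\<^sub>v n"
  proof (rule left_kernel_of_full_row_rank[OF _ _ xi])
    show G: "controllability_mat A B \<in> carrier_mat n (m * n)" "mrank (controllability_mat A B) = n"
      using A B ctrb unfolding controllability_mat_def controllable_def by auto
    show "(controllability_mat A B)\<^sup>T *\<^sub>v xi = 0\<^sub>v (m * n)"
    proof
      show "dim_vec ((controllability_mat A B)\<^sup>T *\<^sub>v xi) = dim_vec (0\<^sub>v (m * n))" using G by simp
      fix j assume "j < dim_vec (0\<^sub>v (m * n) :: real vec)"
      then have j: "j < m * n" by simp
      then have jm: "j mod m < m" by (metis gr_implies_not0 mod_less_divisor mult_0 not_gr_zero)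
      have P: "A ^\<^sub>m (j div m) \<in> carrier_mat n n" using A by simp
      have "col (controllability_mat A B) j = (A ^\<^sub>m (j div m)) *\<^sub>v col B (j mod m)"
        unfolding col_mult2[OF P B jm, symmetric] using A B P j jm
        by (intro eq_vecI) (auto simp: controllability_mat_def)
      then have "((controllability_mat A B)\<^sup>T *\<^sub>v xi) $ j = \<beta> (j div m) (j mod m)"
        using j G comm_scalar_prod[OF mult_mat_vec_carrier[OF P col_carrier_vec[OF jm B]] xi]
        unfolding \<beta>_def by simp
      then show "((controllability_mat A B)\<^sup>T *\<^sub>v xi) $ j = 0\<^sub>v (m * n) $ j" using \<beta>0[OF jm] j by simp
    qed
  qed
qed

text \<open>Column \<open>j\<close> of these matrices is the state, input or output at time \<open>k\<close> of the \<open>j\<close>-th window, so that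
  \<open>X k *\<^sub>v g\<close>, \<open>U k *\<^sub>v g\<close> and \<open>Y k *\<^sub>v g\<close> are the trajectory obtained by combining the windows with weights \<open>g\<close>.\<close>
definition X where "X k = mat n N (\<lambda>(i, j). x (th + int j + int k) $ i)"
definition U where "U k = mat m N (\<lambda>(i, j). u (th + int j + int k) $ i)"
definition Y where "Y k = mat p N (\<lambda>(i, j). y (th + int j + int k) $ i)"

lemma XUY_carrier: "X k \<in> carrier_mat n N" "U k \<in> carrier_mat m N" "Y k \<in> carrier_mat p N"
  unfolding X_def U_def Y_def by auto

lemma X_step: "k < L \<Longrightarrow> X (Suc k) = A * X k + B * U k"
proof (intro eq_matI)
  fix i j assume k: "k < L" and ij: "i < dim_row (A * X k + B * U k)" "j < dim_col (A * X k + B * U k)"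
  then have i: "i < n" and j: "j < N" using A B XUY_carrier[of k] by auto
  have jk: "j + k < Td" using j k N by auto
  have "col (X k) j = x (th + int (j + k))" "col (U k) j = u (th + int (j + k))"
    using x_carrier[of "j + k"] u_nat[of "j + k"] jk j by (auto simp: X_def U_def add.assoc)
  moreover have "x (th + int (j + k) + 1) = A *\<^sub>v x (th + int (j + k)) + B *\<^sub>v u (th + int (j + k))"
    using xs jk by simp
  ultimately show "X (Suc k) $$ (i, j) = (A * X k + B * U k) $$ (i, j)"
    using i j A B XUY_carrier[of k] by (auto simp: X_def[of "Suc k"] algebra_simps)
qed (use A B XUY_carrier[of k] XUY_carrier[of "Suc k"] in auto)

lemma Y_eq: "k < L \<Longrightarrow> Y k = C * X k + D * U k"
proof (intro eq_matI)
  fix i j assume k: "k < L" and ij: "i < dim_row (C * X k + D * U k)" "j < dim_col (C * X k + D * U k)"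
  then have i: "i < p" and j: "j < N" using C D XUY_carrier[of k] by auto
  have jk: "j + k < Td" using j k N by auto
  have "col (X k) j = x (th + int (j + k))" "col (U k) j = u (th + int (j + k))"
    using x_carrier[of "j + k"] u_nat[of "j + k"] jk j by (auto simp: X_def U_def add.assoc)
  moreover have "y (th + int (j + k)) = C *\<^sub>v x (th + int (j + k)) + D *\<^sub>v u (th + int (j + k))"
    using ys jk by simp
  ultimately show "Y k $$ (i, j) = (C * X k + D * U k) $$ (i, j)"
    using i j C D XUY_carrier[of k] by (auto simp: Y_def algebra_simps)
qed (use C D XUY_carrier[of k] in auto)

lemma hankel_vec:
  assumes g: "g \<in> carrier_vec N"
  shows "r < m * L \<Longrightarrow> (hankel m u th Td L *\<^sub>v g) $ r = (U (r div m) *\<^sub>v g) $ (r mod m)"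
    "r < p * L \<Longrightarrow> (hankel p y th Td L *\<^sub>v g) $ r = (Y (r div p) *\<^sub>v g) $ (r mod p)"
proof -
  have *: "r mod d < d" if "r < d * L" for r d :: nat
    using that by (metis gr_implies_not0 mod_less_divisor mult_0 not_gr_zero)
  have H: "hankel d w th Td L = mat (d * L) N (\<lambda>(i, j). w (th + int j + int (i div d)) $ (i mod d))" for d w
    unfolding hankel_def N ..
  show "r < m * L \<Longrightarrow> (hankel m u th Td L *\<^sub>v g) $ r = (U (r div m) *\<^sub>v g) $ (r mod m)"
    using *[of r m] g by (auto simp: H U_def scalar_prod_def)
  show "r < p * L \<Longrightarrow> (hankel p y th Td L *\<^sub>v g) $ r = (Y (r div p) *\<^sub>v g) $ (r mod p)"
    using *[of r p] g by (auto simp: H Y_def scalar_prod_def)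
qed

text \<open>The fundamental lemma: an initial state and an input sequence of length \<open>L\<close> can be prescribed freely, because
  \<open>willems_kernel\<close> says that the rows of initial states and inputs are independent.\<close>
lemma combination_exists:
  assumes xi: "xi \<in> carrier_vec n" and v: "v \<in> carrier_vec (m * L)"
  obtains g where "g \<in> carrier_vec N" "X 0 *\<^sub>v g = xi" "hankel m u th Td L *\<^sub>v g = v"
proof -
  let ?H = "hankel m u th Td L"
  let ?P = "X 0 @\<^sub>r ?H"
  have H: "?H \<in> carrier_mat (m * L) N" unfolding hankel_def N by simp
  have P: "?P \<in> carrier_mat (n + m * L) N" using H XUY_carrier by auto
  have lk: "w = 0\<^sub>v (n + m * L)" if w: "w \<in> carrier_vec (n + m * L)" "?P\<^sup>T *\<^sub>v w = 0\<^sub>v N" for w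
  proof -
    define w1 w2 where "w1 = vec_first w n" and "w2 = vec_last w (m * L)"
    have w12: "w = w1 @\<^sub>v w2" "w1 \<in> carrier_vec n" "w2 \<in> carrier_vec (m * L)"
      using w(1) by (auto simp: w1_def w2_def)
    have rel: "w1 \<bullet> x (th + int j) + (\<Sum>k<L. \<Sum>a<m. w2 $ (k * m + a) * u (th + int (j + k)) $ a) = 0"
      if j: "j < N" for j
    proof -
      have jT: "j \<le> Td" using j N by simp
      have cX: "col (X 0) j = x (th + int j)"
        using x_carrier[of j] j jT by (auto simp: X_def)
      have "0 = (?P\<^sup>T *\<^sub>v w) $ j" using w j by simp
      also have "\<dots> = col ?P j \<bullet> (w1 @\<^sub>v w2)" using P j w12(1) by simp
      also have "\<dots> = col (X 0) j \<bullet> w1 + col ?H j \<bullet> w2"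
        unfolding col_append_rows[OF XUY_carrier(1) H j]
        using w12 col_dim[of "X 0" j] col_dim[of ?H j] carrier_matD[OF H] carrier_matD[OF XUY_carrier(1)[of 0]]
          by (intro scalar_prod_append[of _ n _ "m * L"]) auto
      also have "col (X 0) j \<bullet> w1 = w1 \<bullet> x (th + int j)"
        unfolding cX using w12(2) x_carrier[OF jT] by (intro comm_scalar_prod[of _ n]) auto
      also have "col ?H j \<bullet> w2 = (\<Sum>r<m * L. w2 $ ((r div m) * m + r mod m) * u (th + int (j + r div m)) $ (r mod m))"
        using w12(3) j N by (auto simp: hankel_def scalar_prod_def atLeast0LessThan mult.commute add.assoc intro!: sum.cong)
      also have "\<dots> = (\<Sum>k<L. \<Sum>a<m. w2 $ (k * m + a) * u (th + int (j + k)) $ a)"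
        by (rule sum_div_mod)
      finally show ?thesis by simp
    qed
    have "w1 = 0\<^sub>v n" by (rule willems_kernel(1)[OF w12(2) rel])
    moreover have "w2 = 0\<^sub>v (m * L)"
    proof
      fix r assume "r < dim_vec (0\<^sub>v (m * L) :: real vec)"
      then have r: "r < m * L" by simp
      then have "r div m < L" "r mod m < m"
        by (auto simp: less_mult_imp_div_less mult.commute intro!: mod_less_divisor gr0I)
      then show "w2 $ r = 0\<^sub>v (m * L) $ r"
        using willems_kernel(2)[OF w12(2) rel, of "r div m" "r mod m"] r by simp
    qed (use w12 in simp)
    ultimately show ?thesis unfolding w12(1) by auto
  qed
  let ?R = "?P\<^sup>T * minv (?P * ?P\<^sup>T)"
  note ri = right_inverse[OF P lk]
  have R: "?R \<in> carrier_mat N (n + m * L)" "?P * ?R = 1\<^sub>m (n + m * L)" using ri by blast+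
  have xv: "xi @\<^sub>v v \<in> carrier_vec (n + m * L)" using xi v by simp
  have g: "?R *\<^sub>v (xi @\<^sub>v v) \<in> carrier_vec N" using R xv by simp
  have "?P *\<^sub>v (?R *\<^sub>v (xi @\<^sub>v v)) = xi @\<^sub>v v"
    using assoc_mult_mat_vec[OF P R(1) xv] R(2) xv by simp
  then have "X 0 *\<^sub>v (?R *\<^sub>v (xi @\<^sub>v v)) @\<^sub>v ?H *\<^sub>v (?R *\<^sub>v (xi @\<^sub>v v)) = xi @\<^sub>v v"
    using mat_mult_append[OF XUY_carrier(1) H g] by simp
  then have "X 0 *\<^sub>v (?R *\<^sub>v (xi @\<^sub>v v)) = xi" "?H *\<^sub>v (?R *\<^sub>v (xi @\<^sub>v v)) = v"
    using append_vec_eq[OF mult_mat_vec_carrier[OF XUY_carrier(1) g] xi] by blast+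
  then show thesis using that[OF g] by blast
qed

end

section \<open>Past and future data\<close>

lemma observability_injective_mono:
  assumes A: "A \<in> carrier_mat n n" and C: "C \<in> carrier_mat p n" and le: "l \<le> l'"
    and r: "mrank (observability_mat A C l) = n"
    and v: "v \<in> carrier_vec n" "observability_mat A C l' *\<^sub>v v = 0\<^sub>v (p * l')"
  shows "v = 0\<^sub>v n"
proof (rule inj_of_full_col_rank[OF _ r v(1)])
  show "observability_mat A C l \<in> carrier_mat (p * l) n"
    using A C unfolding observability_mat_def by auto
  show "observability_mat A C l *\<^sub>v v = 0\<^sub>v (p * l)"
  proof
    fix i assume "i < dim_vec (0\<^sub>v (p * l) :: real vec)"
    then have i: "i < p * l" by simp
    then have "i < p * l'" using mult_le_mono2[OF le, of p] by (rule order_less_le_trans)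
    note i = i this
    have "(observability_mat A C l *\<^sub>v v) $ i = (observability_mat A C l' *\<^sub>v v) $ i"
      using i A C v(1) by (auto simp: observability_mat_def scalar_prod_def)
    then show "(observability_mat A C l *\<^sub>v v) $ i = 0\<^sub>v (p * l) $ i" using i v(2) by simp
  qed (use A C in \<open>auto simp: observability_mat_def\<close>)
qed

lemma observability_mat_mult_vec:
  assumes A: "A \<in> carrier_mat n n" and C: "C \<in> carrier_mat p n" and v: "v \<in> carrier_vec n" and i: "i < p * l"
  shows "(observability_mat A C l *\<^sub>v v) $ i = (C *\<^sub>v ((A ^\<^sub>m (i div p)) *\<^sub>v v)) $ (i mod p)"
proof -
  have im: "i mod p < p" using i by (metis gr_implies_not0 mod_less_divisor mult_0 not_gr_zero)
  have P: "A ^\<^sub>m (i div p) \<in> carrier_mat n n" using A by simp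
  have "(observability_mat A C l *\<^sub>v v) $ i = ((C * A ^\<^sub>m (i div p)) *\<^sub>v v) $ (i mod p)"
    using i im A C P v by (auto simp: observability_mat_def scalar_prod_def)
  then show ?thesis using assoc_mult_mat_vec[OF C P v] by simp
qed

lemma mult_mat_zero_vec: "(A :: real mat) \<in> carrier_mat nr nc \<Longrightarrow> A *\<^sub>v 0\<^sub>v nc = 0\<^sub>v nr"
  by (intro eq_vecI) auto

lemma lti_unique:
  assumes "X 0 = X' 0" "\<And>k. k < K \<Longrightarrow> X (Suc k) = A *\<^sub>v X k + B *\<^sub>v U k"
    "\<And>k. k < K \<Longrightarrow> X' (Suc k) = A *\<^sub>v X' k + B *\<^sub>v U k" "k \<le> K"
  shows "X k = X' k"
  using assms(4) by (induction k) (auto simp: assms(1-3))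

context lti_data
begin

lemma X_vec_step:
  "k < L \<Longrightarrow> g \<in> carrier_vec N \<Longrightarrow> X (Suc k) *\<^sub>v g = A *\<^sub>v (X k *\<^sub>v g) + B *\<^sub>v (U k *\<^sub>v g)"
  using A B XUY_carrier[of k] by (simp add: X_step add_mult_distrib_mat_vec[of _ n N] assoc_mult_mat_vec[of _ n n _ N] assoc_mult_mat_vec[of _ n m _ N])

lemma Y_vec_eq:
  "k < L \<Longrightarrow> g \<in> carrier_vec N \<Longrightarrow> Y k *\<^sub>v g = C *\<^sub>v (X k *\<^sub>v g) + D *\<^sub>v (U k *\<^sub>v g)"
  using C D XUY_carrier[of k] by (simp add: Y_eq add_mult_distrib_mat_vec[of _ p N] assoc_mult_mat_vec[of _ p n _ N] assoc_mult_mat_vec[of _ p m _ N])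

end

text \<open>The windows are split into a past of length \<open>Tini\<close> and a future of length \<open>Te\<close>.\<close>
locale split_lti_data = lti_data n m p Td "Tini + Te" N A B C D th u y x
  for n m p Td Tini Te N A B C D th u y x +
  fixes Up Uf Yp Yf :: "real mat"
  assumes U_part: "hankel m u th Td (Tini + Te) = Up @\<^sub>r Uf"
    and Up: "Up \<in> carrier_mat (m * Tini) N" and Uf: "Uf \<in> carrier_mat (m * Te) N"
    and Y_part: "hankel p y th Td (Tini + Te) = Yp @\<^sub>r Yf"
    and Yp: "Yp \<in> carrier_mat (p * Tini) N" and Yf: "Yf \<in> carrier_mat (p * Te) N"
begin

lemma Up_index: "g \<in> carrier_vec N \<Longrightarrow> r < m * Tini \<Longrightarrow> (Up *\<^sub>v g) $ r = (U (r div m) *\<^sub>v g) $ (r mod m)"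
  using append_blocks(1)[OF Up Uf, of g "\<lambda>k i. (U k *\<^sub>v g) $ i"] hankel_vec(1)[of g] unfolding U_part by blast

lemma Uf_index: "g \<in> carrier_vec N \<Longrightarrow> r < m * Te \<Longrightarrow> (Uf *\<^sub>v g) $ r = (U (Tini + r div m) *\<^sub>v g) $ (r mod m)"
  using append_blocks(2)[OF Up Uf, of g "\<lambda>k i. (U k *\<^sub>v g) $ i"] hankel_vec(1)[of g] unfolding U_part by blast

lemma Yp_index: "g \<in> carrier_vec N \<Longrightarrow> r < p * Tini \<Longrightarrow> (Yp *\<^sub>v g) $ r = (Y (r div p) *\<^sub>v g) $ (r mod p)"
  using append_blocks(1)[OF Yp Yf, of g "\<lambda>k i. (Y k *\<^sub>v g) $ i"] hankel_vec(2)[of g] unfolding Y_part by blast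

lemma Yf_index: "g \<in> carrier_vec N \<Longrightarrow> r < p * Te \<Longrightarrow> (Yf *\<^sub>v g) $ r = (Y (Tini + r div p) *\<^sub>v g) $ (r mod p)"
  using append_blocks(2)[OF Yp Yf, of g "\<lambda>k i. (Y k *\<^sub>v g) $ i"] hankel_vec(2)[of g] unfolding Y_part by blast

lemma U_of_Up:
  assumes g: "g \<in> carrier_vec N" and k: "k < Tini"
    and w: "w k \<in> carrier_vec m" and Upg: "Up *\<^sub>v g = vec (m * Tini) (\<lambda>r. w (r div m) $ (r mod m))"
  shows "U k *\<^sub>v g = w k"
proof (rule block_eqI[OF _ w])
  show "U k *\<^sub>v g \<in> carrier_vec m" using XUY_carrier(2) g by (rule mult_mat_vec_carrier)
  fix a assume a: "a < m"
  have "m * k + a < m * Suc k" using a by simp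
  also have "\<dots> \<le> m * Tini" using k by (intro mult_le_mono2) simp
  finally have r: "m * k + a < m * Tini" .
  show "(U k *\<^sub>v g) $ a = w k $ a"
    using Up_index[OF g r] r a unfolding Upg by simp
qed

lemma U_of_Uf:
  assumes g: "g \<in> carrier_vec N" and k: "k < Te" and Ufg: "Uf *\<^sub>v g = 0\<^sub>v (m * Te)"
  shows "U (Tini + k) *\<^sub>v g = 0\<^sub>v m"
proof (rule block_eqI)
  show "U (Tini + k) *\<^sub>v g \<in> carrier_vec m" using XUY_carrier(2) g by (rule mult_mat_vec_carrier)
  fix a assume a: "a < m"
  have "m * k + a < m * Suc k" using a by simp
  also have "\<dots> \<le> m * Te" using k by (intro mult_le_mono2) simp
  finally have r: "m * k + a < m * Te" .
  show "(U (Tini + k) *\<^sub>v g) $ a = 0\<^sub>v m $ a"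
    using Uf_index[OF g r] r a unfolding Ufg by simp
qed simp

text \<open>Start at the zero state with zero past input: the outputs stay zero until the future inputs begin.\<close>
lemma zero_past_any_future_input:
  assumes z: "z \<in> carrier_vec (m * Te)"
  shows "\<exists>g\<in>carrier_vec N. Up *\<^sub>v g = 0\<^sub>v (m * Tini) \<and> Yp *\<^sub>v g = 0\<^sub>v (p * Tini) \<and> Uf *\<^sub>v g = z"
proof -
  have "0\<^sub>v (m * Tini) @\<^sub>v z \<in> carrier_vec (m * (Tini + Te))" using z by (simp add: distrib_left)
  from combination_exists[OF zero_carrier_vec this]
  obtain g where g: "g \<in> carrier_vec N" "X 0 *\<^sub>v g = 0\<^sub>v n" "(Up @\<^sub>r Uf) *\<^sub>v g = 0\<^sub>v (m * Tini) @\<^sub>v z"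
    unfolding U_part by metis
  have UU: "Up *\<^sub>v g = 0\<^sub>v (m * Tini)" "Uf *\<^sub>v g = z"
    using g(3) unfolding mat_mult_append[OF Up Uf g(1)]
    using append_vec_eq[OF mult_mat_vec_carrier[OF Up g(1)], of "0\<^sub>v (m * Tini)"] by auto
  have U0: "U k *\<^sub>v g = 0\<^sub>v m" if "k < Tini" for k
    using U_of_Up[OF g(1) that, of "\<lambda>_. 0\<^sub>v m"] UU(1) zero_vec_blocks by simp
  have X0: "X k *\<^sub>v g = 0\<^sub>v n" if "k \<le> Tini" for k
    using that
  proof (induction k)
    case (Suc k)
    then show ?case using X_vec_step[of k g] U0[of k] g(1) A B
      by (simp add: mult_mat_zero_vec[OF A] mult_mat_zero_vec[OF B])
  qed (use g in simp)
  have "Yp *\<^sub>v g = 0\<^sub>v (p * Tini)"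
  proof
    fix r assume "r < dim_vec (0\<^sub>v (p * Tini) :: real vec)"
    then have r: "r < p * Tini" by simp
    note b = block_index[OF r]
    show "(Yp *\<^sub>v g) $ r = 0\<^sub>v (p * Tini) $ r"
      using Yp_index[OF g(1) r] Y_vec_eq[of "r div p" g] g(1) X0[of "r div p"] U0[of "r div p"] b r
      by (simp add: mult_mat_zero_vec[OF C] mult_mat_zero_vec[OF D])
  qed (use Yp in simp)
  then show ?thesis using g(1) UU by blast
qed

text \<open>Without input the outputs are \<open>C A\<^sup>k\<close> applied to the initial state. As \<open>Tini\<close> is at least the lag, the past
  outputs determine that state linearly, and hence the future outputs. The second case of
  \<open>robust_certificate\<close> rests on this factorization through the past output.\<close>
lemma free_response:
  assumes obsv: "observable A C" and lag: "lag A C \<le> Tini"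
  shows "\<exists>K\<in>carrier_mat (p * Te) (p * Tini). \<forall>g\<in>carrier_vec N.
    Up *\<^sub>v g = 0\<^sub>v (m * Tini) \<longrightarrow> Uf *\<^sub>v g = 0\<^sub>v (m * Te) \<longrightarrow> Yf *\<^sub>v g = K *\<^sub>v (Yp *\<^sub>v g)"
proof -
  let ?O = "observability_mat A C Tini" and ?E = "observability_mat A C Te"
  have O: "?O \<in> carrier_mat (p * Tini) n" and E: "?E \<in> carrier_mat (p * Te) n"
    using A C by (auto simp: observability_mat_def)
  have "mrank (observability_mat A C (lag A C)) = n"
    using LeastI[of "\<lambda>l. mrank (observability_mat A C l) = dim_row A" n] obsv A
    unfolding observable_def lag_def by auto
  from observability_injective_mono[OF A C lag this]
  have "v = 0\<^sub>v n" if "v \<in> carrier_vec n" "?O *\<^sub>v v = 0\<^sub>v (p * Tini)" for v using that by blast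
  from left_inverse[OF O this]
  obtain OL where OL: "OL \<in> carrier_mat n (p * Tini)" "OL * ?O = 1\<^sub>m n" by blast
  have AT: "A ^\<^sub>m Tini \<in> carrier_mat n n" using A by simp
  let ?K = "?E * (A ^\<^sub>m Tini * OL)"
  have "Yf *\<^sub>v g = ?K *\<^sub>v (Yp *\<^sub>v g)"
    if g: "g \<in> carrier_vec N" and Upg: "Up *\<^sub>v g = 0\<^sub>v (m * Tini)" and Ufg: "Uf *\<^sub>v g = 0\<^sub>v (m * Te)" for g
  proof -
    define xi where "xi = X 0 *\<^sub>v g"
    have xi: "xi \<in> carrier_vec n" unfolding xi_def using XUY_carrier(1) g by (rule mult_mat_vec_carrier)
    have U0: "U k *\<^sub>v g = 0\<^sub>v m" if "k < Tini + Te" for k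
    proof (cases "k < Tini")
      case True
      show ?thesis using U_of_Up[OF g True, of "\<lambda>_. 0\<^sub>v m"] Upg zero_vec_blocks by simp
    next
      case False
      then show ?thesis using U_of_Uf[OF g, of "k - Tini"] Ufg that by auto
    qed
    have Xk: "X k *\<^sub>v g = (A ^\<^sub>m k) *\<^sub>v xi" if "k \<le> Tini + Te" for k
      using that
    proof (induction k)
      case 0
      show ?case using A xi by (simp add: xi_def)
    next
      case (Suc k)
      have "(A ^\<^sub>m 1) *\<^sub>v ((A ^\<^sub>m k) *\<^sub>v xi) = (A ^\<^sub>m Suc k) *\<^sub>v xi"
        using pow_mat_mult_vec_add[OF A xi, of 1 k] by simp
      moreover have "A ^\<^sub>m 1 = A" using A by simp
      moreover have "(A ^\<^sub>m Suc k) *\<^sub>v xi \<in> carrier_vec n"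
        using A xi by (intro mult_mat_vec_carrier[of _ n n]) auto
      ultimately show ?case using Suc X_vec_step[of k g] U0[of k] g
        by (simp add: mult_mat_zero_vec[OF B] del: pow_mat.simps)
    qed
    have Yk: "Y k *\<^sub>v g = C *\<^sub>v ((A ^\<^sub>m k) *\<^sub>v xi)" if "k < Tini + Te" for k
    proof -
      have "C *\<^sub>v ((A ^\<^sub>m k) *\<^sub>v xi) \<in> carrier_vec p"
        using A C xi by (intro mult_mat_vec_carrier[of _ p n] mult_mat_vec_carrier[of _ n n]) auto
      then show ?thesis
        using Y_vec_eq[OF that g] U0[OF that] Xk[of k] that by (simp add: mult_mat_zero_vec[OF D])
    qed
    have "Yp *\<^sub>v g = ?O *\<^sub>v xi"
    proof
      fix r assume "r < dim_vec (?O *\<^sub>v xi)"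
      then have r: "r < p * Tini" using O by simp
      show "(Yp *\<^sub>v g) $ r = (?O *\<^sub>v xi) $ r"
        using Yp_index[OF g r] observability_mat_mult_vec[OF A C xi r] Yk[of "r div p"] block_index[OF r] by simp
    qed (use Yp O in simp)
    moreover have "OL *\<^sub>v (?O *\<^sub>v xi) = xi"
      using assoc_mult_mat_vec[OF OL(1) O xi] OL(2) xi by simp
    ultimately have xi_eq: "xi = OL *\<^sub>v (Yp *\<^sub>v g)" by simp
    have "Yf *\<^sub>v g = ?E *\<^sub>v ((A ^\<^sub>m Tini) *\<^sub>v xi)"
    proof
      fix r assume "r < dim_vec (?E *\<^sub>v ((A ^\<^sub>m Tini) *\<^sub>v xi))"
      then have r: "r < p * Te" using E by simp
      have "(A ^\<^sub>m Tini) *\<^sub>v xi \<in> carrier_vec n" using AT xi by (rule mult_mat_vec_carrier)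
      then show "(Yf *\<^sub>v g) $ r = (?E *\<^sub>v ((A ^\<^sub>m Tini) *\<^sub>v xi)) $ r"
        using Yf_index[OF g r] observability_mat_mult_vec[OF A C _ r] Yk[of "Tini + r div p"] block_index[OF r]
          pow_mat_mult_vec_add[OF A xi, of "r div p" Tini] by (simp add: add.commute)
    qed (use Yf E in simp)
    also have "\<dots> = ?E *\<^sub>v ((A ^\<^sub>m Tini) *\<^sub>v (OL *\<^sub>v (Yp *\<^sub>v g)))" using xi_eq by simp
    also have "\<dots> = ?K *\<^sub>v (Yp *\<^sub>v g)"
    proof -
      have w: "Yp *\<^sub>v g \<in> carrier_vec (p * Tini)" using Yp g by (rule mult_mat_vec_carrier)
      show ?thesis
        unfolding assoc_mult_mat_vec[OF E mult_carrier_mat[OF AT OL(1)] w] assoc_mult_mat_vec[OF AT OL(1) w] ..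
    qed
    finally show ?thesis .
  qed
  moreover have "?K \<in> carrier_mat (p * Te) (p * Tini)" using E AT OL(1) by (intro mult_carrier_mat)
  ultimately show ?thesis by blast
qed

text \<open>The combination is chosen with the initial state and inputs of the given trajectory (and future input zero);
  the outputs then agree since both sequences solve the same recursion.\<close>
lemma past_trajectory_represented:
  assumes tr: "trajectory A B C D t Tini v w"
  shows "\<exists>g\<in>carrier_vec N. Up *\<^sub>v g = stack m v t Tini \<and> Yp *\<^sub>v g = stack p w t Tini"
proof -
  obtain s where v: "\<And>k. k \<in> {t..<t + int Tini} \<Longrightarrow> v k \<in> carrier_vec m"
    and s0: "s t \<in> carrier_vec n"
    and s: "\<And>k. k \<in> {t..<t + int Tini} \<Longrightarrow> s (k + 1) = A *\<^sub>v s k + B *\<^sub>v v k"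
    and w: "\<And>k. k \<in> {t..<t + int Tini} \<Longrightarrow> w k = C *\<^sub>v s k + D *\<^sub>v v k"
    using tr A B unfolding trajectory_def by auto
  have "stack m v t Tini @\<^sub>v 0\<^sub>v (m * Te) \<in> carrier_vec (m * (Tini + Te))" by (simp add: stack_def distrib_left)
  from combination_exists[OF s0 this]
  obtain g where g: "g \<in> carrier_vec N" "X 0 *\<^sub>v g = s t" "(Up @\<^sub>r Uf) *\<^sub>v g = stack m v t Tini @\<^sub>v 0\<^sub>v (m * Te)"
    unfolding U_part by metis
  have Upg: "Up *\<^sub>v g = stack m v t Tini"
    using g(3) unfolding mat_mult_append[OF Up Uf g(1)]
    using append_vec_eq[OF mult_mat_vec_carrier[OF Up g(1)], of "stack m v t Tini"] by (auto simp: stack_def)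
  have Uk: "U k *\<^sub>v g = v (t + int k)" if "k < Tini" for k
    using U_of_Up[OF g(1) that, of "\<lambda>k. v (t + int k)"] v[of "t + int k"] that Upg by (auto simp: stack_def)
  have Xk: "X k *\<^sub>v g = s (t + int k)" if "k \<le> Tini" for k
  proof (rule lti_unique[of "\<lambda>k. X k *\<^sub>v g" "\<lambda>k. s (t + int k)" Tini A B "\<lambda>k. v (t + int k)", OF _ _ _ that])
    show "X (Suc k) *\<^sub>v g = A *\<^sub>v (X k *\<^sub>v g) + B *\<^sub>v v (t + int k)" if "k < Tini" for k
      using X_vec_step[of k g] g(1) Uk[OF that] that by simp
    show "s (t + int (Suc k)) = A *\<^sub>v s (t + int k) + B *\<^sub>v v (t + int k)" if "k < Tini" for k
      using s[of "t + int k"] that by (simp add: add.assoc add.commute[of 1])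
  qed (use g in simp)
  have "Yp *\<^sub>v g = stack p w t Tini"
  proof
    fix r assume "r < dim_vec (stack p w t Tini)"
    then have r: "r < p * Tini" by (simp add: stack_def)
    note b = block_index[OF r]
    show "(Yp *\<^sub>v g) $ r = stack p w t Tini $ r"
      using Yp_index[OF g(1) r] Y_vec_eq[of "r div p" g] g(1) Xk[of "r div p"] Uk[of "r div p"] w[of "t + int (r div p)"] b r
      by (simp add: stack_def)
  qed (use Yp in \<open>simp add: stack_def\<close>)
  then show ?thesis using g(1) Upg by blast
qed

end

section \<open>Quadratic forms and the S-lemma\<close>

text \<open>Linearity rules whose side conditions are equations between dimensions, so that the simplifier can discharge
  them after \<open>carrier_matD\<close> and \<open>carrier_vecD\<close>; carrier premises would leave the dimensions to be guessed.\<close>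
lemma sp_add_right: "dim_vec v = dim_vec w \<Longrightarrow> dim_vec w' = dim_vec w \<Longrightarrow> (v::real vec) \<bullet> (w + w') = v \<bullet> w + v \<bullet> w'"
  by (simp add: scalar_prod_def algebra_simps sum.distrib)

lemma sp_add_left: "dim_vec v = dim_vec w \<Longrightarrow> dim_vec v' = dim_vec w \<Longrightarrow> ((v::real vec) + v') \<bullet> w = v \<bullet> w + v' \<bullet> w"
  by (simp add: scalar_prod_def algebra_simps sum.distrib)

lemma sp_minus_right: "dim_vec v = dim_vec w \<Longrightarrow> dim_vec w' = dim_vec w \<Longrightarrow> (v::real vec) \<bullet> (w - w') = v \<bullet> w - v \<bullet> w'"
  by (simp add: scalar_prod_def algebra_simps sum_subtractf)

lemma sp_minus_left: "dim_vec v = dim_vec w \<Longrightarrow> dim_vec v' = dim_vec w \<Longrightarrow> ((v::real vec) - v') \<bullet> w = v \<bullet> w - v' \<bullet> w"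
  by (simp add: scalar_prod_def algebra_simps sum_subtractf)

lemma mv_add: "dim_vec v = dim_col A \<Longrightarrow> dim_vec w = dim_col A \<Longrightarrow> (A::real mat) *\<^sub>v (v + w) = A *\<^sub>v v + A *\<^sub>v w"
  by (intro eq_vecI) (auto simp: sp_add_right)

lemma mv_minus: "dim_vec v = dim_col A \<Longrightarrow> dim_vec w = dim_col A \<Longrightarrow> (A::real mat) *\<^sub>v (v - w) = A *\<^sub>v v - A *\<^sub>v w"
  by (intro eq_vecI) (auto simp: sp_minus_right)

lemma mv_smult: "dim_vec v = dim_col A \<Longrightarrow> (A::real mat) *\<^sub>v (k \<cdot>\<^sub>v v) = k \<cdot>\<^sub>v (A *\<^sub>v v)"
  by (intro eq_vecI) auto

lemma mv_assoc: "dim_vec v = dim_col B \<Longrightarrow> dim_row B = dim_col A \<Longrightarrow> ((A::real mat) * B) *\<^sub>v v = A *\<^sub>v (B *\<^sub>v v)"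
  by (rule assoc_mult_mat_vec[of _ "dim_row A" "dim_col A" _ "dim_col B"]) (auto intro: carrier_vecI)

lemma add_mv: "dim_row B = dim_row A \<Longrightarrow> dim_col B = dim_col A \<Longrightarrow> dim_vec v = dim_col A \<Longrightarrow> ((A::real mat) + B) *\<^sub>v v = A *\<^sub>v v + B *\<^sub>v v"
  by (rule add_mult_distrib_mat_vec[of _ "dim_row A" "dim_col A"]) (auto intro: carrier_vecI)

lemma minus_mv: "dim_row B = dim_row A \<Longrightarrow> dim_col B = dim_col A \<Longrightarrow> dim_vec v = dim_col A \<Longrightarrow> ((A::real mat) - B) *\<^sub>v v = A *\<^sub>v v - B *\<^sub>v v"
  by (rule minus_mult_distrib_mat_vec[of _ "dim_row A" "dim_col A"]) (auto intro: carrier_vecI)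

lemma smult_mv: "dim_vec v = dim_col A \<Longrightarrow> (k \<cdot>\<^sub>m (A::real mat)) *\<^sub>v v = k \<cdot>\<^sub>v (A *\<^sub>v v)"
  by (intro eq_vecI) auto

lemma smult_sp: "dim_vec v = dim_vec w \<Longrightarrow> (k \<cdot>\<^sub>v (v::real vec)) \<bullet> w = k * (v \<bullet> w)"
   "dim_vec v = dim_vec w \<Longrightarrow> (v::real vec) \<bullet> (k \<cdot>\<^sub>v w) = k * (v \<bullet> w)" by simp_all

lemmas bilinear_simps = sp_add_right sp_add_left sp_minus_right sp_minus_left mv_add mv_minus mv_smult mv_assoc add_mv
  minus_mv smult_mv smult_sp

lemma symmetric_form_commute:
  assumes A: "(A::real mat) \<in> carrier_mat n n" "A\<^sup>T = A" and xy: "x \<in> carrier_vec n" "y \<in> carrier_vec n"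
  shows "y \<bullet> (A *\<^sub>v x) = x \<bullet> (A *\<^sub>v y)"
  using adjoint_prod[OF A(1) xy] A comm_scalar_prod[of "A *\<^sub>v y" n x] xy mult_mat_vec_carrier[OF A(1) xy(2)] by simp

lemma form_on_line:
  assumes A: "(A::real mat) \<in> carrier_mat n n" "A\<^sup>T = A" and xy: "x \<in> carrier_vec n" "y \<in> carrier_vec n"
  shows "(x + s \<cdot>\<^sub>v y) \<bullet> (A *\<^sub>v (x + s \<cdot>\<^sub>v y)) = x \<bullet> (A *\<^sub>v x) + 2 * s * (x \<bullet> (A *\<^sub>v y)) + s\<^sup>2 * (y \<bullet> (A *\<^sub>v y))"
proof -
  note d = carrier_matD[OF A(1)] carrier_vecD[OF xy(1)] carrier_vecD[OF xy(2)]
  show ?thesis using symmetric_form_commute[OF A xy]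
    by (simp add: bilinear_simps d power2_eq_square algebra_simps)
qed

text \<open>Evaluate at the minimizer \<open>- b / c\<close>, or far out if \<open>c \<le> 0\<close>. With \<open>c = 0\<close> the conclusion says \<open>b = 0\<close>, and
  this degenerate case is used in \<open>robust_certificate\<close>.\<close>
lemma nonneg_quadratic_discriminant:
  fixes a b c :: real
  assumes "\<And>s. 0 \<le> a + 2 * s * b + s\<^sup>2 * c"
  shows "b\<^sup>2 \<le> a * c"
proof (cases "c = 0")
  case True
  have "b = 0"
  proof (rule ccontr)
    assume b: "b \<noteq> 0"
    have "0 \<le> a + 2 * (- (a + 1) / (2 * b)) * b" using assms[of "- (a + 1) / (2 * b)"] True by simp
    also have "\<dots> = -1" using b by (simp add: field_simps)
    finally show False by simp
  qed
  then show ?thesis using True by simp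
next
  case False
  have "c \<ge> 0"
  proof (rule ccontr)
    assume c: "\<not> c \<ge> 0"
    \<comment> \<open>For this \<open>s\<close> the quadratic term outweighs the other two.\<close>
    define s where "s = 1 + (\<bar>a\<bar> + 2 * \<bar>b\<bar>) / (- c)"
    have s1: "s \<ge> 1" using c by (auto simp: s_def divide_nonneg_neg divide_nonpos_neg)
    have "s * (- c) = - c + (\<bar>a\<bar> + 2 * \<bar>b\<bar>)" using c by (simp add: s_def field_simps)
    then have s2: "s * (- c) > \<bar>a\<bar> + 2 * \<bar>b\<bar>" using c by simp
    have "\<bar>a\<bar> + 2 * s * \<bar>b\<bar> \<le> s * (\<bar>a\<bar> + 2 * \<bar>b\<bar>)"
      using mult_right_mono[OF s1, of "\<bar>a\<bar>"] by (simp add: algebra_simps)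
    also have "\<dots> < s * (s * (- c))" using s1 s2 by (intro mult_strict_left_mono) auto
    finally have "\<bar>a\<bar> + 2 * s * \<bar>b\<bar> + s\<^sup>2 * c < 0" by (simp add: power2_eq_square)
    moreover have "2 * s * b \<le> 2 * s * \<bar>b\<bar>" using s1 by (intro mult_left_mono) auto
    ultimately show False using assms[of s] by linarith
  qed
  then have c: "c > 0" using False by simp
  have "0 \<le> a + 2 * (- b / c) * b + (- b / c)\<^sup>2 * c" by (rule assms)
  also have "\<dots> = a - b\<^sup>2 / c" using c by (simp add: field_simps power2_eq_square)
  finally show ?thesis using c by (simp add: field_simps)
qed

lemma cauchy_schwarz_form:
  assumes P: "(P::real mat) \<in> carrier_mat n n" "P\<^sup>T = P" and pos: "\<And>v. v \<in> carrier_vec n \<Longrightarrow> 0 \<le> v \<bullet> (P *\<^sub>v v)"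
    and xy: "x \<in> carrier_vec n" "y \<in> carrier_vec n"
  shows "(x \<bullet> (P *\<^sub>v y))\<^sup>2 \<le> (x \<bullet> (P *\<^sub>v x)) * (y \<bullet> (P *\<^sub>v y))"
proof (rule nonneg_quadratic_discriminant)
  fix s
  have "0 \<le> (x + s \<cdot>\<^sub>v y) \<bullet> (P *\<^sub>v (x + s \<cdot>\<^sub>v y))" using xy by (intro pos) auto
  then show "0 \<le> x \<bullet> (P *\<^sub>v x) + 2 * s * (x \<bullet> (P *\<^sub>v y)) + s\<^sup>2 * (y \<bullet> (P *\<^sub>v y))"
    unfolding form_on_line[OF P xy] .
qed

text \<open>On the line through \<open>x\<close> in direction \<open>y\<close>, \<open>G\<close> is a parabola that is negative at \<open>x\<close> and opens upwards, so it has
  roots \<open>s1 < 0 < s2\<close>, at which \<open>F\<close> is nonnegative. The convex combination of the two values of \<open>F\<close> that cancels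
  the linear term is \<open>F x - s1 s2 F y\<close>, and \<open>s1 s2 = G x / G y\<close>.\<close>
lemma s_lemma_ratio:
  fixes F G :: "real vec \<Rightarrow> real"
  assumes lines: "\<And>s. F (x + s \<cdot>\<^sub>v y) = F x + 2 * s * f + s\<^sup>2 * F y" "\<And>s. G (x + s \<cdot>\<^sub>v y) = G x + 2 * s * g + s\<^sup>2 * G y"
    and imp: "\<And>s. 0 \<le> G (x + s \<cdot>\<^sub>v y) \<Longrightarrow> 0 \<le> F (x + s \<cdot>\<^sub>v y)"
    and x: "G x < 0" and y: "0 < G y"
  shows "F y * G x \<le> F x * G y"
proof -
  define D where "D = g\<^sup>2 - G x * G y"
  have "G x * G y < 0" using x y by (rule mult_neg_pos)
  then have D: "D > g\<^sup>2" unfolding D_def by simp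
  have sD: "sqrt D > \<bar>g\<bar>" using D by (intro real_less_rsqrt) simp
  have D0: "D > 0" using D zero_le_power2[of g] by linarith
  define s1 s2 where "s1 = (- g - sqrt D) / G y" and "s2 = (- g + sqrt D) / G y"
  have s: "s1 < 0" "0 < s2" using sD y by (auto simp: s1_def s2_def divide_neg_pos)
  have "(sqrt D)\<^sup>2 = D" using D0 by simp
  have prod: "s1 * s2 * G y = G x"
  proof -
    have "s1 * s2 * G y = (g\<^sup>2 - (sqrt D)\<^sup>2) / G y" using y by (simp add: s1_def s2_def field_simps power2_eq_square)
    also have "\<dots> = G x" using y \<open>(sqrt D)\<^sup>2 = D\<close> by (simp add: D_def)
    finally show ?thesis .
  qed
  have root: "G x + 2 * s * g + s\<^sup>2 * G y = 0" if "s * G y = - g + e" "e\<^sup>2 = D" for s e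
  proof -
    have "(G x + 2 * s * g + s\<^sup>2 * G y) * G y = G x * G y + 2 * g * (s * G y) + (s * G y)\<^sup>2"
      by (simp add: power2_eq_square algebra_simps)
    also have "\<dots> = G x * G y - g\<^sup>2 + e\<^sup>2" unfolding that(1) by (simp add: power2_eq_square algebra_simps)
    also have "\<dots> = 0" using that(2) by (simp add: D_def)
    finally show ?thesis using y by simp
  qed
  have "G (x + s1 \<cdot>\<^sub>v y) = 0" "G (x + s2 \<cdot>\<^sub>v y) = 0"
    unfolding lines using y \<open>(sqrt D)\<^sup>2 = D\<close>
    by (intro root[of _ "- sqrt D"] root[of _ "sqrt D"]; simp add: s1_def s2_def)+
  then have "0 \<le> F (x + s1 \<cdot>\<^sub>v y)" "0 \<le> F (x + s2 \<cdot>\<^sub>v y)" using imp by auto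
  then have "0 \<le> s2 * (F x + 2 * s1 * f + s1\<^sup>2 * F y) + (- s1) * (F x + 2 * s2 * f + s2\<^sup>2 * F y)"
    unfolding lines using s by (intro add_nonneg_nonneg[OF mult_nonneg_nonneg mult_nonneg_nonneg]) auto
  also have "\<dots> = (s2 - s1) * (F x - s1 * s2 * F y)" by (simp add: power2_eq_square algebra_simps)
  finally have "0 \<le> F x - s1 * s2 * F y" using s by (simp add: zero_le_mult_iff)
  then have "0 \<le> (F x - s1 * s2 * F y) * G y" using y by simp
  also have "\<dots> = F x * G y - F y * (s1 * s2 * G y)" by (simp add: algebra_simps)
  finally show ?thesis unfolding prod by simp
qed

text \<open>The multiplier has to satisfy \<open>F x / G x \<le> \<alpha>\<close> where \<open>G x < 0\<close> and \<open>\<alpha> \<le> F y / G y\<close> where \<open>G y > 0\<close>. By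
  \<open>s_lemma_ratio\<close> each of the lower bounds is below each of the upper bounds, so the infimum of the upper bounds
  works; the strictly feasible point makes this infimum finite. Only the behaviour of \<open>F\<close> and \<open>G\<close> on lines enters,
  which spares the construction of matrices for the forms it is applied to.\<close>
lemma s_lemma:
  fixes F G :: "real vec \<Rightarrow> real"
  assumes F: "\<And>x y. x \<in> carrier_vec n \<Longrightarrow> y \<in> carrier_vec n \<Longrightarrow> \<exists>f. \<forall>s. F (x + s \<cdot>\<^sub>v y) = F x + 2 * s * f + s\<^sup>2 * F y"
    and G: "\<And>x y. x \<in> carrier_vec n \<Longrightarrow> y \<in> carrier_vec n \<Longrightarrow> \<exists>g. \<forall>s. G (x + s \<cdot>\<^sub>v y) = G x + 2 * s * g + s\<^sup>2 * G y"
    and imp: "\<And>x. x \<in> carrier_vec n \<Longrightarrow> 0 \<le> G x \<Longrightarrow> 0 \<le> F x"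
    and slater: "y0 \<in> carrier_vec n" "0 < G y0"
  shows "\<exists>\<alpha>\<ge>0. \<forall>x\<in>carrier_vec n. 0 \<le> F x - \<alpha> * G x"
proof -
  let ?S = "{y \<in> carrier_vec n. 0 < G y}"
  define \<alpha> where "\<alpha> = (INF y\<in>?S. F y / G y)"
  have ne: "?S \<noteq> {}" using slater by auto
  have nonneg: "0 \<le> F y / G y" if "y \<in> ?S" for y using imp[of y] that by auto
  have bdd: "bdd_below ((\<lambda>y. F y / G y) ` ?S)" using nonneg by (intro bdd_belowI2[of _ 0])
  have "0 \<le> \<alpha>" unfolding \<alpha>_def by (intro cINF_greatest ne nonneg)
  moreover have "0 \<le> F x - \<alpha> * G x" if x: "x \<in> carrier_vec n" for x
  proof (cases "G x" "0 :: real" rule: linorder_cases)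
    case less
    have "F x / G x \<le> \<alpha>" unfolding \<alpha>_def
    proof (intro cINF_greatest ne)
      fix y assume y: "y \<in> ?S"
      obtain f g where fg: "\<And>s. F (x + s \<cdot>\<^sub>v y) = F x + 2 * s * f + s\<^sup>2 * F y"
        "\<And>s. G (x + s \<cdot>\<^sub>v y) = G x + 2 * s * g + s\<^sup>2 * G y" using F[OF x, of y] G[OF x, of y] y by blast
      have "F y * G x \<le> F x * G y"
        by (rule s_lemma_ratio[OF fg imp]) (use x y less in auto)
      then show "F x / G x \<le> F y / G y" using less y by (simp add: field_simps)
    qed
    then show ?thesis using less by (simp add: field_simps)
  next
    case equal
    then show ?thesis using imp[OF x] by simp
  next
    case greater
    then have "\<alpha> \<le> F x / G x" unfolding \<alpha>_def using x by (intro cINF_lower bdd) auto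
    then show ?thesis using greater by (simp add: field_simps)
  qed
  ultimately show ?thesis by blast
qed

text \<open>Write \<open>l = P e\<close>, which is possible since a definite matrix is invertible, and apply Cauchy-Schwarz to the
  inner product given by \<open>- P\<close>. This replaces a compactness argument on the unit sphere.\<close>
lemma definite_bounds_linear:
  assumes P: "(P::real mat) \<in> carrier_mat n n" "neg_def P" and l: "l \<in> carrier_vec n"
  shows "\<exists>c\<ge>0. \<forall>v\<in>carrier_vec n. (l \<bullet> v)\<^sup>2 \<le> c * - (v \<bullet> (P *\<^sub>v v))"
proof -
  have sym: "P\<^sup>T = P" and neg: "\<And>x. x \<in> carrier_vec n \<Longrightarrow> x \<noteq> 0\<^sub>v n \<Longrightarrow> x \<bullet> (P *\<^sub>v x) < 0"
    using P unfolding neg_def_def by auto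
  have nonpos: "x \<bullet> (P *\<^sub>v x) \<le> 0" if "x \<in> carrier_vec n" for x
    using neg[OF that] that P by (cases "x = 0\<^sub>v n") (auto simp: less_imp_le mult_mat_zero_vec[OF P(1)])
  have "x = 0\<^sub>v n" if "x \<in> carrier_vec n" "P *\<^sub>v x = 0\<^sub>v n" for x using neg[of x] that by fastforce
  note inv = inverse_of_inj[OF P(1) this]
  define e where "e = minv P *\<^sub>v l"
  have e: "e \<in> carrier_vec n" "P *\<^sub>v e = l"
    using inv assoc_mult_mat_vec[OF P(1) inv(1) l] l unfolding e_def by auto
  let ?P = "- P"
  have mP: "?P \<in> carrier_mat n n" "?P\<^sup>T = ?P" using P sym by (auto simp: transpose_uminus)
  have eq: "x \<bullet> (?P *\<^sub>v y) = - (x \<bullet> (P *\<^sub>v y))" if "x \<in> carrier_vec n" "y \<in> carrier_vec n" for x y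
    using that P by (subst uminus_mult_mat_vec) auto
  have "(l \<bullet> v)\<^sup>2 \<le> - (e \<bullet> l) * - (v \<bullet> (P *\<^sub>v v))" if v: "v \<in> carrier_vec n" for v
  proof -
    have "l \<bullet> v = v \<bullet> (P *\<^sub>v e)" unfolding e(2) using l v by (rule comm_scalar_prod)
    then have "l \<bullet> v = e \<bullet> (P *\<^sub>v v)" using symmetric_form_commute[OF P(1) sym e(1) v] by simp
    moreover have "(e \<bullet> (?P *\<^sub>v v))\<^sup>2 \<le> (e \<bullet> (?P *\<^sub>v e)) * (v \<bullet> (?P *\<^sub>v v))"
      using nonpos by (intro cauchy_schwarz_form[OF mP _ e(1) v]) (simp add: eq)
    ultimately show ?thesis using e v by (simp add: eq)
  qed
  moreover have "0 \<le> - (e \<bullet> l)" using nonpos[OF e(1)] e by simp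
  ultimately show ?thesis by blast
qed

text \<open>A quadratic form is a sum of products of the linear functionals \<open>v\<^sub>i\<close> and \<open>row H i \<bullet> v\<close>, each of which is
  controlled by \<open>definite_bounds_linear\<close>.\<close>
lemma definite_bounds_form:
  assumes P: "(P::real mat) \<in> carrier_mat n n" "neg_def P" and H: "H \<in> carrier_mat n n"
  shows "\<exists>c\<ge>0. \<forall>v\<in>carrier_vec n. v \<bullet> (H *\<^sub>v v) \<le> c * - (v \<bullet> (P *\<^sub>v v))"
proof -
  have "\<exists>c\<ge>0. \<forall>v\<in>carrier_vec n. v $ i * (row H i \<bullet> v) \<le> c * - (v \<bullet> (P *\<^sub>v v))" if i: "i < n" for i
  proof -
    obtain c where c: "c \<ge> 0" "\<And>v. v \<in> carrier_vec n \<Longrightarrow> (unit_vec n i \<bullet> v)\<^sup>2 \<le> c * - (v \<bullet> (P *\<^sub>v v))"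
      using definite_bounds_linear[OF P, of "unit_vec n i"] by auto
    obtain c' where c': "c' \<ge> 0" "\<And>v. v \<in> carrier_vec n \<Longrightarrow> (row H i \<bullet> v)\<^sup>2 \<le> c' * - (v \<bullet> (P *\<^sub>v v))"
      using definite_bounds_linear[OF P, of "row H i"] row_carrier_vec[OF i H] by blast
    have "v $ i * (row H i \<bullet> v) \<le> ((c + c') / 2) * - (v \<bullet> (P *\<^sub>v v))" if v: "v \<in> carrier_vec n" for v
    proof -
      have "v $ i * (row H i \<bullet> v) \<le> ((v $ i)\<^sup>2 + (row H i \<bullet> v)\<^sup>2) / 2"
        using sum_squares_bound[of "v $ i" "row H i \<bullet> v"] by simp
      moreover have "(v $ i)\<^sup>2 \<le> c * - (v \<bullet> (P *\<^sub>v v))" using c(2)[OF v] i v by simp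
      moreover note c'(2)[OF v]
      ultimately show ?thesis by (simp add: field_simps)
    qed
    then show ?thesis using c(1) c'(1) by (intro exI[of _ "(c + c') / 2"]) auto
  qed
  then obtain c where c: "\<And>i. i < n \<Longrightarrow> c i \<ge> 0"
    "\<And>i v. i < n \<Longrightarrow> v \<in> carrier_vec n \<Longrightarrow> v $ i * (row H i \<bullet> v) \<le> c i * - (v \<bullet> (P *\<^sub>v v))" by metis
  have "v \<bullet> (H *\<^sub>v v) \<le> (\<Sum>i<n. c i) * - (v \<bullet> (P *\<^sub>v v))" if v: "v \<in> carrier_vec n" for v
  proof -
    have "v \<bullet> (H *\<^sub>v v) = (\<Sum>i<n. v $ i * (row H i \<bullet> v))"
      using v H by (auto simp: scalar_prod_def[of v] atLeast0LessThan)
    also have "\<dots> \<le> (\<Sum>i<n. c i * - (v \<bullet> (P *\<^sub>v v)))" using c(2)[OF _ v] by (intro sum_mono) auto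
    finally show ?thesis by (simp add: sum_distrib_right sum_negf)
  qed
  moreover have "0 \<le> (\<Sum>i<n. c i)" using c(1) by (intro sum_nonneg) auto
  ultimately show ?thesis by blast
qed

section \<open>Bordered matrices\<close>

text \<open>Blocks of size one occur throughout; their dimension is kept as \<open>1\<close> so that the carrier facts match.\<close>
declare One_nat_def [simp del]

lemma sum_index_one: "(\<Sum>i = 0..<1::nat. f i) = f 0"
  by (simp add: One_nat_def)

abbreviation one_vec :: "real vec" where "one_vec \<equiv> vec 1 (\<lambda>_. 1)"

lemma vCons_append: "vCons t z = vec 1 (\<lambda>_. t) @\<^sub>v z"
  by (intro eq_vecI) (auto simp: vec_index_vCons append_vec_def)

lemma vCons_line:
  "dim_vec y = dim_vec x \<Longrightarrow> vCons a x + s \<cdot>\<^sub>v vCons b y = vCons (a + s * b) (x + s \<cdot>\<^sub>v y)"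
  by (intro eq_vecI) (auto simp: vec_index_vCons)

text \<open>The matrices of the robust problem act on vectors \<open>(t, z)\<close>, where \<open>t = 1\<close> gives the inhomogeneous quadratic
  function of \<open>z\<close>. The corner entry and the border are expressed through their action on vectors, so that
  products of matrices in these blocks unfold by associativity.\<close>
lemma bordered_form:
  fixes a b D :: "real mat"
  assumes c: "a \<in> carrier_mat 1 1" "b \<in> carrier_mat 1 k" "D \<in> carrier_mat k k" and z: "z \<in> carrier_vec k"
  shows "vCons t z \<bullet> (four_block_mat a b b\<^sup>T D *\<^sub>v vCons t z)
    = t\<^sup>2 * (a *\<^sub>v one_vec) $ 0 + 2 * t * (b *\<^sub>v z) $ 0 + z \<bullet> (D *\<^sub>v z)"
proof -
  let ?t = "vec 1 (\<lambda>_. t)"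
  have t: "?t \<in> carrier_vec 1" by simp
  have bt: "b\<^sup>T \<in> carrier_mat k 1" using c by simp
  have "vCons t z \<bullet> (four_block_mat a b b\<^sup>T D *\<^sub>v vCons t z)
     = ?t \<bullet> (a *\<^sub>v ?t + b *\<^sub>v z) + z \<bullet> (b\<^sup>T *\<^sub>v ?t + D *\<^sub>v z)"
    unfolding vCons_append four_block_mat_mult_vec[OF c(1,2) bt c(3) t z]
    using c z by (intro scalar_prod_append[of _ 1 _ k]) auto
  also have "z \<bullet> (b\<^sup>T *\<^sub>v ?t + D *\<^sub>v z) = z \<bullet> (b\<^sup>T *\<^sub>v ?t) + z \<bullet> (D *\<^sub>v z)"
    using c z by (intro sp_add_right) auto
  also have "z \<bullet> (b\<^sup>T *\<^sub>v ?t) = t * (b *\<^sub>v z) $ 0"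
  proof -
    have "z \<bullet> (b\<^sup>T *\<^sub>v ?t) = (b *\<^sub>v z) \<bullet> ?t" using adjoint_prod[OF bt t z] by simp
    then show ?thesis using c by (simp add: scalar_prod_def[of _ ?t] sum_index_one)
  qed
  also have "?t \<bullet> (a *\<^sub>v ?t + b *\<^sub>v z) = t * (t * (a *\<^sub>v one_vec) $ 0 + (b *\<^sub>v z) $ 0)"
    using c by (simp add: scalar_prod_def[of ?t] scalar_prod_def[of "row a 0"] sum_index_one)
  finally show ?thesis by (simp add: power2_eq_square algebra_simps)
qed

lemma bordered_symmetric:
  fixes a b D :: "real mat"
  assumes "a \<in> carrier_mat 1 1" "b \<in> carrier_mat 1 k" "D \<in> carrier_mat k k" "D\<^sup>T = D"
  shows "(four_block_mat a b b\<^sup>T D)\<^sup>T = four_block_mat a b b\<^sup>T D"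
    "four_block_mat a b b\<^sup>T D \<in> carrier_mat (Suc k) (Suc k)"
proof -
  have "a\<^sup>T = a" using assms(1) by (intro eq_matI) auto
  then show "(four_block_mat a b b\<^sup>T D)\<^sup>T = four_block_mat a b b\<^sup>T D"
    using assms by (subst transpose_four_block_mat[of _ 1 1 _ k _ k]) auto
  show "four_block_mat a b b\<^sup>T D \<in> carrier_mat (Suc k) (Suc k)"
    using four_block_carrier_mat[OF assms(1,3)] by (simp add: One_nat_def)
qed

lemma congruence_symmetric:
  assumes "(P::real mat) \<in> carrier_mat k k" "P\<^sup>T = P" "W \<in> carrier_mat k l"
  shows "(W\<^sup>T * P * W)\<^sup>T = W\<^sup>T * P * W" "W\<^sup>T * P * W \<in> carrier_mat l l"
proof -
  have c: "W\<^sup>T \<in> carrier_mat l k" "W\<^sup>T * P \<in> carrier_mat l k" using assms by auto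
  show "(W\<^sup>T * P * W)\<^sup>T = W\<^sup>T * P * W"
    unfolding transpose_mult[OF c(2) assms(3)] transpose_mult[OF c(1) assms(1)] assms(2)
    using assoc_mult_mat[OF c(1) assms(1,3)] by simp
  show "W\<^sup>T * P * W \<in> carrier_mat l l" using assms by auto
qed

lemma congruence_form:
  assumes "(P::real mat) \<in> carrier_mat k k" "W \<in> carrier_mat k l" "z \<in> carrier_vec l"
  shows "z \<bullet> ((W\<^sup>T * P * W) *\<^sub>v z) = (W *\<^sub>v z) \<bullet> (P *\<^sub>v (W *\<^sub>v z))"
proof -
  note d = carrier_matD[OF assms(1)] carrier_matD[OF assms(2)] carrier_vecD[OF assms(3)]
  have "z \<bullet> (W\<^sup>T *\<^sub>v (P *\<^sub>v (W *\<^sub>v z))) = (W *\<^sub>v z) \<bullet> (P *\<^sub>v (W *\<^sub>v z))"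
    using adjoint_prod[of "W\<^sup>T" l k "P *\<^sub>v (W *\<^sub>v z)" z] assms by auto
  then show ?thesis by (simp add: bilinear_simps d)
qed

lemma col_mat_carrier: "col_mat v \<in> carrier_mat (dim_vec v) 1"
  unfolding col_mat_def mat_of_cols_def by (simp add: One_nat_def)

lemma col_mat_mult_one: "col_mat v *\<^sub>v one_vec = v"
  by (intro eq_vecI) (auto simp: col_mat_def mat_of_cols_def scalar_prod_def sum_index_one)

lemma col_mat_transpose_mult: "dim_vec x = dim_vec v \<Longrightarrow> (col_mat v)\<^sup>T *\<^sub>v x = vec 1 (\<lambda>_. v \<bullet> x)"
  by (intro eq_vecI) (auto simp: col_mat_def)

lemma col_mat_dim: "dim_row (col_mat v) = dim_vec v" "dim_col (col_mat v) = 1"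
  by (auto simp: col_mat_def)

lemma scalar_mat_mult_one: "scalar_mat c *\<^sub>v one_vec = vec 1 (\<lambda>_. c)"
  by (intro eq_vecI) (auto simp: scalar_mat_def scalar_prod_def sum_index_one)

lemma scalar_mat_dim: "dim_row (scalar_mat c) = 1" "dim_col (scalar_mat c) = 1"
  by (auto simp: scalar_mat_def)

lemma row_mult_index: "(b::real mat) \<in> carrier_mat 1 k \<Longrightarrow> x \<in> carrier_vec k \<Longrightarrow> (b *\<^sub>v x) = vec 1 (\<lambda>_. row b 0 \<bullet> x)"
  by (intro eq_vecI) auto

lemma Phi_form:
  assumes \<Phi>12: "\<Phi>12 \<in> carrier_mat 1 k" and \<Phi>22: "\<Phi>22 \<in> carrier_mat k k" and w: "w \<in> carrier_vec k"
  shows "vCons t w \<bullet> (Phi_mat \<Phi>11 \<Phi>12 \<Phi>22 *\<^sub>v vCons t w)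
    = t\<^sup>2 * \<Phi>11 + 2 * t * (row \<Phi>12 0 \<bullet> w) + w \<bullet> (\<Phi>22 *\<^sub>v w)"
proof -
  have s: "scalar_mat \<Phi>11 \<in> carrier_mat 1 1" by (auto simp: scalar_mat_def)
  show ?thesis unfolding Phi_mat_def bordered_form[OF s \<Phi>12 \<Phi>22 w]
    using \<Phi>12 by (simp add: scalar_mat_mult_one)
qed

lemma Phi_symmetric:
  assumes \<Phi>12: "\<Phi>12 \<in> carrier_mat 1 k" and \<Phi>22: "\<Phi>22 \<in> carrier_mat k k" "\<Phi>22\<^sup>T = \<Phi>22"
  shows "(Phi_mat \<Phi>11 \<Phi>12 \<Phi>22)\<^sup>T = Phi_mat \<Phi>11 \<Phi>12 \<Phi>22" "Phi_mat \<Phi>11 \<Phi>12 \<Phi>22 \<in> carrier_mat (Suc k) (Suc k)"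
  unfolding Phi_mat_def
  by (rule bordered_symmetric[OF _ \<Phi>12 \<Phi>22], simp add: scalar_mat_def)+

text \<open>The products in \<open>Aw\<close> regrouped so that it has the shape required by \<open>bordered_form\<close>; in particular it is
  symmetric.\<close>
lemma Aw_mat_block:
  fixes \<Phi>11 :: real and \<Phi>12 \<Phi>22 Y M :: "real mat" and w0 :: "real vec"
  assumes \<Phi>12: "\<Phi>12 \<in> carrier_mat 1 k" and \<Phi>22: "\<Phi>22 \<in> carrier_mat k k" "\<Phi>22\<^sup>T = \<Phi>22"
    and Y: "Y \<in> carrier_mat k N" and M: "M \<in> carrier_mat N l" and w0: "w0 \<in> carrier_vec k"
  defines "a \<equiv> scalar_mat \<Phi>11 + (col_mat w0)\<^sup>T * \<Phi>12\<^sup>T + \<Phi>12 * col_mat w0 + (col_mat w0)\<^sup>T * \<Phi>22 * col_mat w0"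
    and "b \<equiv> - (\<Phi>12 * (Y * M)) - (col_mat w0)\<^sup>T * \<Phi>22 * (Y * M)"
  shows "Aw_mat \<Phi>11 \<Phi>12 \<Phi>22 w0 Y M = four_block_mat a b b\<^sup>T ((Y * M)\<^sup>T * \<Phi>22 * (Y * M))"
    "a \<in> carrier_mat 1 1" "b \<in> carrier_mat 1 l"
proof -
  let ?w = "col_mat w0"
  have w: "?w \<in> carrier_mat k 1" "?w\<^sup>T \<in> carrier_mat 1 k" using col_mat_carrier[of w0] w0 by auto
  have YM: "Y * M \<in> carrier_mat k l" using Y M by simp
  have T: "M\<^sup>T * Y\<^sup>T = (Y * M)\<^sup>T" using transpose_mult[OF Y M] by simp
  have wP: "?w\<^sup>T * \<Phi>22 \<in> carrier_mat 1 k" using w \<Phi>22 by simp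
  show "a \<in> carrier_mat 1 1"
    using mult_carrier_mat[OF wP w(1)] by (simp add: a_def)
  show "b \<in> carrier_mat 1 l"
    unfolding b_def by (rule minus_carrier_mat[OF mult_carrier_mat[OF wP YM]])
  have 12: "- (\<Phi>12 * Y * M) - ?w\<^sup>T * \<Phi>22 * Y * M = b"
    unfolding b_def assoc_mult_mat[OF \<Phi>12 Y M] assoc_mult_mat[OF wP Y M] ..
  have 21: "- (M\<^sup>T * Y\<^sup>T * \<Phi>12\<^sup>T) - M\<^sup>T * Y\<^sup>T * \<Phi>22 * ?w = b\<^sup>T"
  proof -
    have "(\<Phi>12 * (Y * M))\<^sup>T = (Y * M)\<^sup>T * \<Phi>12\<^sup>T" by (rule transpose_mult[OF \<Phi>12 YM])
    moreover have "(?w\<^sup>T * \<Phi>22 * (Y * M))\<^sup>T = (Y * M)\<^sup>T * \<Phi>22 * ?w"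
      unfolding transpose_mult[OF wP YM] transpose_mult[OF w(2) \<Phi>22(1)]
      using \<Phi>22 w YM by (simp add: assoc_mult_mat[of _ l k _ k _ 1])
    ultimately show ?thesis
      unfolding T b_def using \<Phi>12 \<Phi>22 w YM wP
      by (subst transpose_minus[of _ 1 l]) (auto simp: transpose_uminus)
  qed
  have 22: "M\<^sup>T * Y\<^sup>T * \<Phi>22 * Y * M = (Y * M)\<^sup>T * \<Phi>22 * (Y * M)"
    unfolding T using YM \<Phi>22 by (intro assoc_mult_mat[OF _ Y M]) auto
  show "Aw_mat \<Phi>11 \<Phi>12 \<Phi>22 w0 Y M = four_block_mat a b b\<^sup>T ((Y * M)\<^sup>T * \<Phi>22 * (Y * M))"
    unfolding Aw_mat_def Let_def 12 21 22 a_def ..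
qed

text \<open>\<open>Aw\<close> is the noise constraint pulled back along \<open>(t, z) \<mapsto> (t, t w0 - Y M z)\<close>.\<close>
lemma Aw_form:
  assumes \<Phi>12: "\<Phi>12 \<in> carrier_mat 1 k" and \<Phi>22: "\<Phi>22 \<in> carrier_mat k k" "\<Phi>22\<^sup>T = \<Phi>22"
    and Y: "Y \<in> carrier_mat k N" and M: "M \<in> carrier_mat N l" and w0: "w0 \<in> carrier_vec k" and z: "z \<in> carrier_vec l"
  shows "vCons t z \<bullet> (Aw_mat \<Phi>11 \<Phi>12 \<Phi>22 w0 Y M *\<^sub>v vCons t z)
    = vCons t (t \<cdot>\<^sub>v w0 - Y *\<^sub>v (M *\<^sub>v z)) \<bullet> (Phi_mat \<Phi>11 \<Phi>12 \<Phi>22 *\<^sub>v vCons t (t \<cdot>\<^sub>v w0 - Y *\<^sub>v (M *\<^sub>v z)))"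
proof -
  note B = Aw_mat_block(1)[OF \<Phi>12 \<Phi>22 Y M w0, where ?\<Phi>11.0 = \<Phi>11]
    Aw_mat_block(2)[OF \<Phi>12 \<Phi>22 Y M w0, where ?\<Phi>11.0 = \<Phi>11]
    Aw_mat_block(3)[OF \<Phi>12 \<Phi>22 Y M w0]
  have YM: "Y * M \<in> carrier_mat k l" using Y M by simp
  define v where "v = Y *\<^sub>v (M *\<^sub>v z)"
  have v: "v \<in> carrier_vec k" using Y M z unfolding v_def by (intro mult_mat_vec_carrier)
  have YMz: "(Y * M) *\<^sub>v z = v" unfolding v_def by (rule assoc_mult_mat_vec[OF Y M z])
  note d = carrier_matD[OF \<Phi>12] carrier_matD[OF \<Phi>22(1)] carrier_matD[OF Y] carrier_matD[OF M] carrier_vecD[OF w0]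
    carrier_vecD[OF z] carrier_vecD[OF v] col_mat_dim scalar_mat_dim
  have r: "row \<Phi>12 0 \<bullet> w0 = w0 \<bullet> row \<Phi>12 0" using \<Phi>12 w0 by (intro comm_scalar_prod[of _ k]) auto
  have r12: "\<Phi>12\<^sup>T *\<^sub>v one_vec = row \<Phi>12 0" using \<Phi>12 by (intro eq_vecI) (auto simp: scalar_prod_def sum_index_one)
  have s: "v \<bullet> (\<Phi>22 *\<^sub>v w0) = w0 \<bullet> (\<Phi>22 *\<^sub>v v)" by (rule symmetric_form_commute[OF \<Phi>22 w0 v])
  have w: "t \<cdot>\<^sub>v w0 - v \<in> carrier_vec k" using w0 v by simp
  have n: "(- (\<Phi>12 * (Y * M)) - (col_mat w0)\<^sup>T * \<Phi>22 * (Y * M)) *\<^sub>v z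
      = - vec 1 (\<lambda>_. row \<Phi>12 0 \<bullet> v) - vec 1 (\<lambda>_. w0 \<bullet> (\<Phi>22 *\<^sub>v v))"
    by (simp add: bilinear_simps d v_def[symmetric] col_mat_transpose_mult row_mult_index[OF \<Phi>12] v)
  show ?thesis
    unfolding B(1) bordered_form[OF B(2,3) congruence_symmetric(2)[OF \<Phi>22 YM] z]
      congruence_form[OF \<Phi>22(1) YM z] YMz Phi_form[OF \<Phi>12 \<Phi>22(1) w] v_def[symmetric] n
    by (simp add: bilinear_simps d col_mat_mult_one col_mat_transpose_mult scalar_mat_mult_one YMz s r r12
         row_mult_index[OF \<Phi>12] power2_eq_square algebra_simps)
qed

lemma Qga_mat_block:
  fixes \<gamma> :: real and Qb Bw Bu :: "real mat" and b e u y0 r :: "real vec"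
  assumes Qb: "Qb \<in> carrier_mat k k" "Qb\<^sup>T = Qb" and Bw: "Bw \<in> carrier_mat k l"
    and be: "b \<in> carrier_vec k" "e \<in> carrier_vec k"
  defines "a \<equiv> scalar_mat \<gamma> - (col_mat b)\<^sup>T * Qb * col_mat e - (col_mat e)\<^sup>T * Qb * col_mat b - (col_mat e)\<^sup>T * Qb * col_mat e"
    and "c \<equiv> - ((col_mat b + col_mat e)\<^sup>T * Qb * Bw)"
  shows "Bu *\<^sub>v u = b \<Longrightarrow> y0 - r = e \<Longrightarrow> Qga_mat Qb Bu Bw y0 r u \<gamma> = four_block_mat a c c\<^sup>T (- (Bw\<^sup>T * Qb * Bw))"
    "a \<in> carrier_mat 1 1" "c \<in> carrier_mat 1 l"
proof -
  let ?s = "col_mat b + col_mat e"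
  have s: "?s \<in> carrier_mat k 1" "?s\<^sup>T \<in> carrier_mat 1 k" using col_mat_carrier[of b] col_mat_carrier[of e] be by auto
  have sQ: "?s\<^sup>T * Qb \<in> carrier_mat 1 k" using s Qb by simp
  show "a \<in> carrier_mat 1 1" "c \<in> carrier_mat 1 l"
    using Qb Bw s col_mat_carrier[of b] col_mat_carrier[of e] by (auto simp: a_def c_def scalar_mat_def)
  have "(?s\<^sup>T * Qb * Bw)\<^sup>T = Bw\<^sup>T * Qb * ?s"
    unfolding transpose_mult[OF sQ Bw] transpose_mult[OF s(2) Qb(1)]
    using Qb s Bw by (simp add: assoc_mult_mat[of _ l k _ k _ 1])
  then have "- (Bw\<^sup>T * Qb * ?s) = c\<^sup>T" by (simp add: c_def transpose_uminus)
  then show "Qga_mat Qb Bu Bw y0 r u \<gamma> = four_block_mat a c c\<^sup>T (- (Bw\<^sup>T * Qb * Bw))" if "Bu *\<^sub>v u = b" "y0 - r = e"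
    unfolding Qga_mat_def Let_def that a_def c_def by simp
qed

text \<open>At \<open>t = 1\<close>: \<open>\<gamma>\<close> minus the output cost, except that the square of \<open>b\<close> is missing; it is moved
  into \<open>S\<close> and comes back with the Schur complement.\<close>
lemma Qga_form:
  assumes Qb: "Qb \<in> carrier_mat k k" "Qb\<^sup>T = Qb" and Bw: "Bw \<in> carrier_mat k l"
    and be: "b \<in> carrier_vec k" "e \<in> carrier_vec k" "Bu *\<^sub>v u = b" "y0 - r = e" and z: "z \<in> carrier_vec l"
  shows "vCons t z \<bullet> (Qga_mat Qb Bu Bw y0 r u \<gamma> *\<^sub>v vCons t z) = t\<^sup>2 * (\<gamma> + b \<bullet> (Qb *\<^sub>v b))
    - (t \<cdot>\<^sub>v (b + e) + Bw *\<^sub>v z) \<bullet> (Qb *\<^sub>v (t \<cdot>\<^sub>v (b + e) + Bw *\<^sub>v z))"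
proof -
  note B = Qga_mat_block(1)[OF Qb Bw be(1,2), where \<gamma> = \<gamma>]
    Qga_mat_block(2)[OF Qb Bw be(1,2), where \<gamma> = \<gamma>]
    Qga_mat_block(3)[OF Qb Bw be(1,2)]
  define v where "v = Bw *\<^sub>v z"
  have v: "v \<in> carrier_vec k" unfolding v_def using Bw z by (rule mult_mat_vec_carrier)
  note d = carrier_matD[OF Qb(1)] carrier_matD[OF Bw] carrier_vecD[OF be(1)] carrier_vecD[OF be(2)]
    carrier_vecD[OF z] carrier_vecD[OF v] col_mat_dim scalar_mat_dim
  have D: "- (Bw\<^sup>T * Qb * Bw) \<in> carrier_mat l l" using Bw Qb by simp
  have f: "z \<bullet> (- (Bw\<^sup>T * Qb * Bw) *\<^sub>v z) = - (v \<bullet> (Qb *\<^sub>v v))"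
    using congruence_form[OF Qb(1) Bw z] z Bw unfolding v_def by (subst uminus_mult_mat_vec) auto
  have sym: "e \<bullet> (Qb *\<^sub>v b) = b \<bullet> (Qb *\<^sub>v e)" "v \<bullet> (Qb *\<^sub>v b) = b \<bullet> (Qb *\<^sub>v v)" "v \<bullet> (Qb *\<^sub>v e) = e \<bullet> (Qb *\<^sub>v v)"
    by (rule symmetric_form_commute[OF Qb]; fact be v)+
  have T: "(col_mat b + col_mat e)\<^sup>T = (col_mat b)\<^sup>T + (col_mat e)\<^sup>T"
    using col_mat_carrier[of b] col_mat_carrier[of e] be by (intro transpose_add[of _ k 1]) auto
  have n: "(- ((col_mat b + col_mat e)\<^sup>T * Qb * Bw) *\<^sub>v z) $ 0 = - (b \<bullet> (Qb *\<^sub>v v) + e \<bullet> (Qb *\<^sub>v v))"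
    unfolding T
    by (subst uminus_mult_mat_vec) (simp_all add: d bilinear_simps col_mat_transpose_mult v_def[symmetric])
  show ?thesis
    unfolding B(1)[OF be(3,4)] bordered_form[OF B(2,3) D z] f n v_def[symmetric]
    by (simp add: bilinear_simps d col_mat_mult_one col_mat_transpose_mult scalar_mat_mult_one sym
         power2_eq_square algebra_simps)
qed

section \<open>Stage costs and the Schur complement\<close>

lemma kron_one_carrier: "Q \<in> carrier_mat p p \<Longrightarrow> kron (1\<^sub>m T) Q \<in> carrier_mat (p * T) (p * T)"
  unfolding kron_def by (simp add: mult.commute)

lemma kron_one_symmetric:
  assumes Q: "Q \<in> carrier_mat p p" "Q\<^sup>T = Q"
  shows "(kron (1\<^sub>m T) Q)\<^sup>T = kron (1\<^sub>m T) Q"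
proof (intro eq_matI)
  fix i j assume "i < dim_row (kron (1\<^sub>m T) Q)" "j < dim_col (kron (1\<^sub>m T) Q)"
  then have ij: "i < p * T" "j < p * T" using kron_one_carrier[OF Q(1), of T] by auto
  then have d: "i div p < T" "j div p < T" "i mod p < p" "j mod p < p"
    by (auto simp: less_mult_imp_div_less mult.commute intro!: mod_less_divisor gr0I)
  have "Q $$ (j mod p, i mod p) = Q\<^sup>T $$ (i mod p, j mod p)" using Q(1) d by simp
  then show "(kron (1\<^sub>m T) Q)\<^sup>T $$ (i, j) = kron (1\<^sub>m T) Q $$ (i, j)"
    using ij d Q by (auto simp: kron_def mult.commute)
qed (use kron_one_carrier[OF Q(1), of T] in auto)

lemma kron_one_form:
  assumes Q: "Q \<in> carrier_mat p p" and x: "x \<in> carrier_vec (p * T)"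
  shows "x \<bullet> (kron (1\<^sub>m T) Q *\<^sub>v x) = (\<Sum>k<T. vblock p x k \<bullet> (Q *\<^sub>v vblock p x k))"
proof -
  let ?K = "kron (1\<^sub>m T) Q"
  have row: "(?K *\<^sub>v x) $ i = (Q *\<^sub>v vblock p x (i div p)) $ (i mod p)" if i: "i < p * T" for i
  proof -
    have d: "i div p < T" "i mod p < p"
      using i by (auto simp: less_mult_imp_div_less mult.commute intro!: mod_less_divisor gr0I)
    have "(?K *\<^sub>v x) $ i = (\<Sum>j<p*T. ?K $$ (i, j) * x $ j)"
      using i x kron_one_carrier[OF Q, of T] by (auto simp: scalar_prod_def atLeast0LessThan)
    also have "\<dots> = (\<Sum>j<p*T. (if j div p = i div p then Q $$ (i mod p, j mod p) * x $ ((j div p) * p + j mod p) else 0))"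
    proof (rule sum.cong[OF refl])
      fix j assume "j \<in> {..<p*T}"
      then have "j div p < T" "j < T * p"
        by (auto simp: less_mult_imp_div_less mult.commute)
      moreover have "(i div p) * p + j mod p = j" if "j div p = i div p"
        using that div_mult_mod_eq[of j p] by metis
      ultimately show "?K $$ (i, j) * x $ j = (if j div p = i div p then Q $$ (i mod p, j mod p) * x $ ((j div p) * p + j mod p) else 0)"
        using i d Q by (cases "j div p = i div p") (simp_all add: kron_def mult.commute[of p T])
    qed
    also have "\<dots> = (\<Sum>k<T. \<Sum>b<p. (if k = i div p then Q $$ (i mod p, b) * x $ (k * p + b) else 0))"
      by (rule sum_div_mod)
    also have "\<dots> = (\<Sum>k<T. if k = i div p then (\<Sum>b<p. Q $$ (i mod p, b) * x $ (k * p + b)) else 0)"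
      by (intro sum.cong refl) auto
    also have "\<dots> = (\<Sum>b<p. Q $$ (i mod p, b) * x $ ((i div p) * p + b))" using d by simp
    also have "\<dots> = (Q *\<^sub>v vblock p x (i div p)) $ (i mod p)"
      using d Q by (simp add: vblock_def scalar_prod_def atLeast0LessThan)
    finally show ?thesis .
  qed
  have "x \<bullet> (?K *\<^sub>v x) = (\<Sum>i<p*T. x $ ((i div p) * p + i mod p) * (Q *\<^sub>v vblock p x (i div p)) $ (i mod p))"
    using x kron_one_carrier[OF Q, of T] row by (auto simp: scalar_prod_def[of x] atLeast0LessThan)
  also have "\<dots> = (\<Sum>k<T. \<Sum>a<p. x $ (k * p + a) * (Q *\<^sub>v vblock p x k) $ a)"
    by (rule sum_div_mod)
  also have "\<dots> = (\<Sum>k<T. vblock p x k \<bullet> (Q *\<^sub>v vblock p x k))"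
  proof (rule sum.cong[OF refl])
    fix k
    define w where "w = Q *\<^sub>v vblock p x k"
    have "w \<in> carrier_vec p" using Q unfolding w_def by (auto intro!: carrier_vecI)
    then have "(\<Sum>a<p. x $ (k * p + a) * w $ a) = vblock p x k \<bullet> w"
      by (auto simp: scalar_prod_def atLeast0LessThan vblock_def)
    then show "(\<Sum>a<p. x $ (k * p + a) * (Q *\<^sub>v vblock p x k) $ a) = vblock p x k \<bullet> (Q *\<^sub>v vblock p x k)"
      unfolding w_def .
  qed
  finally show ?thesis .
qed

lemma psdD: "psd A \<Longrightarrow> A \<in> carrier_mat n n \<Longrightarrow> A\<^sup>T = A"
  "psd A \<Longrightarrow> A \<in> carrier_mat n n \<Longrightarrow> x \<in> carrier_vec n \<Longrightarrow> 0 \<le> x \<bullet> (A *\<^sub>v x)"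
  unfolding psd_def by auto

lemma psd_kron_one:
  assumes Q: "Q \<in> carrier_mat p p" "psd Q"
  shows "psd (kron (1\<^sub>m T) Q)"
proof -
  have c: "kron (1\<^sub>m T) Q \<in> carrier_mat (p * T) (p * T)" by (rule kron_one_carrier[OF Q(1)])
  have "0 \<le> x \<bullet> (kron (1\<^sub>m T) Q *\<^sub>v x)" if "x \<in> carrier_vec (p * T)" for x
    unfolding kron_one_form[OF Q(1) that]
    by (intro sum_nonneg psdD(2)[OF Q(2,1)]) (simp add: vblock_def)
  then show ?thesis
    using c kron_one_symmetric[OF Q(1) psdD(1)[OF Q(2,1)], of T] unfolding psd_def by auto
qed

lemma wnorm_power2:
  assumes "Q \<in> carrier_mat p p" "psd Q" "x \<in> carrier_vec p"
  shows "(wnorm Q x)\<^sup>2 = x \<bullet> (Q *\<^sub>v x)"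
  unfolding wnorm_def using psdD(2)[OF assms(2,1,3)] by simp

text \<open>For the upper left block \<open>S\<inverse>\<close> with border \<open>(u, 0)\<close>, the form at \<open>(a, t, z)\<close> is the form of \<open>S\<close> at \<open>S\<inverse> a + t u\<close>
  plus the form of \<open>X\<close> minus \<open>t\<^sup>2 u \<bullet> S u\<close>; the first summand is nonnegative and vanishes for \<open>a = - t S u\<close>.\<close>
lemma LMI_mat_psd_iff:
  assumes S: "S \<in> carrier_mat c c" "psd S" "invertible_mat S" and u: "u \<in> carrier_vec c"
    and X: "X \<in> carrier_mat (Suc k) (Suc k)" "X\<^sup>T = X"
  shows "psd (LMI_mat S k u X) \<longleftrightarrow>
    (\<forall>t. \<forall>z\<in>carrier_vec k. t\<^sup>2 * (u \<bullet> (S *\<^sub>v u)) \<le> vCons t z \<bullet> (X *\<^sub>v vCons t z))"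
proof -
  obtain V where V: "V * S = 1\<^sub>m (dim_row V)" "S * V = 1\<^sub>m c"
    using S unfolding invertible_mat_def inverts_mat_def by auto
  have Vc: "V \<in> carrier_mat c c"
    using arg_cong[OF V(1), of dim_col] arg_cong[OF V(2), of dim_col] S(1) by auto
  have "x = 0\<^sub>v c" if x: "x \<in> carrier_vec c" "S *\<^sub>v x = 0\<^sub>v c" for x
    using assoc_mult_mat_vec[OF Vc S(1) x(1)] x V Vc by (simp add: mult_mat_zero_vec[OF Vc])
  then have inv: "minv S \<in> carrier_mat c c" "S * minv S = 1\<^sub>m c" "minv S * S = 1\<^sub>m c"
    using inverse_of_inj[OF S(1)] by blast+
  let ?I = "minv S"
  have sym: "S\<^sup>T = S" using psdD(1)[OF S(2,1)] .
  have Isym: "?I\<^sup>T = ?I"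
  proof -
    have It: "?I\<^sup>T \<in> carrier_mat c c" using inv by simp
    have "?I\<^sup>T * S = 1\<^sub>m c" using transpose_mult[OF S(1) inv(1)] inv(2) sym by simp
    then show ?thesis
      using assoc_mult_mat[OF It S(1) inv(1)] inv It by simp
  qed
  define W where "W = (col_mat u)\<^sup>T @\<^sub>r 0\<^sub>m k (dim_vec u)"
  have ut: "(col_mat u)\<^sup>T \<in> carrier_mat 1 c" using col_mat_carrier[of u] u by simp
  have W: "W \<in> carrier_mat (Suc k) c"
    unfolding W_def using carrier_append_rows[OF ut zero_carrier_mat[of k c]] u by (simp add: One_nat_def)
  have Wt: "W\<^sup>T \<in> carrier_mat c (Suc k)" using W by simp
  have z0: "0\<^sub>m k c *\<^sub>v a = 0\<^sub>v k" if "a \<in> carrier_vec c" for a :: "real vec"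
    using that by (intro eq_vecI) auto
  have Wa: "W *\<^sub>v a = vCons (u \<bullet> a) (0\<^sub>v k)" if a: "a \<in> carrier_vec c" for a
    unfolding W_def vCons_append using u a mat_mult_append[OF ut zero_carrier_mat[of k c] a]
    by (simp add: col_mat_transpose_mult z0[OF a])
  have L: "LMI_mat S k u X = four_block_mat ?I W\<^sup>T W X" unfolding LMI_mat_def Let_def W_def ..
  have Lc: "LMI_mat S k u X \<in> carrier_mat (c + Suc k) (c + Suc k)"
    unfolding L using inv X by (intro four_block_carrier_mat)
  have Lt: "(LMI_mat S k u X)\<^sup>T = LMI_mat S k u X"
    unfolding L using transpose_four_block_mat[OF inv(1) Wt W X(1)] Isym X by simp
  have form: "(a @\<^sub>v vCons t z) \<bullet> (LMI_mat S k u X *\<^sub>v (a @\<^sub>v vCons t z))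
      = a \<bullet> (?I *\<^sub>v a) + 2 * t * (u \<bullet> a) + vCons t z \<bullet> (X *\<^sub>v vCons t z)"
    if a: "a \<in> carrier_vec c" and z: "z \<in> carrier_vec k" for a t z
  proof -
    have x: "vCons t z \<in> carrier_vec (Suc k)" using z by simp
    note d = carrier_matD[OF inv(1)] carrier_matD[OF W] carrier_matD[OF X(1)] carrier_vecD[OF a] carrier_vecD[OF x] carrier_vecD[OF z]
    have 1: "vCons t z \<bullet> (W *\<^sub>v a) = t * (u \<bullet> a)" using z by (simp add: Wa[OF a])
    have 2: "a \<bullet> (W\<^sup>T *\<^sub>v vCons t z) = t * (u \<bullet> a)"
      using adjoint_prod[OF Wt x a] 1 comm_scalar_prod[OF x mult_mat_vec_carrier[OF W a]] by simp
    have "(a @\<^sub>v vCons t z) \<bullet> (LMI_mat S k u X *\<^sub>v (a @\<^sub>v vCons t z))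
      = a \<bullet> (?I *\<^sub>v a + W\<^sup>T *\<^sub>v vCons t z) + vCons t z \<bullet> (W *\<^sub>v a + X *\<^sub>v vCons t z)"
      unfolding L four_block_mat_mult_vec[OF inv(1) Wt W X(1) a x]
      using inv Wt W X a x by (intro scalar_prod_append[of _ c _ "Suc k"]) auto
    then show ?thesis using 1 2 by (simp add: sp_add_right d)
  qed
  show ?thesis
  proof
    assume p: "psd (LMI_mat S k u X)"
    show "\<forall>t. \<forall>z\<in>carrier_vec k. t\<^sup>2 * (u \<bullet> (S *\<^sub>v u)) \<le> vCons t z \<bullet> (X *\<^sub>v vCons t z)"
    proof (intro allI ballI)
      fix t and z :: "real vec" assume z: "z \<in> carrier_vec k"
      define a where "a = - t \<cdot>\<^sub>v (S *\<^sub>v u)"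
      have Su: "S *\<^sub>v u \<in> carrier_vec c" using S(1) u by (rule mult_mat_vec_carrier)
      have a: "a \<in> carrier_vec c" unfolding a_def using Su by simp
      have Ia: "?I *\<^sub>v a = - t \<cdot>\<^sub>v u"
        unfolding a_def using mult_mat_vec[OF inv(1) Su] assoc_mult_mat_vec[OF inv(1) S(1) u] inv(3) u by simp
      have comm: "(S *\<^sub>v u) \<bullet> u = u \<bullet> (S *\<^sub>v u)" using Su u by (rule comm_scalar_prod)
      have "0 \<le> (a @\<^sub>v vCons t z) \<bullet> (LMI_mat S k u X *\<^sub>v (a @\<^sub>v vCons t z))"
        using a z by (intro psdD(2)[OF p Lc] append_carrier_vec) simp_all
      also have "\<dots> = a \<bullet> (- t \<cdot>\<^sub>v u) + 2 * t * (u \<bullet> a) + vCons t z \<bullet> (X *\<^sub>v vCons t z)"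
        unfolding form[OF a z] Ia ..
      also have "a \<bullet> (- t \<cdot>\<^sub>v u) = t\<^sup>2 * (u \<bullet> (S *\<^sub>v u))"
        unfolding a_def using Su u comm carrier_vecD[OF Su] carrier_vecD[OF u] S(1) by (simp add: power2_eq_square)
      also have "u \<bullet> a = - t * (u \<bullet> (S *\<^sub>v u))"
        unfolding a_def using Su u carrier_vecD[OF Su] carrier_vecD[OF u] S(1) by simp
      finally show "t\<^sup>2 * (u \<bullet> (S *\<^sub>v u)) \<le> vCons t z \<bullet> (X *\<^sub>v vCons t z)"
        by (simp add: power2_eq_square)
    qed
  next
    assume h: "\<forall>t. \<forall>z\<in>carrier_vec k. t\<^sup>2 * (u \<bullet> (S *\<^sub>v u)) \<le> vCons t z \<bullet> (X *\<^sub>v vCons t z)"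
    have "0 \<le> x \<bullet> (LMI_mat S k u X *\<^sub>v x)" if x: "x \<in> carrier_vec (c + Suc k)" for x
    proof -
      define a where "a = vec_first x c"
      define y where "y = vec_last x (Suc k)"
      have xe: "x = a @\<^sub>v y" and a: "a \<in> carrier_vec c" and y: "y \<in> carrier_vec (Suc k)"
        using x by (auto simp: a_def y_def)
      obtain t z where y': "y = vCons t z" using y by (cases y) auto
      have z: "z \<in> carrier_vec k" using y unfolding y' by simp
      define b where "b = ?I *\<^sub>v a"
      have b: "b \<in> carrier_vec c" unfolding b_def using inv(1) a by (rule mult_mat_vec_carrier)
      have Sb: "a = S *\<^sub>v b" unfolding b_def using assoc_mult_mat_vec[OF S(1) inv(1) a] inv(2) a by simp
      have "0 \<le> (b + t \<cdot>\<^sub>v u) \<bullet> (S *\<^sub>v (b + t \<cdot>\<^sub>v u))"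
        using b u by (intro psdD(2)[OF S(2,1)]) auto
      also have "\<dots> = b \<bullet> (S *\<^sub>v b) + 2 * t * (b \<bullet> (S *\<^sub>v u)) + t\<^sup>2 * (u \<bullet> (S *\<^sub>v u))"
        by (rule form_on_line[OF S(1) sym b u])
      also have "b \<bullet> (S *\<^sub>v u) = u \<bullet> (S *\<^sub>v b)" by (rule symmetric_form_commute[OF S(1) sym u b])
      finally have "0 \<le> b \<bullet> a + 2 * t * (u \<bullet> a) + t\<^sup>2 * (u \<bullet> (S *\<^sub>v u))" unfolding Sb[symmetric] .
      also have "\<dots> \<le> b \<bullet> a + 2 * t * (u \<bullet> a) + vCons t z \<bullet> (X *\<^sub>v vCons t z)" using h z by simp
      also have "\<dots> = x \<bullet> (LMI_mat S k u X *\<^sub>v x)"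
        unfolding xe y' form[OF a z] using comm_scalar_prod[OF a b] by (simp add: b_def)
      finally show ?thesis .
    qed
    then show "psd (LMI_mat S k u X)" unfolding psd_def using Lc Lt by auto
  qed
qed

section \<open>Certificates for worst-case bounds\<close>

definition vtail :: "real vec \<Rightarrow> real vec" where
  "vtail x = vec (dim_vec x - 1) (\<lambda>i. x $ Suc i)"

lemma vtail_vCons: "vtail (vCons t z) = z"
  unfolding vtail_def by (intro eq_vecI) auto

text \<open>Let \<open>F\<close> be the slack of the bound and \<open>G\<close> the noise constraint, both made homogeneous by \<open>t\<close>. If \<open>G\<close> is positive
  somewhere, this is the S-lemma; directions at infinity (\<open>t = 0\<close>) satisfy the constraint only if \<open>W z = 0\<close>, and
  then \<open>F\<close> vanishes because \<open>Bw\<close> factors through \<open>W\<close>. Otherwise \<open>G\<close> has its maximum \<open>0\<close> at \<open>(1, z0)\<close>, so at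
  \<open>t (1, z0) + (0, h)\<close> it equals its value \<open>- e\<close> at \<open>(0, h)\<close>, a definite form in \<open>W h\<close>; there
  \<open>F = t\<^sup>2 \<sigma>0 - 2 t b - q\<close> with \<open>\<sigma>0 > 0\<close>, \<open>b\<^sup>2 \<le> c1 e\<close> and \<open>q \<le> c2 e\<close>. Completing the square shows that
  \<open>\<alpha> = c2 + c1 / \<sigma>0\<close> is a multiplier. The strict inequality in the last assumption provides \<open>\<sigma>0 > 0\<close>.\<close>
lemma robust_certificate:
  assumes \<Phi>12: "\<Phi>12 \<in> carrier_mat 1 k" and \<Phi>22: "\<Phi>22 \<in> carrier_mat k k" "neg_def \<Phi>22"
    and W: "W \<in> carrier_mat k l" and w0: "w0 \<in> carrier_vec k"
    and Qb: "Qb \<in> carrier_mat k' k'" "psd Qb" and Bw: "Bw \<in> carrier_mat k' l" and K: "K \<in> carrier_mat k' k"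
    and BK: "\<And>z. z \<in> carrier_vec l \<Longrightarrow> Bw *\<^sub>v z = K *\<^sub>v (W *\<^sub>v z)" and d: "d \<in> carrier_vec k'"
    and feasible: "z0 \<in> carrier_vec l" "noise_qc (Phi_mat \<Phi>11 \<Phi>12 \<Phi>22) (w0 - W *\<^sub>v z0)"
    and bound: "\<And>z. z \<in> carrier_vec l \<Longrightarrow> noise_qc (Phi_mat \<Phi>11 \<Phi>12 \<Phi>22) (w0 - W *\<^sub>v z) \<Longrightarrow>
      (d + Bw *\<^sub>v z) \<bullet> (Qb *\<^sub>v (d + Bw *\<^sub>v z)) < \<sigma>"
  shows "\<exists>\<alpha>\<ge>0. \<forall>t. \<forall>z\<in>carrier_vec l. 0 \<le> t\<^sup>2 * \<sigma> - (t \<cdot>\<^sub>v d + Bw *\<^sub>v z) \<bullet> (Qb *\<^sub>v (t \<cdot>\<^sub>v d + Bw *\<^sub>v z))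
    - \<alpha> * (vCons t (t \<cdot>\<^sub>v w0 - W *\<^sub>v z) \<bullet> (Phi_mat \<Phi>11 \<Phi>12 \<Phi>22 *\<^sub>v vCons t (t \<cdot>\<^sub>v w0 - W *\<^sub>v z)))"
proof -
  let ?\<Phi> = "Phi_mat \<Phi>11 \<Phi>12 \<Phi>22"
  have \<Phi>22s: "\<Phi>22\<^sup>T = \<Phi>22" and neg: "\<And>x. x \<in> carrier_vec k \<Longrightarrow> x \<noteq> 0\<^sub>v k \<Longrightarrow> x \<bullet> (\<Phi>22 *\<^sub>v x) < 0"
    using \<Phi>22 unfolding neg_def_def by auto
  note \<Phi>s = Phi_symmetric[OF \<Phi>12 \<Phi>22(1) \<Phi>22s, where ?\<Phi>11.0 = \<Phi>11]
  note Qs = psdD(1)[OF Qb(2,1)]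
  define g where "g t z = t \<cdot>\<^sub>v w0 - W *\<^sub>v z" for t z
  define f where "f t z = t \<cdot>\<^sub>v d + Bw *\<^sub>v z" for t z
  have Wz: "W *\<^sub>v z \<in> carrier_vec k" and Bz: "Bw *\<^sub>v z \<in> carrier_vec k'" if "z \<in> carrier_vec l" for z
    using W Bw that by (auto intro: mult_mat_vec_carrier)
  have gc: "g t z \<in> carrier_vec k" and fc: "f t z \<in> carrier_vec k'" if "z \<in> carrier_vec l" for t z
    using Wz[OF that] Bz[OF that] w0 d by (auto simp: g_def f_def)
  note dm = carrier_matD[OF W] carrier_matD[OF Bw] carrier_vecD[OF w0] carrier_vecD[OF d]
  have g_line: "g (t + s * t') (z + s \<cdot>\<^sub>v z') = g t z + s \<cdot>\<^sub>v g t' z'"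
    and f_line: "f (t + s * t') (z + s \<cdot>\<^sub>v z') = f t z + s \<cdot>\<^sub>v f t' z'"
    if "z \<in> carrier_vec l" "z' \<in> carrier_vec l" for t t' s z z'
    unfolding g_def f_def using carrier_vecD[OF that(1)] carrier_vecD[OF that(2)]
    by (intro eq_vecI; simp add: bilinear_simps dm sp_add_right algebra_simps)+
  define F where "F x = (x $ 0)\<^sup>2 * \<sigma> - f (x $ 0) (vtail x) \<bullet> (Qb *\<^sub>v f (x $ 0) (vtail x))" for x
  define G where "G x = vCons (x $ 0) (g (x $ 0) (vtail x)) \<bullet> (?\<Phi> *\<^sub>v vCons (x $ 0) (g (x $ 0) (vtail x)))" for x
  have FG: "F (vCons t z) = t\<^sup>2 * \<sigma> - f t z \<bullet> (Qb *\<^sub>v f t z)" "G (vCons t z) = vCons t (g t z) \<bullet> (?\<Phi> *\<^sub>v vCons t (g t z))" for t z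
    by (simp_all add: F_def G_def vtail_vCons)
  have goal: "(\<exists>\<alpha>\<ge>0. \<forall>x\<in>carrier_vec (Suc l). 0 \<le> F x - \<alpha> * G x) \<Longrightarrow> ?thesis"
    unfolding f_def[symmetric] g_def[symmetric] FG(1)[symmetric] FG(2)[symmetric] by (metis vCons_carrier_vec)
  have F_line: "F (vCons (t + s * t') (z + s \<cdot>\<^sub>v z'))
        = F (vCons t z) + 2 * s * (t * t' * \<sigma> - f t z \<bullet> (Qb *\<^sub>v f t' z')) + s\<^sup>2 * F (vCons t' z')"
    and G_line: "G (vCons (t + s * t') (z + s \<cdot>\<^sub>v z'))
        = G (vCons t z) + 2 * s * (vCons t (g t z) \<bullet> (?\<Phi> *\<^sub>v vCons t' (g t' z'))) + s\<^sup>2 * G (vCons t' z')"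
    if z: "z \<in> carrier_vec l" "z' \<in> carrier_vec l" for s t t' z z'
  proof -
    show "F (vCons (t + s * t') (z + s \<cdot>\<^sub>v z'))
        = F (vCons t z) + 2 * s * (t * t' * \<sigma> - f t z \<bullet> (Qb *\<^sub>v f t' z')) + s\<^sup>2 * F (vCons t' z')"
      unfolding FG f_line[OF z] form_on_line[OF Qb(1) Qs fc[OF z(1)] fc[OF z(2)]]
      by (simp add: power2_eq_square algebra_simps)
    have c: "vCons t (g t z) \<in> carrier_vec (Suc k)" "vCons t' (g t' z') \<in> carrier_vec (Suc k)"
      using gc z by auto
    have "vCons (t + s * t') (g (t + s * t') (z + s \<cdot>\<^sub>v z')) = vCons t (g t z) + s \<cdot>\<^sub>v vCons t' (g t' z')"
      unfolding g_line[OF z] using gc[OF z(1)] gc[OF z(2)] by (intro vCons_line[symmetric]) (metis carrier_vecD)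
    then show "G (vCons (t + s * t') (z + s \<cdot>\<^sub>v z'))
        = G (vCons t z) + 2 * s * (vCons t (g t z) \<bullet> (?\<Phi> *\<^sub>v vCons t' (g t' z'))) + s\<^sup>2 * G (vCons t' z')"
      unfolding FG using form_on_line[OF \<Phi>s(2,1) c] by simp
  qed
  have lines: "(\<exists>e. \<forall>s. F (x + s \<cdot>\<^sub>v y) = F x + 2 * s * e + s\<^sup>2 * F y) \<and> (\<exists>e. \<forall>s. G (x + s \<cdot>\<^sub>v y) = G x + 2 * s * e + s\<^sup>2 * G y)"
    if xy: "x \<in> carrier_vec (Suc l)" "y \<in> carrier_vec (Suc l)" for x y
  proof -
    obtain t z where x: "x = vCons t z" using xy(1) by (cases x) auto
    obtain t' z' where y: "y = vCons t' z'" using xy(2) by (cases y) auto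
    have z: "z \<in> carrier_vec l" "z' \<in> carrier_vec l" using xy unfolding x y by auto
    have line: "x + s \<cdot>\<^sub>v y = vCons (t + s * t') (z + s \<cdot>\<^sub>v z')" for s
      unfolding x y using z by (intro vCons_line) simp
    show ?thesis unfolding line unfolding x y using F_line[OF z] G_line[OF z] by blast
  qed
  have one: "1 \<cdot>\<^sub>v w0 = w0" "1 \<cdot>\<^sub>v d = d" by auto
  have bound1: "F (vCons 1 z) > 0" if z: "z \<in> carrier_vec l" "0 \<le> G (vCons 1 z)" for z
    using bound[OF z(1)] z(2) one unfolding FG noise_qc_def f_def g_def by simp
  have f0: "f 0 z = K *\<^sub>v (W *\<^sub>v z)" if z: "z \<in> carrier_vec l" for z
    unfolding f_def BK[OF z, symmetric] using d carrier_matD[OF Bw] by (intro eq_vecI) auto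
  have G0: "G (vCons 0 z) = (W *\<^sub>v z) \<bullet> (\<Phi>22 *\<^sub>v (W *\<^sub>v z))" if z: "z \<in> carrier_vec l" for z
  proof -
    have "g 0 z = (-1) \<cdot>\<^sub>v (W *\<^sub>v z)" unfolding g_def using w0 carrier_matD[OF W] by (intro eq_vecI) auto
    then show ?thesis
      unfolding FG Phi_form[OF \<Phi>12 \<Phi>22(1) gc[OF z]]
      using carrier_vecD[OF Wz[OF z]] carrier_matD[OF \<Phi>22(1)] by (simp add: bilinear_simps)
  qed
  show ?thesis
  proof (rule goal, cases "\<exists>y\<in>carrier_vec (Suc l). 0 < G y")
    case True
    then obtain y0 where y0: "y0 \<in> carrier_vec (Suc l)" "0 < G y0" by blast
    show "\<exists>\<alpha>\<ge>0. \<forall>x\<in>carrier_vec (Suc l). 0 \<le> F x - \<alpha> * G x"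
    proof (rule s_lemma[of "Suc l" F G, OF _ _ _ y0])
      fix x assume x: "x \<in> carrier_vec (Suc l)" and Gx: "0 \<le> G x"
      obtain t z where x': "x = vCons t z" using x by (cases x) auto
      have z: "z \<in> carrier_vec l" using x unfolding x' by simp
      show "0 \<le> F x"
      proof (cases "t = 0")
        case True
        have "W *\<^sub>v z = 0\<^sub>v k" using neg[OF Wz[OF z]] Gx unfolding x' True G0[OF z] by fastforce
        then have "f 0 z = 0\<^sub>v k'" using f0[OF z] by (simp add: mult_mat_zero_vec[OF K])
        then show ?thesis unfolding x' True FG by (simp add: mult_mat_zero_vec[OF Qb(1)])
      next
        case False
        \<comment> \<open>\<open>x = t (1, y)\<close>, and both forms are homogeneous of degree two.\<close>
        define y where "y = inverse t \<cdot>\<^sub>v z"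
        have y: "y \<in> carrier_vec l" unfolding y_def using z by simp
        have zero: "0\<^sub>v l + t \<cdot>\<^sub>v y = z" unfolding y_def using z False by (intro eq_vecI) auto
        have fg0: "f 0 (0\<^sub>v l) = 0\<^sub>v k'" "g 0 (0\<^sub>v l) = 0\<^sub>v k"
          unfolding f_def g_def mult_mat_zero_vec[OF W] mult_mat_zero_vec[OF Bw] using w0 d by (auto intro!: eq_vecI)
        have vz: "vCons 0 (0\<^sub>v k) = 0\<^sub>v (Suc k)" by (simp add: zero_vec_Suc)
        have Qv: "Qb *\<^sub>v f 1 y \<in> carrier_vec k'" using Qb(1) fc[OF y] by (rule mult_mat_vec_carrier)
        have \<Phi>v: "?\<Phi> *\<^sub>v vCons 1 (g 1 y) \<in> carrier_vec (Suc k)"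
          using \<Phi>s(2) gc[OF y] by (intro mult_mat_vec_carrier) auto
        have "F x = t\<^sup>2 * F (vCons 1 y)" "G x = t\<^sup>2 * G (vCons 1 y)"
          using F_line[OF zero_carrier_vec y, of 0 t 1] G_line[OF zero_carrier_vec y, of 0 t 1] Qv \<Phi>v
          unfolding x' zero FG(1)[of 0 "0\<^sub>v l"] FG(2)[of 0 "0\<^sub>v l"] fg0 vz
          by (simp_all add: mult_mat_zero_vec[OF Qb(1)] mult_mat_zero_vec[OF \<Phi>s(2)])
        then show ?thesis using bound1[OF y] Gx False by (auto simp: zero_le_mult_iff)
      qed
    qed (use lines in blast)+
  next
    case False
    then have Gneg: "G x \<le> 0" if "x \<in> carrier_vec (Suc l)" for x using that by force
    have Gz0: "G (vCons 1 z0) = 0"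
      using Gneg[of "vCons 1 z0"] feasible one unfolding FG noise_qc_def g_def by simp
    define \<sigma>0 where "\<sigma>0 = F (vCons 1 z0)"
    have \<sigma>0: "\<sigma>0 > 0" unfolding \<sigma>0_def using bound1[OF feasible(1)] Gz0 by simp
    have Qd: "Qb *\<^sub>v f 1 z0 \<in> carrier_vec k'" using Qb(1) fc[OF feasible(1)] by (rule mult_mat_vec_carrier)
    have "K\<^sup>T *\<^sub>v (Qb *\<^sub>v f 1 z0) \<in> carrier_vec k" using K Qd by (intro mult_mat_vec_carrier[of _ k k']) auto
    from definite_bounds_linear[OF \<Phi>22 this]
    obtain c1 where c1: "c1 \<ge> 0" "\<And>v. v \<in> carrier_vec k \<Longrightarrow>
        ((K\<^sup>T *\<^sub>v (Qb *\<^sub>v f 1 z0)) \<bullet> v)\<^sup>2 \<le> c1 * - (v \<bullet> (\<Phi>22 *\<^sub>v v))" by blast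
    from definite_bounds_form[OF \<Phi>22 congruence_symmetric(2)[OF Qb(1) Qs K]]
    obtain c2 where c2: "c2 \<ge> 0" "\<And>v. v \<in> carrier_vec k \<Longrightarrow>
        v \<bullet> (K\<^sup>T * Qb * K *\<^sub>v v) \<le> c2 * - (v \<bullet> (\<Phi>22 *\<^sub>v v))" by blast
    have "0 \<le> F x - (c2 + c1 / \<sigma>0) * G x" if x: "x \<in> carrier_vec (Suc l)" for x
    proof -
      obtain t z where x': "x = vCons t z" using x by (cases x) auto
      have z: "z \<in> carrier_vec l" using x unfolding x' by simp
      define h where "h = z - t \<cdot>\<^sub>v z0"
      have h: "h \<in> carrier_vec l" and hz: "h + t \<cdot>\<^sub>v z0 = z"
        unfolding h_def using z feasible(1) by (auto intro!: eq_vecI)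
      define v where "v = W *\<^sub>v h"
      have v: "v \<in> carrier_vec k" unfolding v_def by (rule Wz[OF h])
      define b where "b = f 0 h \<bullet> (Qb *\<^sub>v f 1 z0)"
      define e where "e = - G (vCons 0 h)"
      have e: "e = - (v \<bullet> (\<Phi>22 *\<^sub>v v))" unfolding e_def v_def G0[OF h] ..
      define \<kappa> where "\<kappa> = vCons 0 (g 0 h) \<bullet> (?\<Phi> *\<^sub>v vCons 1 (g 1 z0))"
      have Gt: "G (vCons s (h + s \<cdot>\<^sub>v z0)) = - e + 2 * s * \<kappa>" for s
        using G_line[OF h feasible(1), of 0 s 1] Gz0 unfolding e_def \<kappa>_def by simp
      \<comment> \<open>The cross term vanishes, since \<open>G\<close> would otherwise become positive on this line.\<close>
      have "(- \<kappa>)\<^sup>2 \<le> e * 0"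
      proof (rule nonneg_quadratic_discriminant)
        fix s
        have "G (vCons s (h + s \<cdot>\<^sub>v z0)) \<le> 0" using h feasible(1) by (intro Gneg) simp
        then show "0 \<le> e + 2 * s * - \<kappa> + s\<^sup>2 * 0" unfolding Gt by simp
      qed
      then have Gx: "G x = - e" using Gt[of t] unfolding x' hz by simp
      have "b = (K\<^sup>T *\<^sub>v (Qb *\<^sub>v f 1 z0)) \<bullet> v"
        unfolding b_def f0[OF h] v_def[symmetric] adjoint_prod[OF K v Qd, symmetric]
        by (rule comm_scalar_prod[OF mult_mat_vec_carrier[OF K v] Qd])
      then have b: "b\<^sup>2 \<le> c1 * e" using c1(2)[OF v] e by simp
      have q: "f 0 h \<bullet> (Qb *\<^sub>v f 0 h) \<le> c2 * e"
        using c2(2)[OF v] e unfolding congruence_form[OF Qb(1) K v] f0[OF h] v_def[symmetric] by simp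
      have Fx: "F x = - (f 0 h \<bullet> (Qb *\<^sub>v f 0 h)) - 2 * t * b + t\<^sup>2 * \<sigma>0"
        using F_line[OF h feasible(1), of 0 t 1] unfolding x' hz \<sigma>0_def b_def by (simp add: FG(1)[of 0 h])
      have "0 \<le> (t * \<sigma>0 - b)\<^sup>2 / \<sigma>0" using \<sigma>0 by simp
      also have "\<dots> = t\<^sup>2 * \<sigma>0 - 2 * t * b + b\<^sup>2 / \<sigma>0" using \<sigma>0 by (simp add: field_simps power2_eq_square)
      also have "\<dots> \<le> t\<^sup>2 * \<sigma>0 - 2 * t * b + c1 * e / \<sigma>0" using b \<sigma>0 by (simp add: divide_right_mono)
      also have "\<dots> \<le> F x - (c2 + c1 / \<sigma>0) * G x" unfolding Fx Gx using q by (simp add: algebra_simps)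
      finally show ?thesis .
    qed
    moreover have "0 \<le> c2 + c1 / \<sigma>0" using c1 c2 \<sigma>0 by simp
    ultimately show "\<exists>\<alpha>\<ge>0. \<forall>x\<in>carrier_vec (Suc l). 0 \<le> F x - \<alpha> * G x" by blast
  qed
qed

section \<open>The min-max problem as a linear matrix inequality\<close>

text \<open>Selecting rows can only enlarge the kernel, and it does not do so if the rank is kept.\<close>
lemma selected_rows_kernel:
  assumes U: "U \<in> carrier_mat a N" and F: "F \<in> carrier_mat f N" and Y: "Y \<in> carrier_mat b N"
    and P: "P \<in> carrier_mat b b" and Y1: "Y1 \<in> carrier_mat q N" and Y2: "Y2 \<in> carrier_mat q' N"
    and part: "P * Y = Y1 @\<^sub>r Y2" and rk: "mrank (U @\<^sub>r Y1 @\<^sub>r F) = mrank (U @\<^sub>r Y @\<^sub>r F)"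
    and v: "v \<in> carrier_vec N" "U *\<^sub>v v = 0\<^sub>v a" "Y1 *\<^sub>v v = 0\<^sub>v q" "F *\<^sub>v v = 0\<^sub>v f"
  shows "Y *\<^sub>v v = 0\<^sub>v b"
proof -
  have c1: "U @\<^sub>r Y1 @\<^sub>r F \<in> carrier_mat (a + (q + f)) N" using U Y1 F by auto
  have c2: "U @\<^sub>r Y @\<^sub>r F \<in> carrier_mat (a + (b + f)) N" using U Y F by auto
  have m: "(U @\<^sub>r Z @\<^sub>r F) *\<^sub>v g = U *\<^sub>v g @\<^sub>v (Z *\<^sub>v g @\<^sub>v F *\<^sub>v g)"
    if Z: "Z \<in> carrier_mat k N" and g: "g \<in> carrier_vec N" for Z k g
    unfolding mat_mult_append[OF U carrier_append_rows[OF Z F] g] mat_mult_append[OF Z F g] ..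
  have z: "0\<^sub>v (i + j) = 0\<^sub>v i @\<^sub>v (0\<^sub>v j :: real vec)" for i j by auto
  have ker: "U *\<^sub>v g @\<^sub>v (Z *\<^sub>v g @\<^sub>v F *\<^sub>v g) = 0\<^sub>v (a + (k + f)) \<longleftrightarrow> U *\<^sub>v g = 0\<^sub>v a \<and> Z *\<^sub>v g = 0\<^sub>v k \<and> F *\<^sub>v g = 0\<^sub>v f"
    if Z: "Z \<in> carrier_mat k N" and g: "g \<in> carrier_vec N" for Z k g
    unfolding z append_vec_eq[OF mult_mat_vec_carrier[OF U g] zero_carrier_vec]
      append_vec_eq[OF mult_mat_vec_carrier[OF Z g] zero_carrier_vec] ..
  have "mat_kernel (U @\<^sub>r Y @\<^sub>r F) \<subseteq> mat_kernel (U @\<^sub>r Y1 @\<^sub>r F)"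
  proof
    fix g assume "g \<in> mat_kernel (U @\<^sub>r Y @\<^sub>r F)"
    then have g: "g \<in> carrier_vec N" and g0: "(U @\<^sub>r Y @\<^sub>r F) *\<^sub>v g = 0\<^sub>v (a + (b + f))"
      using mat_kernelD[OF c2] by auto
    have g0: "U *\<^sub>v g = 0\<^sub>v a" "Y *\<^sub>v g = 0\<^sub>v b" "F *\<^sub>v g = 0\<^sub>v f"
      using g0 unfolding m[OF Y g] ker[OF Y g] by auto
    have "Y1 *\<^sub>v g @\<^sub>v Y2 *\<^sub>v g = 0\<^sub>v b"
      using assoc_mult_mat_vec[OF P Y g] g0(2) mult_mat_zero_vec[OF P]
      unfolding part mat_mult_append[OF Y1 Y2 g] by simp
    moreover have "b = q + q'" using arg_cong[OF part, of dim_row] P carrier_append_rows[OF Y1 Y2] by auto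
    ultimately have "Y1 *\<^sub>v g = 0\<^sub>v q"
      using append_vec_eq[OF mult_mat_vec_carrier[OF Y1 g] zero_carrier_vec[of q]] unfolding \<open>b = _\<close> z by blast
    then show "g \<in> mat_kernel (U @\<^sub>r Y1 @\<^sub>r F)"
      using g g0 
      by (intro mat_kernelI[OF c1 g]) (unfold m[OF Y1 g] ker[OF Y1 g], blast)
  qed
  from kernel_mono_eq_rank[OF c2 c1 this rk[symmetric]]
  have "v \<in> mat_kernel (U @\<^sub>r Y @\<^sub>r F)"
    using mat_kernelI[OF c1 v(1)] v(2-) unfolding m[OF Y1 v(1)] ker[OF Y1 v(1)] by blast
  then have "(U @\<^sub>r Y @\<^sub>r F) *\<^sub>v v = 0\<^sub>v (a + (b + f))" using mat_kernelD[OF c2] by auto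
  then show ?thesis unfolding m[OF Y v(1)] ker[OF Y v(1)] by auto
qed

context split_lti_data
begin

lemma Up_left_kernel:
  assumes w: "w \<in> carrier_vec (m * Tini)" "Up\<^sup>T *\<^sub>v w = 0\<^sub>v N"
  shows "w = 0\<^sub>v (m * Tini)"
proof -
  have "w @\<^sub>v 0\<^sub>v (m * Te) \<in> carrier_vec (m * (Tini + Te))" using w(1) by (simp add: distrib_left)
  from combination_exists[OF zero_carrier_vec this]
  obtain g where g: "g \<in> carrier_vec N" "(Up @\<^sub>r Uf) *\<^sub>v g = w @\<^sub>v 0\<^sub>v (m * Te)"
    unfolding U_part by metis
  have "Up *\<^sub>v g = w"
    using g(2) unfolding mat_mult_append[OF Up Uf g(1)]
    using append_vec_eq[OF mult_mat_vec_carrier[OF Up g(1)] w(1)] by auto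
  then have "w \<bullet> w = 0" using adjoint_prod[OF Up g(1) w(1)] w(2) g(1) by simp
  then show ?thesis using scalar_prod_self_0[OF w(1)] by simp
qed

end

lemma append_zero_rows_mult:
  assumes "F \<in> carrier_mat f N" "g \<in> carrier_vec N"
  shows "(0\<^sub>m a N @\<^sub>r 0\<^sub>m b N @\<^sub>r F) *\<^sub>v g = 0\<^sub>v a @\<^sub>v 0\<^sub>v b @\<^sub>v (F *\<^sub>v g :: real vec)"
proof -
  have z: "0\<^sub>m k N *\<^sub>v g = 0\<^sub>v k" for k using assms(2) by (intro eq_vecI) auto
  show ?thesis
    unfolding mat_mult_append[OF zero_carrier_mat carrier_append_rows[OF zero_carrier_mat assms(1)] assms(2)]
      mat_mult_append[OF zero_carrier_mat assms] z ..
qed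

lemma full_row_rank_right_inverse:
  assumes L: "L \<in> carrier_mat r N" and rk: "mrank L = r" and w: "w \<in> carrier_vec r"
  shows "L\<^sup>T * minv (L * L\<^sup>T) \<in> carrier_mat N r" "L *\<^sub>v ((L\<^sup>T * minv (L * L\<^sup>T)) *\<^sub>v w) = w"
proof -
  note R = right_inverse[OF L left_kernel_of_full_row_rank[OF L rk]]
  show c: "L\<^sup>T * minv (L * L\<^sup>T) \<in> carrier_mat N r" using R(1) by blast
  have "L * (L\<^sup>T * minv (L * L\<^sup>T)) = 1\<^sub>m r" using R(2) by blast
  then show "L *\<^sub>v ((L\<^sup>T * minv (L * L\<^sup>T)) *\<^sub>v w) = w"
    using assoc_mult_mat_vec[OF L c w] w by simp
qed

context split_lti_data
begin

text \<open>By \<open>zero_past_any_future_input\<close> some combination has zero past data and future input \<open>z\<close>.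
  The combination selected by the right inverse of \<open>\<Lambda>\<close> differs from it by a kernel vector
  of \<open>\<Lambda>\<close>. The rows of \<open>Yp\<close> that \<open>\<Lambda>\<close> omits depend on rows of \<open>\<Lambda>\<close>, and these include
  future inputs; that no output of the past reacts to them is causality.\<close>
lemma past_neutral_input:
  assumes PYc: "PY \<in> carrier_mat (p * Tini) (p * Tini)" and q: "q \<le> p * Tini"
    and Yp1: "Yp1 \<in> carrier_mat q N" and Yp2: "Yp2 \<in> carrier_mat (p * Tini - q) N"
    and PY_part: "PY * Yp = Yp1 @\<^sub>r Yp2"
    and full: "mrank (Up @\<^sub>r Yp1 @\<^sub>r Uf) = m * Tini + (q + m * Te)"
    and rank: "mrank (Up @\<^sub>r Yp1 @\<^sub>r Uf) = mrank (Up @\<^sub>r Yp @\<^sub>r Uf)"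
    and z: "z \<in> carrier_vec (m * Te)"
  defines "\<Lambda> \<equiv> Up @\<^sub>r Yp1 @\<^sub>r Uf"
  defines "w \<equiv> (\<Lambda>\<^sup>T * minv (\<Lambda> * \<Lambda>\<^sup>T)) *\<^sub>v (0\<^sub>v (m * Tini) @\<^sub>v 0\<^sub>v q @\<^sub>v z)"
  shows "Up *\<^sub>v w = 0\<^sub>v (m * Tini)" "Yp *\<^sub>v w = 0\<^sub>v (p * Tini)" "Uf *\<^sub>v w = z"
proof -
  have \<Lambda>c: "\<Lambda> \<in> carrier_mat (m * Tini + (q + m * Te)) N" unfolding \<Lambda>_def using Up Yp1 Uf by auto
  have zz: "0\<^sub>v (m * Tini) @\<^sub>v 0\<^sub>v q @\<^sub>v z \<in> carrier_vec (m * Tini + (q + m * Te))" using z by auto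
  note right = full_row_rank_right_inverse[OF \<Lambda>c full[folded \<Lambda>_def] zz, folded w_def]
  have w: "w \<in> carrier_vec N" unfolding w_def using right(1) zz by (rule mult_mat_vec_carrier)
  have "Up *\<^sub>v w @\<^sub>v Yp1 *\<^sub>v w @\<^sub>v Uf *\<^sub>v w = 0\<^sub>v (m * Tini) @\<^sub>v 0\<^sub>v q @\<^sub>v z"
    using right(2) unfolding \<Lambda>_def mat_mult_append[OF Up carrier_append_rows[OF Yp1 Uf] w] mat_mult_append[OF Yp1 Uf w] .
  then have e: "Up *\<^sub>v w = 0\<^sub>v (m * Tini)" "Yp1 *\<^sub>v w = 0\<^sub>v q" "Uf *\<^sub>v w = z"
    unfolding append_vec_eq[OF mult_mat_vec_carrier[OF Up w] zero_carrier_vec]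
      append_vec_eq[OF mult_mat_vec_carrier[OF Yp1 w] zero_carrier_vec] by auto
  then show "Up *\<^sub>v w = 0\<^sub>v (m * Tini)" "Uf *\<^sub>v w = z" by auto
  obtain v where v: "v \<in> carrier_vec N" "Up *\<^sub>v v = 0\<^sub>v (m * Tini)" "Yp *\<^sub>v v = 0\<^sub>v (p * Tini)" "Uf *\<^sub>v v = z"
    using zero_past_any_future_input[OF z] by auto
  have "Yp1 *\<^sub>v v @\<^sub>v Yp2 *\<^sub>v v = PY *\<^sub>v (Yp *\<^sub>v v)"
    unfolding assoc_mult_mat_vec[OF PYc Yp v(1), symmetric] PY_part mat_mult_append[OF Yp1 Yp2 v(1)] ..
  also have "\<dots> = 0\<^sub>v q @\<^sub>v 0\<^sub>v (p * Tini - q)" unfolding v(3) mult_mat_zero_vec[OF PYc] using q by auto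
  finally have v1: "Yp1 *\<^sub>v v = 0\<^sub>v q"
    using append_vec_eq[OF mult_mat_vec_carrier[OF Yp1 v(1)] zero_carrier_vec[of q]] by blast
  have df: "w - v \<in> carrier_vec N" using w v(1) by simp
  have "Yp *\<^sub>v (w - v) = 0\<^sub>v (p * Tini)"
  proof (rule selected_rows_kernel[OF Up Uf Yp PYc Yp1 Yp2 PY_part rank df])
    show "Up *\<^sub>v (w - v) = 0\<^sub>v (m * Tini)" "Yp1 *\<^sub>v (w - v) = 0\<^sub>v q" "Uf *\<^sub>v (w - v) = 0\<^sub>v (m * Te)"
      using mult_minus_distrib_mat_vec[OF Up w v(1)] mult_minus_distrib_mat_vec[OF Yp1 w v(1)]
        mult_minus_distrib_mat_vec[OF Uf w v(1)] e v v1 z by auto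
  qed
  then have "Yp *\<^sub>v w - 0\<^sub>v (p * Tini) = 0\<^sub>v (p * Tini)"
    using mult_minus_distrib_mat_vec[OF Yp w v(1)] v(3) by simp
  then show "Yp *\<^sub>v w = 0\<^sub>v (p * Tini)"
    using mult_mat_vec_carrier[OF Yp w] by simp
qed

end

lemma tracking_cost:
  assumes Q: "Q \<in> carrier_mat p p" "psd Q" and R: "R \<in> carrier_mat m m" "psd R"
    and y: "y \<in> carrier_vec (p * T)" and r: "r \<in> carrier_vec (p * T)" and u: "u \<in> carrier_vec (m * T)"
  shows "(\<Sum>k<T. (wnorm Q (vblock p y k - vblock p r k))\<^sup>2 + (wnorm R (vblock m u k))\<^sup>2)
    = (y - r) \<bullet> (kron (1\<^sub>m T) Q *\<^sub>v (y - r)) + u \<bullet> (kron (1\<^sub>m T) R *\<^sub>v u)"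
proof -
  have yr: "y - r \<in> carrier_vec (p * T)" using y r by simp
  have "vblock p y k - vblock p r k = vblock p (y - r) k" if k: "k < T" for k
  proof (intro eq_vecI)
    fix i assume "i < dim_vec (vblock p (y - r) k)"
    then have i: "i < p" by (simp add: vblock_def)
    have "k * p + i < Suc k * p" using i by simp
    also have "\<dots> \<le> T * p" using k by (intro mult_le_mono1) simp
    finally have "k * p + i < p * T" by (simp add: mult.commute)
    then show "(vblock p y k - vblock p r k) $ i = vblock p (y - r) k $ i"
      using i y r by (simp add: vblock_def)
  qed (simp add: vblock_def)
  then have "(wnorm Q (vblock p y k - vblock p r k))\<^sup>2 = vblock p (y - r) k \<bullet> (Q *\<^sub>v vblock p (y - r) k)" if "k < T" for k
    using that wnorm_power2[OF Q, of "vblock p (y - r) k"] by (simp add: vblock_def)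
  moreover have "(wnorm R (vblock m u k))\<^sup>2 = vblock m u k \<bullet> (R *\<^sub>v vblock m u k)" for k
    using wnorm_power2[OF R, of "vblock m u k"] by (simp add: vblock_def)
  ultimately show ?thesis
    unfolding kron_one_form[OF Q(1) yr] kron_one_form[OF R(1) u] by (simp add: sum.distrib)
qed

text \<open>A minimization over triples \<open>(u, \<gamma>, \<alpha>)\<close> in which \<open>\<gamma>\<close> is only ever an upper bound of \<open>J u\<close>
  has the same value as the minimization of \<open>J\<close> as soon as every bound strictly above \<open>J u\<close> is certified.
  The bound \<open>J u\<close> itself may fail to be certified, which can happen below
  if no noise satisfies the quadratic constraint strictly.\<close>
lemma optimum_of_certified_bounds:
  fixes J :: "'a \<Rightarrow> ereal" and L :: "('a \<times> real \<times> 'b) set"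
  assumes upper: "\<And>u \<gamma> \<alpha>. (u, \<gamma>, \<alpha>) \<in> L \<Longrightarrow> u \<in> V \<and> J u \<le> ereal \<gamma>"
    and lower: "\<And>u \<gamma>. u \<in> V \<Longrightarrow> J u < ereal \<gamma> \<Longrightarrow> \<exists>\<alpha>. (u, \<gamma>, \<alpha>) \<in> L"
  shows "(INF u \<in> V. J u) = (INF (u, \<gamma>, \<alpha>) \<in> L. ereal \<gamma>) \<and>
    (\<forall>us \<gamma>s \<alpha>s. (us, \<gamma>s, \<alpha>s) \<in> L \<and> (\<forall>(u, \<gamma>, \<alpha>) \<in> L. \<gamma>s \<le> \<gamma>) \<longrightarrow>
       us \<in> V \<and> (\<forall>u \<in> V. J us \<le> J u))"
proof -
  have same_value: "(INF u \<in> V. J u) = (INF (u, \<gamma>, \<alpha>) \<in> L. ereal \<gamma>)"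
  proof (rule antisym)
    show "(INF u \<in> V. J u) \<le> (INF (u, \<gamma>, \<alpha>) \<in> L. ereal \<gamma>)"
    proof (rule INF_greatest, clarify)
      fix u \<gamma> \<alpha> assume "(u, \<gamma>, \<alpha>) \<in> L"
      then show "(INF u \<in> V. J u) \<le> ereal \<gamma>"
        using upper by (intro INF_lower2[of u]) blast+
    qed
    show "(INF (u, \<gamma>, \<alpha>) \<in> L. ereal \<gamma>) \<le> (INF u \<in> V. J u)"
    proof (rule INF_greatest)
      fix u assume u: "u \<in> V"
      show "(INF (u, \<gamma>, \<alpha>) \<in> L. ereal \<gamma>) \<le> J u"
      proof (rule dense_ge)
        fix v assume "J u < v"
        then obtain \<gamma> where \<gamma>: "J u < ereal \<gamma>" "ereal \<gamma> < v" using ereal_dense2 by blast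
        obtain \<alpha> where "(u, \<gamma>, \<alpha>) \<in> L" using lower[OF u \<gamma>(1)] by blast
        then have "(INF (u, \<gamma>, \<alpha>) \<in> L. ereal \<gamma>) \<le> ereal \<gamma>" by (intro INF_lower2[of "(u, \<gamma>, \<alpha>)"]) auto
        then show "(INF (u, \<gamma>, \<alpha>) \<in> L. ereal \<gamma>) \<le> v" using \<gamma>(2) by simp
      qed
    qed
  qed
  moreover have "us \<in> V \<and> (\<forall>u \<in> V. J us \<le> J u)"
    if L: "(us, \<gamma>s, \<alpha>s) \<in> L" and opt: "\<forall>(u, \<gamma>, \<alpha>) \<in> L. \<gamma>s \<le> \<gamma>" for us \<gamma>s \<alpha>s
  proof -
    have "J us \<le> ereal \<gamma>s" using upper[OF L] by blast
    also have "\<dots> \<le> (INF (u, \<gamma>, \<alpha>) \<in> L. ereal \<gamma>)" using opt by (intro INF_greatest) auto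
    finally have "J us \<le> (INF u \<in> V. J u)" unfolding same_value .
    then show ?thesis using upper[OF L] by (auto simp: le_INF_iff)
  qed
  ultimately show ?thesis by blast
qed

theorem theorem12:
  fixes n m p Td Tini Te q nw N :: nat
    and th :: int
    and A B C D Q R :: "real mat"
    and ud yd um yc :: "int \<Rightarrow> real vec"
    and uini yini noise r w0 gw y0 :: "real vec"
    and \<Phi>11 :: real
    and \<Phi>12 \<Phi>22 \<Phi> Up Uf Yp Yf M PY Yp1 Yp2 \<Lambda> \<Lambda>inv Bini Bu Bw Qbar Rbar S Aw :: "real mat"
    and cost :: "real vec \<Rightarrow> real vec \<Rightarrow> real"
    and feas :: "real vec \<Rightarrow> (real vec \<times> real vec \<times> real vec) set"
    and J :: "real vec \<Rightarrow> ereal"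
    and LMI :: "(real vec \<times> real \<times> real) set"
  (* system *)
  assumes A: "A \<in> carrier_mat n n" and B: "B \<in> carrier_mat n m"
    and C: "C \<in> carrier_mat p n" and D: "D \<in> carrier_mat p m"
    and ctrb: "controllable A B" and obsv: "observable A C"
  (* historical data; N is the number of columns of the data matrices *)
    and hist: "trajectory A B C D th Td ud yd"
    and pe: "persistently_exciting m ud th Td (Tini + Te + n)"
    and lag: "lag A C \<le> Tini"
    and N: "N = Td + 1 - (Tini + Te)"
    and U_part: "hankel m ud th Td (Tini + Te) = Up @\<^sub>r Uf"
    and Up: "Up \<in> carrier_mat (m * Tini) N" and Uf: "Uf \<in> carrier_mat (m * Te) N"
    and Y_part: "hankel p yd th Td (Tini + Te) = Yp @\<^sub>r Yf"
    and Yp: "Yp \<in> carrier_mat (p * Tini) N" and Yf: "Yf \<in> carrier_mat (p * Te) N"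
  (* noise model *)
    and \<Phi>12: "\<Phi>12 \<in> carrier_mat 1 (p * Tini)"
    and \<Phi>22: "\<Phi>22 \<in> carrier_mat (p * Tini) (p * Tini)" "neg_def \<Phi>22"
    and \<Phi>: "\<Phi> = Phi_mat \<Phi>11 \<Phi>12 \<Phi>22"
  (* recent data: measured inputs um, noiseless outputs yc *)
    and recent: "trajectory A B C D (- int Tini) Tini um yc"
    and uini: "uini = stack m um (- int Tini) Tini"
    and noise: "noise \<in> carrier_vec (p * Tini)" "noise_qc \<Phi> noise"
    and yini: "yini = stack p yc (- int Tini) Tini + noise"
  (* cost data *)
    and r: "r \<in> carrier_vec (p * Te)"
    and Q: "Q \<in> carrier_mat p p" "psd Q" and R: "R \<in> carrier_mat m m" "psd R"
    and Qbar: "Qbar = kron (1\<^sub>m Te) Q" and Rbar: "Rbar = kron (1\<^sub>m Te) R"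
  (* matrices derived from the data *)
    and nw: "nw = kernel_dim Up"
    and M: "null_basis_mat Up M"
    and gw: "gw = (Up\<^sup>T * minv (Up * Up\<^sup>T)) *\<^sub>v uini"
    and w0: "w0 = yini - Yp *\<^sub>v gw"
    and Aw: "Aw = Aw_mat \<Phi>11 \<Phi>12 \<Phi>22 w0 Yp M"
    and PY: "permutation_mat (p * Tini) PY"
    and q: "q \<le> p * Tini"
    and PY_part: "PY * Yp = Yp1 @\<^sub>r Yp2"
    and Yp1: "Yp1 \<in> carrier_mat q N" and Yp2: "Yp2 \<in> carrier_mat (p * Tini - q) N"
    and \<Lambda>: "\<Lambda> = Up @\<^sub>r Yp1 @\<^sub>r Uf"
    and \<Lambda>_full: "mrank \<Lambda> = dim_row \<Lambda>"
    and \<Lambda>_rank: "mrank \<Lambda> = mrank (Up @\<^sub>r Yp @\<^sub>r Uf)"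
    and \<Lambda>inv: "\<Lambda>inv = \<Lambda>\<^sup>T * minv (\<Lambda> * \<Lambda>\<^sup>T)"
    and Bini: "Bini = Yf * (1\<^sub>m N + \<Lambda>inv * (0\<^sub>m (m * Tini) N @\<^sub>r 0\<^sub>m q N @\<^sub>r (- Uf)))"
    and Bu: "Bu = Yf * \<Lambda>inv * (0\<^sub>m (m * Tini) (m * Te) @\<^sub>r 0\<^sub>m q (m * Te) @\<^sub>r 1\<^sub>m (m * Te))"
    and Bw: "Bw = Bini * M"
    and y0: "y0 = Bini *\<^sub>v gw"
    and S: "S = Rbar + Bu\<^sup>T * Qbar * Bu"
    and S_inv: "invertible_mat S"
  (* problem (P1): J u is the optimal value of the inner maximization *)
    and cost: "\<And>u y. cost u y = (\<Sum>k<Te.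
      (wnorm Q (vblock p y k - vblock p r k))\<^sup>2 + (wnorm R (vblock m u k))\<^sup>2)"
    and feas: "\<And>u. feas u = {(w, g, y). w \<in> carrier_vec (p * Tini) \<and> g \<in> carrier_vec N \<and>
      y \<in> carrier_vec (p * Te) \<and>
      (Up @\<^sub>r Yp @\<^sub>r Uf @\<^sub>r Yf) *\<^sub>v g = uini @\<^sub>v (yini - w) @\<^sub>v u @\<^sub>v y \<and>
      noise_qc \<Phi> w}"
    and J: "\<And>u. J u = (SUP (w, g, y) \<in> feas u. ereal (cost u y))"
  (* problem (LMI): its feasible triples (u, gamma, alpha) *)
    and LMI: "LMI = {(u, \<gamma>, \<alpha>). u \<in> carrier_vec (m * Te) \<and> 0 \<le> \<alpha> \<and>
      psd (LMI_mat S nw u (Qga_mat Qbar Bu Bw y0 r u \<gamma> - \<alpha> \<cdot>\<^sub>m Aw))}"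
  shows "(INF u \<in> carrier_vec (m * Te). J u) = (INF (u, \<gamma>, \<alpha>) \<in> LMI. ereal \<gamma>) \<and>
    (\<forall>us \<gamma>s \<alpha>s. (us, \<gamma>s, \<alpha>s) \<in> LMI \<and> (\<forall>(u, \<gamma>, \<alpha>) \<in> LMI. \<gamma>s \<le> \<gamma>) \<longrightarrow>
       us \<in> carrier_vec (m * Te) \<and> (\<forall>u \<in> carrier_vec (m * Te). J us \<le> J u))"
proof -
  obtain x where x0: "x th \<in> carrier_vec n"
    and xs: "\<And>k. k \<in> {th..<th + int Td} \<Longrightarrow> x (k + 1) = A *\<^sub>v x k + B *\<^sub>v ud k"
    and ys: "\<And>k. k \<in> {th..<th + int Td} \<Longrightarrow> yd k = C *\<^sub>v x k + D *\<^sub>v ud k"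
    using hist A unfolding trajectory_def by auto
  interpret data: split_lti_data n m p Td Tini Te N A B C D th ud yd x Up Uf Yp Yf
    using A B C D ctrb hist x0 xs ys pe N U_part Up Uf Y_part Yp Yf
    by unfold_locales (auto simp: trajectory_def)
  have Mc: "M \<in> carrier_mat N nw" and UM: "\<And>z. z \<in> carrier_vec nw \<Longrightarrow> Up *\<^sub>v (M *\<^sub>v z) = 0\<^sub>v (m * Tini)"
    and ker: "\<And>g. g \<in> carrier_vec N \<Longrightarrow> Up *\<^sub>v g = 0\<^sub>v (m * Tini) \<Longrightarrow> \<exists>z\<in>carrier_vec nw. g = M *\<^sub>v z"
    using null_basisD[OF Up M] unfolding nw by auto
  have uini_c: "uini \<in> carrier_vec (m * Tini)" unfolding uini stack_def by simp
  have yini_c: "yini \<in> carrier_vec (p * Tini)" unfolding yini using noise by (simp add: stack_def)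
  have PYc: "PY \<in> carrier_mat (p * Tini) (p * Tini)" using PY unfolding permutation_mat_def by auto
  have \<Lambda>c: "\<Lambda> \<in> carrier_mat (m * Tini + (q + m * Te)) N" unfolding \<Lambda> using Up Yp1 Uf by auto
  have \<Lambda>rk: "mrank \<Lambda> = m * Tini + (q + m * Te)" using \<Lambda>_full \<Lambda>c by simp
  note lift = data.past_neutral_input[OF PYc q Yp1 Yp2 PY_part \<Lambda>rk[unfolded \<Lambda>] \<Lambda>_rank[unfolded \<Lambda>],
      folded \<Lambda>, folded \<Lambda>inv]
  have \<Lambda>inv_c: "\<Lambda>inv \<in> carrier_mat N (m * Tini + (q + m * Te))"
    unfolding \<Lambda>inv by (rule full_row_rank_right_inverse(1)[OF \<Lambda>c \<Lambda>rk zero_carrier_vec])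
  define E where "E = \<Lambda>inv * (0\<^sub>m (m * Tini) (m * Te) @\<^sub>r 0\<^sub>m q (m * Te) @\<^sub>r 1\<^sub>m (m * Te))"
  let ?I = "0\<^sub>m (m * Tini) (m * Te) @\<^sub>r 0\<^sub>m q (m * Te) @\<^sub>r (1\<^sub>m (m * Te) :: real mat)"
  have Ic: "?I \<in> carrier_mat (m * Tini + (q + m * Te)) (m * Te)" by auto
  have Ec: "E \<in> carrier_mat N (m * Te)" unfolding E_def using \<Lambda>inv_c Ic by (rule mult_carrier_mat)
  have Ez: "E *\<^sub>v z \<in> carrier_vec N" if "z \<in> carrier_vec (m * Te)" for z
    using Ec that by (rule mult_mat_vec_carrier)
  have E_eq: "E *\<^sub>v z = \<Lambda>inv *\<^sub>v (0\<^sub>v (m * Tini) @\<^sub>v 0\<^sub>v q @\<^sub>v z)" if z: "z \<in> carrier_vec (m * Te)" for z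
    unfolding E_def assoc_mult_mat_vec[OF \<Lambda>inv_c Ic z] append_zero_rows_mult[OF one_carrier_mat z] using z by simp
  \<comment> \<open>The column combination \<open>E z\<close> changes the future input by \<open>z\<close> and leaves the past data unchanged,
    so any past data \<open>g\<close> can be continued with any input.\<close>
  have E: "Up *\<^sub>v (E *\<^sub>v z) = 0\<^sub>v (m * Tini)" "Yp *\<^sub>v (E *\<^sub>v z) = 0\<^sub>v (p * Tini)" "Uf *\<^sub>v (E *\<^sub>v z) = z"
    if z: "z \<in> carrier_vec (m * Te)" for z
    unfolding E_eq[OF z] by (rule lift[OF z])+
  have Qbar_c: "Qbar \<in> carrier_mat (p * Te) (p * Te)" and Rbar_c: "Rbar \<in> carrier_mat (m * Te) (m * Te)"
    unfolding Qbar Rbar using kron_one_carrier[OF Q(1)] kron_one_carrier[OF R(1)] by auto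
  have Qbar_psd: "psd Qbar" and Rbar_psd: "psd Rbar"
    unfolding Qbar Rbar using psd_kron_one[OF Q] psd_kron_one[OF R] by auto
  have Bu_E: "Bu = Yf * E" unfolding Bu E_def by (rule assoc_mult_mat[OF Yf \<Lambda>inv_c Ic])
  have Bu_c: "Bu \<in> carrier_mat (p * Te) (m * Te)" unfolding Bu_E using Yf Ec by (rule mult_carrier_mat)
  have Bu_eq: "Bu *\<^sub>v u = Yf *\<^sub>v (E *\<^sub>v u)" if "u \<in> carrier_vec (m * Te)" for u
    unfolding Bu_E using assoc_mult_mat_vec[OF Yf Ec that] .
  let ?Z = "0\<^sub>m (m * Tini) N @\<^sub>r 0\<^sub>m q N @\<^sub>r (- Uf)"
  have Zc: "?Z \<in> carrier_mat (m * Tini + (q + m * Te)) N" using Uf by auto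
  have LZ: "\<Lambda>inv * ?Z \<in> carrier_mat N N" using \<Lambda>inv_c Zc by (rule mult_carrier_mat)
  have Bini_c: "Bini \<in> carrier_mat (p * Te) N" unfolding Bini using Yf LZ by auto
  have Bw_c: "Bw \<in> carrier_mat (p * Te) nw" unfolding Bw using Bini_c Mc by (rule mult_carrier_mat)
  have Bini_eq: "Bini *\<^sub>v g = Yf *\<^sub>v (g + E *\<^sub>v (- (Uf *\<^sub>v g)))" if g: "g \<in> carrier_vec N" for g
  proof -
    have Ufg: "Uf *\<^sub>v g \<in> carrier_vec (m * Te)" using Uf g by (rule mult_mat_vec_carrier)
    have "- Uf *\<^sub>v g = - (Uf *\<^sub>v g)" using g Uf by simp
    then have "(\<Lambda>inv * ?Z) *\<^sub>v g = E *\<^sub>v (- (Uf *\<^sub>v g))"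
      unfolding assoc_mult_mat_vec[OF \<Lambda>inv_c Zc g] using Ufg Uf g E_eq[of "- (Uf *\<^sub>v g)"]
      by (simp add: append_zero_rows_mult[of "- Uf" "m * Te" N g "m * Tini" q])
    then have "(1\<^sub>m N + \<Lambda>inv * ?Z) *\<^sub>v g = g + E *\<^sub>v (- (Uf *\<^sub>v g))"
      using add_mult_distrib_mat_vec[OF one_carrier_mat LZ g] g by simp
    then show ?thesis
      unfolding Bini using assoc_mult_mat_vec[OF Yf _ g, of "1\<^sub>m N + \<Lambda>inv * ?Z"] LZ by simp
  qed
  \<comment> \<open>\<open>Bini\<close> and \<open>Bu\<close> together evaluate the future output after the future input of \<open>g\<close> has been replaced by \<open>u\<close>.\<close>
  have response: "Bini *\<^sub>v g + Bu *\<^sub>v u = Yf *\<^sub>v (g + E *\<^sub>v (u - Uf *\<^sub>v g))"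
    if g: "g \<in> carrier_vec N" and u: "u \<in> carrier_vec (m * Te)" for g u
  proof -
    have Ufg: "Uf *\<^sub>v g \<in> carrier_vec (m * Te)" using Uf g by (rule mult_mat_vec_carrier)
    have "E *\<^sub>v (- (Uf *\<^sub>v g)) + E *\<^sub>v u = E *\<^sub>v (- (Uf *\<^sub>v g) + u)"
      using mult_add_distrib_mat_vec[OF Ec _ u, of "- (Uf *\<^sub>v g)"] Ufg by simp
    also have "- (Uf *\<^sub>v g) + u = u - Uf *\<^sub>v g" using u carrier_matD[OF Uf] by (intro eq_vecI) auto
    finally have e: "E *\<^sub>v (- (Uf *\<^sub>v g)) + E *\<^sub>v u = E *\<^sub>v (u - Uf *\<^sub>v g)" .
    have E1: "E *\<^sub>v (- (Uf *\<^sub>v g)) \<in> carrier_vec N" using Ez Ufg by simp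
    have "Bini *\<^sub>v g + Bu *\<^sub>v u = Yf *\<^sub>v ((g + E *\<^sub>v (- (Uf *\<^sub>v g))) + E *\<^sub>v u)"
      unfolding Bini_eq[OF g] Bu_eq[OF u]
      using mult_add_distrib_mat_vec[OF Yf _ Ez[OF u], of "g + E *\<^sub>v (- (Uf *\<^sub>v g))"] g E1 by simp
    also have "(g + E *\<^sub>v (- (Uf *\<^sub>v g))) + E *\<^sub>v u = g + E *\<^sub>v (u - Uf *\<^sub>v g)"
      unfolding e[symmetric] using g E1 Ez[OF u] by (rule assoc_add_vec)
    finally show ?thesis .
  qed
  have gw_c: "gw \<in> carrier_vec N" and Up_gw: "Up *\<^sub>v gw = uini"
  proof -
    have c: "Up\<^sup>T * minv (Up * Up\<^sup>T) \<in> carrier_mat N (m * Tini)" and i: "Up * (Up\<^sup>T * minv (Up * Up\<^sup>T)) = 1\<^sub>m (m * Tini)"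
      using right_inverse[OF Up data.Up_left_kernel] by blast+
    show "gw \<in> carrier_vec N" unfolding gw using c uini_c by (rule mult_mat_vec_carrier)
    show "Up *\<^sub>v gw = uini" unfolding gw using assoc_mult_mat_vec[OF Up c uini_c] i uini_c by simp
  qed
  have Yp_c: "Yp *\<^sub>v g \<in> carrier_vec (p * Tini)" and Uf_c: "Uf *\<^sub>v g \<in> carrier_vec (m * Te)"
    and Yf_c: "Yf *\<^sub>v g \<in> carrier_vec (p * Te)" and Up_c: "Up *\<^sub>v g \<in> carrier_vec (m * Tini)"
    if "g \<in> carrier_vec N" for g
    using that Yp Uf Yf Up by (auto intro: mult_mat_vec_carrier)
  have w0_c: "w0 \<in> carrier_vec (p * Tini)" unfolding w0 using yini_c Yp_c[OF gw_c] by simp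
  have y0_c: "y0 \<in> carrier_vec (p * Te)" unfolding y0 using Bini_c gw_c by (rule mult_mat_vec_carrier)
  have Mz: "M *\<^sub>v z \<in> carrier_vec N" if "z \<in> carrier_vec nw" for z
    using Mc that by (rule mult_mat_vec_carrier)
  have Bwz: "Bw *\<^sub>v z \<in> carrier_vec (p * Te)" if "z \<in> carrier_vec nw" for z
    using Bw_c that by (rule mult_mat_vec_carrier)
  have Buu: "Bu *\<^sub>v u \<in> carrier_vec (p * Te)" if "u \<in> carrier_vec (m * Te)" for u
    using Bu_c that by (rule mult_mat_vec_carrier)
  let ?W = "Yp * M"
  have W_c: "?W \<in> carrier_mat (p * Tini) nw" using Yp Mc by (rule mult_carrier_mat)
  have Wz: "?W *\<^sub>v z = Yp *\<^sub>v (M *\<^sub>v z)" if "z \<in> carrier_vec nw" for z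
    using assoc_mult_mat_vec[OF Yp Mc that] .
  \<comment> \<open>The tracking error caused by the input \<open>u\<close> and the parameter \<open>z\<close> of the past data.\<close>
  define out where "out u z = (Bu *\<^sub>v u + (y0 - r)) + Bw *\<^sub>v z" for u z
  have out_r: "Yf *\<^sub>v ((gw + M *\<^sub>v z) + E *\<^sub>v (u - Uf *\<^sub>v (gw + M *\<^sub>v z))) - r = out u z"
    if z: "z \<in> carrier_vec nw" and u: "u \<in> carrier_vec (m * Te)" for u z
  proof -
    have g: "gw + M *\<^sub>v z \<in> carrier_vec N" using gw_c Mz[OF z] by simp
    have "Bini *\<^sub>v (gw + M *\<^sub>v z) = y0 + Bw *\<^sub>v z"
      unfolding mult_add_distrib_mat_vec[OF Bini_c gw_c Mz[OF z]] y0 Bw assoc_mult_mat_vec[OF Bini_c Mc z] ..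
    then show ?thesis
      unfolding response[OF g u, symmetric] out_def using y0_c r carrier_matD[OF Bw_c] carrier_matD[OF Bu_c]
      by (intro eq_vecI) (auto simp del: index_mult_mat_vec)
  qed
  have feas_iff: "(w, g, y) \<in> feas u \<longleftrightarrow> w \<in> carrier_vec (p * Tini) \<and> g \<in> carrier_vec N \<and>
      y \<in> carrier_vec (p * Te) \<and> Up *\<^sub>v g = uini \<and> Yp *\<^sub>v g = yini - w \<and> Uf *\<^sub>v g = u \<and> Yf *\<^sub>v g = y \<and> noise_qc \<Phi> w"
    (is "_ \<longleftrightarrow> ?rhs") for w g y u
  proof -
    have "(Up @\<^sub>r Yp @\<^sub>r Uf @\<^sub>r Yf) *\<^sub>v g = uini @\<^sub>v (yini - w) @\<^sub>v u @\<^sub>v y \<longleftrightarrow>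
      Up *\<^sub>v g = uini \<and> Yp *\<^sub>v g = yini - w \<and> Uf *\<^sub>v g @\<^sub>v Yf *\<^sub>v g = u @\<^sub>v y"
      if g: "g \<in> carrier_vec N" and w: "w \<in> carrier_vec (p * Tini)"
    proof -
      have yw: "yini - w \<in> carrier_vec (p * Tini)" using yini_c w by simp
      have c1: "Uf @\<^sub>r Yf \<in> carrier_mat (m * Te + p * Te) N" using Uf Yf by auto
      have c2: "Yp @\<^sub>r Uf @\<^sub>r Yf \<in> carrier_mat (p * Tini + (m * Te + p * Te)) N" using Yp c1 by auto
      show ?thesis
        unfolding mat_mult_append[OF Up c2 g] mat_mult_append[OF Yp c1 g] mat_mult_append[OF Uf Yf g]
          append_vec_eq[OF Up_c[OF g] uini_c] append_vec_eq[OF Yp_c[OF g] yw] ..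
    qed
    moreover have "Uf *\<^sub>v g @\<^sub>v Yf *\<^sub>v g = u @\<^sub>v y \<longleftrightarrow> Uf *\<^sub>v g = u \<and> Yf *\<^sub>v g = y"
      if g: "g \<in> carrier_vec N" and y: "y \<in> carrier_vec (p * Te)"
    proof
      assume eq: "Uf *\<^sub>v g @\<^sub>v Yf *\<^sub>v g = u @\<^sub>v y"
      have "dim_vec u = m * Te"
        using arg_cong[OF eq, of dim_vec] carrier_vecD[OF Uf_c[OF g]] carrier_vecD[OF Yf_c[OF g]] carrier_vecD[OF y]
        by simp
      then show "Uf *\<^sub>v g = u \<and> Yf *\<^sub>v g = y"
        using append_vec_eq[OF Uf_c[OF g], of u] eq by (auto intro: carrier_vecI)
    qed auto
    ultimately show ?thesis unfolding feas by auto
  qed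
  have feasD: "\<exists>z\<in>carrier_vec nw. noise_qc \<Phi> (w0 - ?W *\<^sub>v z) \<and> y - r = out u z"
    if f: "(w, g, y) \<in> feas u" and u: "u \<in> carrier_vec (m * Te)" for w g y u
  proof -
    note f = f[unfolded feas_iff]
    have g: "g \<in> carrier_vec N" and w: "w \<in> carrier_vec (p * Tini)" using f by auto
    have "g - gw \<in> carrier_vec N" "Up *\<^sub>v (g - gw) = 0\<^sub>v (m * Tini)"
      using g gw_c mult_minus_distrib_mat_vec[OF Up g gw_c] Up_gw f uini_c by auto
    from ker[OF this] obtain z where z: "z \<in> carrier_vec nw" "g - gw = M *\<^sub>v z" by blast
    have gz: "gw + M *\<^sub>v z = g" unfolding z(2)[symmetric] using g gw_c by (intro eq_vecI) auto
    have "Yp *\<^sub>v gw + Yp *\<^sub>v (M *\<^sub>v z) = yini - w"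
      unfolding mult_add_distrib_mat_vec[OF Yp gw_c Mz[OF z(1)], symmetric] gz using f by simp
    then have "(Yp *\<^sub>v gw) $ i + (Yp *\<^sub>v (M *\<^sub>v z)) $ i = yini $ i - w $ i" if "i < p * Tini" for i
      using that yini_c w Yp_c[OF gw_c] Yp_c[OF Mz[OF z(1)]]
      by (metis carrier_vecD index_add_vec(1) index_minus_vec(1))
    then have "w0 - ?W *\<^sub>v z = w"
      unfolding w0 Wz[OF z(1)] using yini_c w carrier_vecD[OF Yp_c[OF gw_c]] carrier_vecD[OF Yp_c[OF Mz[OF z(1)]]]
      by (intro eq_vecI) (fastforce simp del: index_mult_mat_vec)+
    moreover have "E *\<^sub>v (u - Uf *\<^sub>v g) = 0\<^sub>v N" using f u mult_mat_zero_vec[OF Ec] by auto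
    then have "y - r = out u z" using out_r[OF z(1) u] f g unfolding gz by simp
    ultimately show ?thesis using z(1) f by auto
  qed
  have feasI: "\<exists>w g y. (w, g, y) \<in> feas u \<and> y - r = out u z"
    if z: "z \<in> carrier_vec nw" and qc: "noise_qc \<Phi> (w0 - ?W *\<^sub>v z)" and u: "u \<in> carrier_vec (m * Te)" for u z
  proof -
    define g0 where "g0 = gw + M *\<^sub>v z"
    define e where "e = E *\<^sub>v (u - Uf *\<^sub>v g0)"
    have g0: "g0 \<in> carrier_vec N" unfolding g0_def using gw_c Mz[OF z] by simp
    have ue: "u - Uf *\<^sub>v g0 \<in> carrier_vec (m * Te)" using u Uf_c[OF g0] by simp
    have e: "e \<in> carrier_vec N" unfolding e_def by (rule Ez[OF ue])
    have "Up *\<^sub>v (g0 + e) = uini"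
      using mult_add_distrib_mat_vec[OF Up g0 e] E(1)[OF ue] mult_add_distrib_mat_vec[OF Up gw_c Mz[OF z]]
        UM[OF z] Up_gw uini_c unfolding e_def g0_def by simp
    moreover have "Yp *\<^sub>v (g0 + e) = yini - (w0 - ?W *\<^sub>v z)"
    proof -
      have "Yp *\<^sub>v (g0 + e) = Yp *\<^sub>v gw + Yp *\<^sub>v (M *\<^sub>v z)"
        using mult_add_distrib_mat_vec[OF Yp g0 e] E(2)[OF ue] mult_add_distrib_mat_vec[OF Yp gw_c Mz[OF z]]
          Yp_c[OF gw_c] Yp_c[OF Mz[OF z]] unfolding e_def g0_def by simp
      also have "\<dots> = yini - (w0 - ?W *\<^sub>v z)"
        unfolding w0 Wz[OF z] using yini_c carrier_vecD[OF Yp_c[OF gw_c]] carrier_vecD[OF Yp_c[OF Mz[OF z]]]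
        by (intro eq_vecI) (auto simp del: index_mult_mat_vec)
      finally show ?thesis .
    qed
    moreover have "Uf *\<^sub>v (g0 + e) = u"
    proof -
      have "Uf *\<^sub>v (g0 + e) = Uf *\<^sub>v g0 + (u - Uf *\<^sub>v g0)"
        using mult_add_distrib_mat_vec[OF Uf g0 e] E(3)[OF ue] unfolding e_def by simp
      also have "\<dots> = u" using u carrier_vecD[OF Uf_c[OF g0]] by (intro eq_vecI) (auto simp del: index_mult_mat_vec)
      finally show ?thesis .
    qed
    moreover have "w0 - ?W *\<^sub>v z \<in> carrier_vec (p * Tini)" using w0_c mult_mat_vec_carrier[OF W_c z] by simp
    moreover have "g0 + e \<in> carrier_vec N" using g0 e by simp
    ultimately have "(w0 - ?W *\<^sub>v z, g0 + e, Yf *\<^sub>v (g0 + e)) \<in> feas u"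
      unfolding feas_iff using qc Yf_c by blast
    moreover have "Yf *\<^sub>v (g0 + e) - r = out u z" unfolding e_def g0_def by (rule out_r[OF z u])
    ultimately show ?thesis by blast
  qed
  have cost_eq: "cost u y = (y - r) \<bullet> (Qbar *\<^sub>v (y - r)) + u \<bullet> (Rbar *\<^sub>v u)"
    if "y \<in> carrier_vec (p * Te)" "u \<in> carrier_vec (m * Te)" for u y
    unfolding cost Qbar Rbar by (rule tracking_cost[OF Q R that(1) r that(2)])
  define wc where "wc u z = out u z \<bullet> (Qbar *\<^sub>v out u z) + u \<bullet> (Rbar *\<^sub>v u)" for u z
  \<comment> \<open>The inner maximization over \<open>(w, g, y)\<close> is one over \<open>z\<close>: \<open>feasD\<close> and \<open>feasI\<close> match feasible points of equal cost.\<close>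
  have J_eq: "J u = (SUP z\<in>{z \<in> carrier_vec nw. noise_qc \<Phi> (w0 - ?W *\<^sub>v z)}. ereal (wc u z))"
    if u: "u \<in> carrier_vec (m * Te)" for u
    unfolding J
  proof (rule antisym)
    show "(SUP (w, g, y)\<in>feas u. ereal (cost u y)) \<le> (SUP z\<in>{z \<in> carrier_vec nw. noise_qc \<Phi> (w0 - ?W *\<^sub>v z)}. ereal (wc u z))"
    proof (rule SUP_least, clarify)
      fix w g y assume f: "(w, g, y) \<in> feas u"
      obtain z where z: "z \<in> carrier_vec nw" "noise_qc \<Phi> (w0 - ?W *\<^sub>v z)" "y - r = out u z" using feasD[OF f u] by blast
      have "cost u y = wc u z" using cost_eq[OF _ u, of y] f z(3) unfolding feas_iff wc_def by auto
      then show "ereal (cost u y) \<le> (SUP z\<in>{z \<in> carrier_vec nw. noise_qc \<Phi> (w0 - ?W *\<^sub>v z)}. ereal (wc u z))"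
        using z by (intro SUP_upper2[of z]) auto
    qed
    show "(SUP z\<in>{z \<in> carrier_vec nw. noise_qc \<Phi> (w0 - ?W *\<^sub>v z)}. ereal (wc u z)) \<le> (SUP (w, g, y)\<in>feas u. ereal (cost u y))"
    proof (rule SUP_least, clarify)
      fix z assume z: "z \<in> carrier_vec nw" "noise_qc \<Phi> (w0 - ?W *\<^sub>v z)"
      obtain w g y where f: "(w, g, y) \<in> feas u" "y - r = out u z" using feasI[OF z u] by blast
      have "cost u y = wc u z" using cost_eq[OF _ u, of y] f unfolding feas_iff wc_def by auto
      then show "ereal (wc u z) \<le> (SUP (w, g, y)\<in>feas u. ereal (cost u y))"
        using f(1) by (intro SUP_upper2[of "(w, g, y)"]) auto
    qed
  qed
  have Qs: "Qbar\<^sup>T = Qbar" and Rs: "Rbar\<^sup>T = Rbar"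
    using psdD(1) Qbar_psd Qbar_c Rbar_psd Rbar_c by blast+
  have S_c: "S \<in> carrier_mat (m * Te) (m * Te)" unfolding S using Rbar_c Bu_c Qbar_c by auto
  have S_form: "u \<bullet> (S *\<^sub>v u) = u \<bullet> (Rbar *\<^sub>v u) + (Bu *\<^sub>v u) \<bullet> (Qbar *\<^sub>v (Bu *\<^sub>v u))"
    if u: "u \<in> carrier_vec (m * Te)" for u
    unfolding S congruence_form[OF Qbar_c Bu_c u, symmetric]
    using congruence_symmetric(2)[OF Qbar_c Qs Bu_c] Rbar_c u
    by (subst add_mult_distrib_mat_vec[of _ "m * Te" "m * Te"]) (auto intro!: scalar_prod_add_distrib[of _ "m * Te"] mult_mat_vec_carrier[of _ "m * Te" "m * Te"])
  have S_psd: "psd S"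
  proof -
    have "S\<^sup>T = S" unfolding S using transpose_add[OF Rbar_c congruence_symmetric(2)[OF Qbar_c Qs Bu_c]]
        congruence_symmetric(1)[OF Qbar_c Qs Bu_c] Rs by simp
    moreover have "0 \<le> u \<bullet> (S *\<^sub>v u)" if u: "u \<in> carrier_vec (m * Te)" for u
      unfolding S_form[OF u] using psdD(2)[OF Rbar_psd Rbar_c u] psdD(2)[OF Qbar_psd Qbar_c Buu[OF u]] by simp
    ultimately show ?thesis unfolding psd_def using S_c by auto
  qed
  have \<Phi>22s: "\<Phi>22\<^sup>T = \<Phi>22" using \<Phi>22 unfolding neg_def_def by auto
  \<comment> \<open>The slack of the bound \<open>\<gamma>\<close> minus \<open>\<alpha>\<close> times the noise constraint, at \<open>(t, z)\<close>; the Schur complement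
    supplies the input cost and completes the square of \<open>Bu u\<close>.\<close>
  define cert where "cert u \<gamma> \<alpha> t z = t\<^sup>2 * (\<gamma> - u \<bullet> (Rbar *\<^sub>v u))
      - (t \<cdot>\<^sub>v (Bu *\<^sub>v u + (y0 - r)) + Bw *\<^sub>v z) \<bullet> (Qbar *\<^sub>v (t \<cdot>\<^sub>v (Bu *\<^sub>v u + (y0 - r)) + Bw *\<^sub>v z))
      - \<alpha> * (vCons t (t \<cdot>\<^sub>v w0 - ?W *\<^sub>v z) \<bullet> (\<Phi> *\<^sub>v vCons t (t \<cdot>\<^sub>v w0 - ?W *\<^sub>v z)))" for u \<gamma> \<alpha> t z
  have LMI_iff: "(u, \<gamma>, \<alpha>) \<in> LMI \<longleftrightarrow> u \<in> carrier_vec (m * Te) \<and> 0 \<le> \<alpha> \<and> (\<forall>t. \<forall>z\<in>carrier_vec nw. 0 \<le> cert u \<gamma> \<alpha> t z)"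
    for u \<gamma> \<alpha>
  proof -
    have "psd (LMI_mat S nw u (Qga_mat Qbar Bu Bw y0 r u \<gamma> - \<alpha> \<cdot>\<^sub>m Aw)) \<longleftrightarrow> (\<forall>t. \<forall>z\<in>carrier_vec nw. 0 \<le> cert u \<gamma> \<alpha> t z)"
      if u: "u \<in> carrier_vec (m * Te)"
    proof -
      let ?X = "Qga_mat Qbar Bu Bw y0 r u \<gamma>"
      have e: "y0 - r \<in> carrier_vec (p * Te)" using y0_c r by simp
      note XB = Qga_mat_block(1)[OF Qbar_c Qs Bw_c Buu[OF u] e refl refl, where \<gamma> = \<gamma>]
      have D: "- (Bw\<^sup>T * Qbar * Bw) \<in> carrier_mat nw nw" "(- (Bw\<^sup>T * Qbar * Bw))\<^sup>T = - (Bw\<^sup>T * Qbar * Bw)"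
        using congruence_symmetric[OF Qbar_c Qs Bw_c] by (auto simp: transpose_uminus)
      have X: "?X\<^sup>T = ?X" "?X \<in> carrier_mat (Suc nw) (Suc nw)"
        unfolding XB by (rule bordered_symmetric[OF Qga_mat_block(2)[OF Qbar_c Qs Bw_c Buu[OF u] e]
            Qga_mat_block(3)[OF Qbar_c Qs Bw_c Buu[OF u] e] D])+
      have A: "Aw\<^sup>T = Aw" "Aw \<in> carrier_mat (Suc nw) (Suc nw)"
        unfolding Aw Aw_mat_block(1)[OF \<Phi>12 \<Phi>22(1) \<Phi>22s Yp Mc w0_c]
        by (rule bordered_symmetric[OF Aw_mat_block(2)[OF \<Phi>12 \<Phi>22(1) \<Phi>22s Yp Mc w0_c]
            Aw_mat_block(3)[OF \<Phi>12 \<Phi>22(1) \<Phi>22s Yp Mc w0_c] congruence_symmetric(2,1)[OF \<Phi>22(1) \<Phi>22s W_c]])+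
      have XA: "?X - \<alpha> \<cdot>\<^sub>m Aw \<in> carrier_mat (Suc nw) (Suc nw)" using X A by auto
      have XAt: "(?X - \<alpha> \<cdot>\<^sub>m Aw)\<^sup>T = ?X - \<alpha> \<cdot>\<^sub>m Aw"
      proof -
        have "(\<alpha> \<cdot>\<^sub>m Aw)\<^sup>T = \<alpha> \<cdot>\<^sub>m Aw\<^sup>T" by (intro eq_matI) auto
        then show ?thesis using transpose_minus[OF X(2), of "\<alpha> \<cdot>\<^sub>m Aw"] X A by simp
      qed
      have "vCons t z \<bullet> ((?X - \<alpha> \<cdot>\<^sub>m Aw) *\<^sub>v vCons t z) - t\<^sup>2 * (u \<bullet> (S *\<^sub>v u)) = cert u \<gamma> \<alpha> t z"
        if z: "z \<in> carrier_vec nw" for t z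
      proof -
        have x: "vCons t z \<in> carrier_vec (Suc nw)" using z by simp
        have "vCons t z \<bullet> ((?X - \<alpha> \<cdot>\<^sub>m Aw) *\<^sub>v vCons t z)
          = vCons t z \<bullet> (?X *\<^sub>v vCons t z) - \<alpha> * (vCons t z \<bullet> (Aw *\<^sub>v vCons t z))"
          using carrier_matD[OF X(2)] carrier_matD[OF A(2)] carrier_vecD[OF x] carrier_vecD[OF z] by (simp add: bilinear_simps)
        then show ?thesis
          unfolding Qga_form[OF Qbar_c Qs Bw_c Buu[OF u] e refl refl z] Aw Aw_form[OF \<Phi>12 \<Phi>22(1) \<Phi>22s Yp Mc w0_c z]
            S_form[OF u] cert_def Wz[OF z] \<Phi> by (simp add: algebra_simps)
      qed
      note eq = this
      have "t\<^sup>2 * (u \<bullet> (S *\<^sub>v u)) \<le> vCons t z \<bullet> ((?X - \<alpha> \<cdot>\<^sub>m Aw) *\<^sub>v vCons t z) \<longleftrightarrow> 0 \<le> cert u \<gamma> \<alpha> t z"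
        if "z \<in> carrier_vec nw" for t z
        unfolding eq[OF that, symmetric] by linarith
      then show ?thesis unfolding LMI_mat_psd_iff[OF S_c S_psd S_inv u XA XAt] by blast
    qed
    then show ?thesis unfolding LMI by auto
  qed
  have upper: "u \<in> carrier_vec (m * Te) \<and> J u \<le> ereal \<gamma>" if L: "(u, \<gamma>, \<alpha>) \<in> LMI" for u \<gamma> \<alpha>
  proof -
    have u: "u \<in> carrier_vec (m * Te)" and \<alpha>: "0 \<le> \<alpha>" and c: "\<And>t z. z \<in> carrier_vec nw \<Longrightarrow> 0 \<le> cert u \<gamma> \<alpha> t z"
      using L unfolding LMI_iff by auto
    have "wc u z \<le> \<gamma>" if z: "z \<in> carrier_vec nw" "noise_qc \<Phi> (w0 - ?W *\<^sub>v z)" for z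
    proof -
      have "1 \<cdot>\<^sub>v w0 = w0" "1 \<cdot>\<^sub>v (Bu *\<^sub>v u + (y0 - r)) = Bu *\<^sub>v u + (y0 - r)" by auto
      then have "cert u \<gamma> \<alpha> 1 z = \<gamma> - wc u z - \<alpha> * (vCons 1 (w0 - ?W *\<^sub>v z) \<bullet> (\<Phi> *\<^sub>v vCons 1 (w0 - ?W *\<^sub>v z)))"
        unfolding cert_def wc_def out_def by simp
      moreover have "0 \<le> \<alpha> * (vCons 1 (w0 - ?W *\<^sub>v z) \<bullet> (\<Phi> *\<^sub>v vCons 1 (w0 - ?W *\<^sub>v z)))"
        using \<alpha> z(2) unfolding noise_qc_def by simp
      ultimately show ?thesis using c[OF z(1), of 1] by linarith
    qed
    then show ?thesis using u unfolding J_eq[OF u] by (auto intro: SUP_least)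
  qed
  \<comment> \<open>The actual noise is admissible, so the inner problem is feasible for every input.\<close>
  obtain z0 where z0: "z0 \<in> carrier_vec nw" "noise_qc \<Phi> (w0 - ?W *\<^sub>v z0)"
  proof -
    obtain g where g: "g \<in> carrier_vec N" "Up *\<^sub>v g = uini" "Yp *\<^sub>v g = stack p yc (- int Tini) Tini"
      using data.past_trajectory_represented[OF recent] unfolding uini by auto
    have yn: "yini - noise = stack p yc (- int Tini) Tini"
      unfolding yini using noise(1) by (intro eq_vecI) (auto simp: stack_def)
    have "g - gw \<in> carrier_vec N" "Up *\<^sub>v (g - gw) = 0\<^sub>v (m * Tini)"
      using g gw_c mult_minus_distrib_mat_vec[OF Up g(1) gw_c] Up_gw uini_c by auto
    from ker[OF this] obtain z where z: "z \<in> carrier_vec nw" "g - gw = M *\<^sub>v z" by blast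
    have Wz: "?W *\<^sub>v z = (yini - noise) - Yp *\<^sub>v gw"
      unfolding Wz[OF z(1)] z(2)[symmetric] yn g(3)[symmetric] by (rule mult_minus_distrib_mat_vec[OF Yp g(1) gw_c])
    have "w0 - ?W *\<^sub>v z = noise"
      unfolding w0 Wz using yini_c noise(1) carrier_vecD[OF Yp_c[OF gw_c]]
      by (intro eq_vecI) (auto simp del: index_mult_mat_vec)
    then show thesis using that z(1) noise(2) by auto
  qed
  obtain K where K: "K \<in> carrier_mat (p * Te) (p * Tini)"
    "\<And>g. g \<in> carrier_vec N \<Longrightarrow> Up *\<^sub>v g = 0\<^sub>v (m * Tini) \<Longrightarrow> Uf *\<^sub>v g = 0\<^sub>v (m * Te) \<Longrightarrow> Yf *\<^sub>v g = K *\<^sub>v (Yp *\<^sub>v g)"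
    using data.free_response[OF obsv lag] by blast
  \<comment> \<open>\<open>Bw z\<close> is the future output of a combination with zero input whose past output is \<open>Yp M z\<close>.\<close>
  have BK: "Bw *\<^sub>v z = K *\<^sub>v (?W *\<^sub>v z)" if z: "z \<in> carrier_vec nw" for z
  proof -
    define e where "e = E *\<^sub>v (- (Uf *\<^sub>v (M *\<^sub>v z)))"
    have ue: "- (Uf *\<^sub>v (M *\<^sub>v z)) \<in> carrier_vec (m * Te)" using Uf_c[OF Mz[OF z]] by simp
    have e: "e \<in> carrier_vec N" unfolding e_def by (rule Ez[OF ue])
    have "Up *\<^sub>v (M *\<^sub>v z + e) = 0\<^sub>v (m * Tini)"
      unfolding mult_add_distrib_mat_vec[OF Up Mz[OF z] e] UM[OF z] using E(1)[OF ue] by (simp add: e_def)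
    moreover have "Uf *\<^sub>v (M *\<^sub>v z + e) = 0\<^sub>v (m * Te)"
      unfolding mult_add_distrib_mat_vec[OF Uf Mz[OF z] e] using E(3)[OF ue] Uf_c[OF Mz[OF z]] by (simp add: e_def)
    moreover have "Yp *\<^sub>v (M *\<^sub>v z + e) = ?W *\<^sub>v z"
      unfolding mult_add_distrib_mat_vec[OF Yp Mz[OF z] e] Wz[OF z] using E(2)[OF ue] Yp_c[OF Mz[OF z]] by (simp add: e_def)
    moreover have "Bw *\<^sub>v z = Yf *\<^sub>v (M *\<^sub>v z + e)"
      unfolding Bw assoc_mult_mat_vec[OF Bini_c Mc z] Bini_eq[OF Mz[OF z]] e_def ..
    moreover have "M *\<^sub>v z + e \<in> carrier_vec N" using Mz[OF z] e by simp
    ultimately show ?thesis using K(2) by metis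
  qed
  have lower: "\<exists>\<alpha>. (u, \<gamma>, \<alpha>) \<in> LMI" if u: "u \<in> carrier_vec (m * Te)" and less: "J u < ereal \<gamma>" for u \<gamma>
  proof -
    have "wc u z < \<gamma>" if "z \<in> carrier_vec nw" "noise_qc \<Phi> (w0 - ?W *\<^sub>v z)" for z
    proof -
      have "ereal (wc u z) \<le> J u" unfolding J_eq[OF u] using that by (intro SUP_upper) auto
      then show ?thesis using less by (metis ereal_less_eq(3) leD le_less_trans not_le)
    qed
    then have bound: "out u z \<bullet> (Qbar *\<^sub>v out u z) < \<gamma> - u \<bullet> (Rbar *\<^sub>v u)"
      if "z \<in> carrier_vec nw" "noise_qc \<Phi> (w0 - ?W *\<^sub>v z)" for z
      using that unfolding wc_def by (simp add: less_diff_eq)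
    have d: "Bu *\<^sub>v u + (y0 - r) \<in> carrier_vec (p * Te)" using Buu[OF u] y0_c r by simp
    obtain \<alpha> where "\<alpha> \<ge> 0" "\<And>t z. z \<in> carrier_vec nw \<Longrightarrow> 0 \<le> cert u \<gamma> \<alpha> t z"
      using robust_certificate[OF \<Phi>12 \<Phi>22 W_c w0_c Qbar_c Qbar_psd Bw_c K(1) BK d z0(1) z0(2)[unfolded \<Phi>]
          bound[unfolded \<Phi> out_def]] unfolding cert_def \<Phi> by blast
    then show ?thesis unfolding LMI_iff using u by blast
  qed
  show ?thesis by (rule optimum_of_certified_bounds[OF upper lower])
qed

end
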